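(* Let $\Omega\subset\mathbb{R}^d$ be a bounded domain with $C^2$ boundary, let $L$ be a reversible strict Tonelli Lagrangian on $\mathbb{R}^d$ with Hamiltonian $H$, let $F:\mathbb{R}^d\times\mathcal{P}(\overline{\Omega})\to\mathbb{R}$, $u^f$ a terminal cost and $m_0\in\mathcal{P}(\overline{\Omega})$. Assume that conditions (F1), (F2), (F3), (A2), (U), (A3) listed in the context hold. For each $T>1$, let $(u^T,m^\eta_t)$ be a mild solution of the constrained MFG system on $[0,T]$, and let $(\bar\lambda,\bar u,\bar m)$ be a solution of the constrained ergodic MFG system. Then there exists a positive constant $C'$, depending only on $L$, $F$, $u^f$ and $\Omega$, such that $$\sup_{t\in[0,T]}\Big\|\frac{u^T(t,\cdot)}{T}+\bar\lambda\Big(1-\frac tT\Big)\Big\|_{\infty,\overline{\Omega}}\le\frac{C'}{T^{\frac1{d+2}}},$$ $$\frac1T\int_0^T\big\|F(\cdot,m^\eta_s)-F(\cdot,\bar m)\big\|_{\infty,\overline{\Omega}}\,ds\le\frac{C'}{T^{\frac1{d+2}}}.$$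
   Context: Strict Tonelli Lagrangian: a $C^2$ function $L:\mathbb{R}^d\times\mathbb{R}^d\to\mathbb{R}$ for which there are constants $C_1,C_2,C_3>0$ with, for all $(x,v)$: (a) $\frac{I}{C_1}\le D^2_{vv}L(x,v)\le C_1 I$; (b) $\|D^2_{vx}L(x,v)\|\le C_2(1+|v|)$; (c) $|L(x,0)|+|D_xL(x,0)|+|D_vL(x,0)|\le C_3$. It is reversible if $L(x,v)=L(x,-v)$. Its Hamiltonian is $H(x,p)=\sup_{v}\{\langle p,v\rangle-L(x,v)\}$. $\mathcal{P}(\overline{\Omega})$: Borel probability measures on $\overline{\Omega}$; $d_1$: Kantorovich–Rubinstein (Wasserstein-1) distance. $C^2_b(\mathbb{R}^d)$: bounded functions with bounded uniformly continuous first and second derivatives; $C^1_b(U)$: analogously with first derivatives. $\nu(x)$: outward unit normal at $x\in\partial\Omega$. $\pi_1:\overline{\Omega}\times\mathbb{R}^d\to\overline{\Omega}$: projection; $\sharp$: push-forward. Assumptions: (F1) for every $m\in\mathcal{P}(\overline{\Omega})$, $x\mapsto F(x,m)$ is of class $C^2_b(\mathbb{R}^d)$, and $\mathcal{F}:=\sup_{m}\sum_{|\alpha|\le2}\|D^\alpha F(\cdot,m)\|_\infty<+\infty$. (F2) $\sup_{x\in\mathbb{R}^d,\,m_1\ne m_2}\frac{|F(x,m_1)-F(x,m_2)|}{d_1(m_1,m_2)}<+\infty$. (F3) there is $C_F>0$ such that for all $m_1,m_2\in\mathcal{P}(\overline{\Omega})$, $\int_{\overline{\Omega}}(F(x,m_1)-F(x,m_2))\,d(m_1-m_2)\ge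 C_F\int_{\overline{\Omega}}(F(x,m_1)-F(x,m_2))^2dx$. (A2) $\operatorname{argmin}_{x\in\mathbb{R}^d}(L(x,0)+F(x,m))\cap\overline{\Omega}\ne\emptyset$ for all $m\in\mathcal{P}(\overline{\Omega})$. (U) $u^f\in C^1_b(U)$, where $U\subset\mathbb{R}^d$ is open with $\overline{\Omega}\subset U$. (A3) the set-valued map $m\mapsto\operatorname{argmin}_{x\in\overline{\Omega}}\{L(x,0)+F(x,m)\}$ from $(\mathcal{P}(\overline{\Omega}),d_1)$ to $(\mathbb{R}^d,|\cdot|)$ has a Lipschitz selection, i.e. a Lipschitz map $\xi_*$ with $\xi_*(m)\in\operatorname{argmin}_{x\in\overline{\Omega}}\{L(x,0)+F(x,m)\}$; moreover $\min_{x\in\overline{\Omega}}\{L(x,0)+F(x,m)\}=0$ for every $m\in\mathcal{P}(\overline{\Omega})$. Mild solutions on $[0,T]$: let $\Gamma=\{\gamma\in AC([0,T];\mathbb{R}^d):\gamma(t)\in\overline{\Omega}\ \forall t\}$ and $\Gamma(x)=\{\gamma\in\Gamma:\gamma(0)=x\}$; let $e_t(\gamma)=\gamma(t)$. For a Borel probability measure $\eta$ on $\Gamma$ put $m^\eta_t=e_t\sharp\eta$; $\mathcal{P}_{m_0}(\Gamma)$ is the set of $\eta$ with $m^\eta_0=m_0$. Put $J_\eta[\gamma]=\int_0^T(L(\gamma,\dot\gamma)+F(\gamma(s),m^\eta_s))ds+u^f(\gamma(T))$. $\eta\in\mathcal{P}_{m_0}(\Gamma)$ is a constrained MFG equilibrium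 for $m_0$ if $\operatorname{spt}(\eta)\subset\bigcup_{x\in\overline{\Omega}}\{\gamma^*\in\Gamma(x):J_\eta[\gamma^*]=\min_{\Gamma(x)}J_\eta\}$. A pair $(u^T,m^T)\in C([0,T]\times\overline{\Omega})\times C([0,T];\mathcal{P}(\overline{\Omega}))$ is a mild solution of the constrained MFG system if there is a constrained MFG equilibrium $\eta\in\mathcal{P}_{m_0}(\Gamma)$ with $m^T(t)=m^\eta_t$ for all $t$ and $u^T(t,x)=\inf_{\gamma\in\Gamma,\gamma(t)=x}\{\int_t^T(L(\gamma,\dot\gamma)+F(\gamma(s),m^T(s)))ds+u^f(\gamma(T))\}$ for all $(t,x)\in[0,T]\times\overline{\Omega}$; it is written $(u^T,m^\eta_t)$. Ergodic system: for $m\in\mathcal{P}(\overline{\Omega})$ put $L_m(x,v)=L(x,v)+F(x,m)$. Constrained viscosity solution of $G(x,Du)=c$ on $\overline{\Omega}$: $u\in C(\overline{\Omega})$ such that for every $\varphi\in C^1(\mathbb{R}^d)$: $G(x_0,D\varphi(x_0))\le c$ at every local maximum point $x_0\in\Omega$ of $u-\varphi$, and $G(x_0,D\varphi(x_0))\ge c$ at every $x_0\in\overline{\Omega}$ which is a local minimum point of $u-\varphi$ relative to $\overline{\Omega}$. Mather (minimizing) measure for a reversible Tonelli Lagrangian $\ell$: $\mu\in\mathcal{P}(\overline{\Omega}\times\mathbb{R}^d)$ whose extension $\bar\mu(B)=\mu(B\cap(\overline{\Omega}\times\mathbb{R}^d))$ to $\mathbb{R}^d\times\mathbb{R}^d$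 is invariant under the Euler–Lagrange flow of $\ell$ (the flow of $\frac{d}{dt}D_v\ell(x,\dot x)=D_x\ell(x,\dot x)$) and with support contained in $\{(x,0)\in\overline{\Omega}\times\mathbb{R}^d:\ell(x,0)=\inf_{y\in\mathbb{R}^d}\ell(y,0)\}$. Superdifferential of $u\in C(\overline\Omega)$ at $x\in\overline\Omega$: $D^+u(x)=\{p\in\mathbb{R}^d:\limsup_{y\to x,\,y\in\overline{\Omega}}\frac{u(y)-u(x)-\langle p,y-x\rangle}{|y-x|}\le0\}$. For $x\in\partial\Omega$ write $p^\tau=p-\langle p,\nu(x)\rangle\nu(x)$, $\lambda_p(x)=\max\{\lambda:p^\tau+\lambda\nu(x)\in D^+u(x)\}$ for $p\in D^+u(x)$, and $\lambda_+(x)=\max\{\lambda_p(x):p\in D^+u(x)\}$. A $C^1$ curve $\gamma:[a,b]\to\overline{\Omega}$ is $(u,\ell,c)$-calibrated if $u(\gamma(t'))-u(\gamma(t))=\int_t^{t'}\ell(\gamma,\dot\gamma)ds+c(t'-t)$ for all $a\le t<t'\le b$. If $x\in\partial\Omega$ and $\gamma:[-\tau,\tau]\to\overline\Omega$ is $(u,\ell,c)$-calibrated with $\gamma(0)=x$, put $D^\tau u(x)=D_v\ell(x,\dot\gamma(0))-\langle D_v\ell(x,\dot\gamma(0)),\nu(x)\rangle\nu(x)$. (If $x\in\operatorname{spt}(\bar m)$ below, the constant curve at $x$ is $(\bar u,L_{\bar m},\bar\lambda)$-calibrated.) Solution of the constrained ergodic MFG system: a triple $(\bar\lambda,\bar u,\bar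 m)\in\mathbb{R}\times C(\overline{\Omega})\times\mathcal{P}(\overline{\Omega})$ such that (1) $\bar u$ is a constrained viscosity solution on $\overline{\Omega}$ of $H(x,Du)=F(x,\bar m)+\bar\lambda$; (2) $D\bar u(x)$ exists for $\bar m$-a.e. $x\in\overline{\Omega}$ (at boundary points, differentiability is understood relative to $\overline\Omega$); (3) $\bar m=\pi_1\sharp\eta_{\bar m}$ for some minimizing (Mather) measure $\eta_{\bar m}$ for $L_{\bar m}$; (4) $\int_{\overline{\Omega}}\langle Df(x),V(x)\rangle\,d\bar m(x)=0$ for all $f\in C^\infty(\overline{\Omega})$ with $\operatorname{spt}(f)\subset\Omega$, where $V(x)=D_pH(x,D\bar u(x))$ if $x\in\Omega\cap\operatorname{spt}(\bar m)$ (where $D\bar u(x)$ exists), and $V(x)=D_pH(x,D^\tau\bar u(x)+\lambda_+(x)\nu(x))$ if $x\in\partial\Omega\cap\operatorname{spt}(\bar m)$, with $D^\tau\bar u$, $\lambda_+$ defined for $u=\bar u$. *)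

theory Defs
  imports "HOL-Probability.Probability"
begin

section \<open>Calculus\<close>

text \<open>The ambient space \<open>\<real>\<^sup>d\<close> is a Euclidean space \<open>'a\<close> with \<open>d = DIM('a)\<close>.\<close>

text \<open>Passing \<open>at x within S\<close> as the filter gives the gradient relative to \<open>S\<close>.\<close>

definition grad :: "('a::euclidean_space \<Rightarrow> real) \<Rightarrow> 'a filter \<Rightarrow> 'a" where
  "grad f A = (THE g. (f has_derivative (\<lambda>h. h \<bullet> g)) A)"

text \<open>Iterated partial derivatives are indexed by lists of coordinate directions.\<close>

primrec pderivs :: "'a::euclidean_space list \<Rightarrow> ('a \<Rightarrow> real) \<Rightarrow> 'a \<Rightarrow> real" where
  "pderivs [] f = f"
| "pderivs (b # bs) f = (\<lambda>x. frechet_derivative (pderivs bs f) (at x) b)"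

definition dirs :: "nat \<Rightarrow> 'a::euclidean_space list set" where
  "dirs k = {bs. set bs \<subseteq> Basis \<and> length bs \<le> k}"

definition Ck_on :: "nat \<Rightarrow> ('a::euclidean_space \<Rightarrow> real) \<Rightarrow> 'a set \<Rightarrow> bool" where
  "Ck_on k f U \<longleftrightarrow>
     (\<forall>bs\<in>dirs k. continuous_on U (pderivs bs f) \<and>
        (length bs < k \<longrightarrow> (\<forall>x\<in>U. pderivs bs f differentiable at x)))"

definition Ckb_on :: "nat \<Rightarrow> ('a::euclidean_space \<Rightarrow> real) \<Rightarrow> 'a set \<Rightarrow> bool" where
  "Ckb_on k f U \<longleftrightarrow> Ck_on k f U \<and>
     (\<forall>bs\<in>dirs k. bounded (pderivs bs f ` U) \<and>
        (bs \<noteq> [] \<longrightarrow> uniformly_continuous_on U (pderivs bs f)))"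

definition sup_norm :: "'b set \<Rightarrow> ('b \<Rightarrow> real) \<Rightarrow> real" where
  "sup_norm S f = (SUP x\<in>S. \<bar>f x\<bar>)"

definition argmin_set :: "('b \<Rightarrow> 'c::ord) \<Rightarrow> 'b set \<Rightarrow> 'b set" where
  "argmin_set f S = {x. is_arg_min f (\<lambda>y. y \<in> S) x}"

definition abs_continuous_on :: "real \<Rightarrow> real \<Rightarrow> (real \<Rightarrow> 'a::metric_space) \<Rightarrow> bool" where
  "abs_continuous_on a b \<gamma> \<longleftrightarrow>
     (\<forall>\<epsilon>>0. \<exists>\<delta>>0. \<forall>I :: (real \<times> real) set.
        finite I \<longrightarrow>
        (\<forall>(s, t)\<in>I. a \<le> s \<and> s \<le> t \<and> t \<le> b) \<longrightarrow>
        pairwise (\<lambda>(s, t) (s', t'). {s<..<t} \<inter> {s'<..<t'} = {}) I \<longrightarrow>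
        (\<Sum>(s, t)\<in>I. t - s) < \<delta> \<longrightarrow>
        (\<Sum>(s, t)\<in>I. dist (\<gamma> s) (\<gamma> t)) < \<epsilon>)"

text \<open>The Bochner integral of a non-integrable function is \<open>0\<close>, whereas the action of a curve
  that is merely absolutely continuous can be \<open>+\<infinity>\<close>; hence an extended-valued integral, the
  difference of the integrals of the positive and the negative part (\<open>ennreal\<close> truncates
  negative reals to \<open>0\<close>).\<close>

definition eintegral :: "'b measure \<Rightarrow> ('b \<Rightarrow> real) \<Rightarrow> ereal" where
  "eintegral M f =
     enn2ereal (\<integral>\<^sup>+ x. ennreal (f x) \<partial>M) - enn2ereal (\<integral>\<^sup>+ x. ennreal (- f x) \<partial>M)"


section \<open>Domains with \<open>C\<^sup>2\<close> boundary\<close>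

text \<open>Near a boundary point the domain is the strict subgraph, in a unit direction \<open>e\<close>, of a
  \<open>C\<^sup>2\<close> function of the component orthogonal to \<open>e\<close>.\<close>

definition boundary_chart :: "'a::euclidean_space set \<Rightarrow> 'a \<Rightarrow> real \<Rightarrow> 'a \<Rightarrow> ('a \<Rightarrow> real) \<Rightarrow> bool" where
  "boundary_chart \<Omega> x r e g \<longleftrightarrow> 0 < r \<and> norm e = 1 \<and> Ck_on 2 g UNIV \<and>
     \<Omega> \<inter> ball x r = {y \<in> ball x r. y \<bullet> e < g (y - (y \<bullet> e) *\<^sub>R e)}"

definition C2_boundary :: "'a::euclidean_space set \<Rightarrow> bool" where
  "C2_boundary \<Omega> \<longleftrightarrow> (\<forall>x\<in>frontier \<Omega>. \<exists>r e g. boundary_chart \<Omega> x r e g)"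

definition bounded_C2_domain :: "'a::euclidean_space set \<Rightarrow> bool" where
  "bounded_C2_domain \<Omega> \<longleftrightarrow>
     open \<Omega> \<and> connected \<Omega> \<and> \<Omega> \<noteq> {} \<and> bounded \<Omega> \<and> C2_boundary \<Omega>"

text \<open>The normalized gradient of the defining function of a chart; it does not depend on the
  chart.\<close>

definition outward_normal :: "'a::euclidean_space set \<Rightarrow> 'a \<Rightarrow> 'a" where
  "outward_normal \<Omega> x = (THE n. \<exists>r e g. boundary_chart \<Omega> x r e g \<and>
     n = sgn (grad (\<lambda>y. y \<bullet> e - g (y - (y \<bullet> e) *\<^sub>R e)) (at x)))"


section \<open>Probability measures\<close>

definition prob_on :: "'b::topological_space set \<Rightarrow> 'b measure set" where
  "prob_on K = {\<mu>. sets \<mu> = sets (restrict_space borel K) \<and> prob_space \<mu>}"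

definition d1 :: "'a::metric_space set \<Rightarrow> 'a measure \<Rightarrow> 'a measure \<Rightarrow> real" where
  "d1 K m1 m2 = Sup {(\<integral>x. \<phi> x \<partial>m1) - (\<integral>x. \<phi> x \<partial>m2) | \<phi> :: 'a \<Rightarrow> real. 1-lipschitz_on K \<phi>}"

definition spt :: "'b::topological_space measure \<Rightarrow> 'b set" where
  "spt \<mu> = {x \<in> space \<mu>. \<forall>U. open U \<longrightarrow> x \<in> U \<longrightarrow> 0 < emeasure \<mu> (U \<inter> space \<mu>)}"


section \<open>Lagrangians\<close>

definition Dx :: "('a::euclidean_space \<Rightarrow> 'a \<Rightarrow> real) \<Rightarrow> 'a \<Rightarrow> 'a \<Rightarrow> 'a" where
  "Dx L x v = grad (\<lambda>y. L y v) (at x)"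

definition Dv :: "('a::euclidean_space \<Rightarrow> 'a \<Rightarrow> real) \<Rightarrow> 'a \<Rightarrow> 'a \<Rightarrow> 'a" where
  "Dv L x v = grad (\<lambda>w. L x w) (at v)"

definition strict_tonelli :: "('a::euclidean_space \<Rightarrow> 'a \<Rightarrow> real) \<Rightarrow> bool" where
  "strict_tonelli L \<longleftrightarrow> Ck_on 2 (\<lambda>(x, v). L x v) UNIV \<and>
     (\<exists>C1>0. \<exists>C2>0. \<exists>C3>0. \<forall>x v.
        (\<forall>h. (norm h)\<^sup>2 / C1 \<le> frechet_derivative (\<lambda>w. Dv L x w) (at v) h \<bullet> h \<and>
             frechet_derivative (\<lambda>w. Dv L x w) (at v) h \<bullet> h \<le> C1 * (norm h)\<^sup>2) \<and>
        onorm (frechet_derivative (\<lambda>y. Dv L y v) (at x)) \<le> C2 * (1 + norm v) \<and>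
        \<bar>L x 0\<bar> + norm (Dx L x 0) + norm (Dv L x 0) \<le> C3)"

definition reversible :: "('a::euclidean_space \<Rightarrow> 'a \<Rightarrow> real) \<Rightarrow> bool" where
  "reversible L \<longleftrightarrow> (\<forall>x v. L x v = L x (- v))"

definition hamiltonian :: "('a::euclidean_space \<Rightarrow> 'a \<Rightarrow> real) \<Rightarrow> 'a \<Rightarrow> 'a \<Rightarrow> real" where
  "hamiltonian L x p = (SUP v. p \<bullet> v - L x v)"

definition DpH :: "('a::euclidean_space \<Rightarrow> 'a \<Rightarrow> real) \<Rightarrow> 'a \<Rightarrow> 'a \<Rightarrow> 'a" where
  "DpH H x p = grad (\<lambda>q. H x q) (at p)"

text \<open>The flow acts on phase space \<open>(x, v)\<close>; for a Tonelli Lagrangian it is unique.\<close>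

definition euler_lagrange_flow ::
  "('a::euclidean_space \<Rightarrow> 'a \<Rightarrow> real) \<Rightarrow> (real \<Rightarrow> 'a \<times> 'a \<Rightarrow> 'a \<times> 'a) \<Rightarrow> bool" where
  "euler_lagrange_flow l \<Phi> \<longleftrightarrow>
     (\<forall>z. \<Phi> 0 z = z \<and>
       (\<forall>t. ((\<lambda>s. fst (\<Phi> s z)) has_vector_derivative snd (\<Phi> t z)) (at t) \<and>
            ((\<lambda>s. Dv l (fst (\<Phi> s z)) (snd (\<Phi> s z))) has_vector_derivative
               Dx l (fst (\<Phi> t z)) (snd (\<Phi> t z))) (at t)))"

text \<open>\<open>distr \<mu> borel (\<lambda>z. z)\<close> is the extension of \<open>\<mu>\<close> by zero to \<open>\<real>\<^sup>d \<times> \<real>\<^sup>d\<close>.\<close>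

definition mather_measure ::
  "'a::euclidean_space set \<Rightarrow> ('a \<Rightarrow> 'a \<Rightarrow> real) \<Rightarrow> ('a \<times> 'a) measure \<Rightarrow> bool" where
  "mather_measure \<Omega> l \<mu> \<longleftrightarrow>
     \<mu> \<in> prob_on (closure \<Omega> \<times> UNIV) \<and>
     (\<exists>\<Phi>. euler_lagrange_flow l \<Phi> \<and>
        (\<forall>t. distr (distr \<mu> borel (\<lambda>z. z)) borel (\<Phi> t) = distr \<mu> borel (\<lambda>z. z))) \<and>
     spt \<mu> \<subseteq> {(x, 0) | x. x \<in> closure \<Omega> \<and> l x 0 = (INF y. l y 0)}"


section \<open>Mild solutions of the constrained mean field game system\<close>

text \<open>A curve on \<open>[0,T]\<close> is encoded as a bounded continuous function on \<open>\<real>\<close> that is constant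
  on each side of \<open>[0,T]\<close>, so that the metric of \<open>bcontfun\<close> is the uniform distance on \<open>[0,T]\<close>
  and \<open>borel\<close> is the corresponding Borel \<open>\<sigma>\<close>-algebra.\<close>

definition curves :: "'a::euclidean_space set \<Rightarrow> real \<Rightarrow> (real \<Rightarrow>\<^sub>C 'a) set" where
  "curves K T = {\<gamma>. abs_continuous_on 0 T (apply_bcontfun \<gamma>) \<and> (\<forall>t\<in>{0..T}. \<gamma> t \<in> K) \<and>
     (\<forall>t\<le>0. \<gamma> t = \<gamma> 0) \<and> (\<forall>t\<ge>T. \<gamma> t = \<gamma> T)}"

definition marginal :: "'a::euclidean_space set \<Rightarrow> (real \<Rightarrow>\<^sub>C 'a) measure \<Rightarrow> real \<Rightarrow> 'a measure" where
  "marginal K \<eta> t = distr \<eta> (restrict_space borel K) (\<lambda>\<gamma>. \<gamma> t)"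

definition action ::
  "('a::euclidean_space \<Rightarrow> 'a \<Rightarrow> real) \<Rightarrow> ('a \<Rightarrow> 'a measure \<Rightarrow> real) \<Rightarrow> ('a \<Rightarrow> real) \<Rightarrow>
   (real \<Rightarrow> 'a measure) \<Rightarrow> real \<Rightarrow> real \<Rightarrow> (real \<Rightarrow>\<^sub>C 'a) \<Rightarrow> ereal" where
  "action L F uf m t T \<gamma> =
     eintegral (lebesgue_on {t..T})
       (\<lambda>s. L (\<gamma> s) (vector_derivative (apply_bcontfun \<gamma>) (at s)) + F (\<gamma> s) (m s))
     + ereal (uf (\<gamma> T))"

definition mfg_equilibrium ::
  "'a::euclidean_space set \<Rightarrow> ('a \<Rightarrow> 'a \<Rightarrow> real) \<Rightarrow> ('a \<Rightarrow> 'a measure \<Rightarrow> real) \<Rightarrow> ('a \<Rightarrow> real) \<Rightarrow>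
   'a measure \<Rightarrow> real \<Rightarrow> (real \<Rightarrow>\<^sub>C 'a) measure \<Rightarrow> bool" where
  "mfg_equilibrium \<Omega> L F uf m0 T \<eta> \<longleftrightarrow>
     \<eta> \<in> prob_on (curves (closure \<Omega>) T) \<and>
     marginal (closure \<Omega>) \<eta> 0 = m0 \<and>
     spt \<eta> \<subseteq> (\<Union>x\<in>closure \<Omega>.
       argmin_set (action L F uf (marginal (closure \<Omega>) \<eta>) 0 T) {\<gamma> \<in> curves (closure \<Omega>) T. \<gamma> 0 = x})"

definition mild_solution ::
  "'a::euclidean_space set \<Rightarrow> ('a \<Rightarrow> 'a \<Rightarrow> real) \<Rightarrow> ('a \<Rightarrow> 'a measure \<Rightarrow> real) \<Rightarrow> ('a \<Rightarrow> real) \<Rightarrow>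
   'a measure \<Rightarrow> real \<Rightarrow> (real \<Rightarrow> 'a \<Rightarrow> real) \<Rightarrow> (real \<Rightarrow> 'a measure) \<Rightarrow> bool" where
  "mild_solution \<Omega> L F uf m0 T u m \<longleftrightarrow>
     continuous_on ({0..T} \<times> closure \<Omega>) (\<lambda>(t, x). u t x) \<and>
     (\<forall>t\<in>{0..T}. m t \<in> prob_on (closure \<Omega>) \<and>
        ((\<lambda>s. d1 (closure \<Omega>) (m s) (m t)) \<longlongrightarrow> 0) (at t within {0..T})) \<and>
     (\<exists>\<eta>. mfg_equilibrium \<Omega> L F uf m0 T \<eta> \<and> (\<forall>t\<in>{0..T}. m t = marginal (closure \<Omega>) \<eta> t)) \<and>
     (\<forall>t\<in>{0..T}. \<forall>x\<in>closure \<Omega>.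
        ereal (u t x) = (INF \<gamma>\<in>{\<gamma> \<in> curves (closure \<Omega>) T. \<gamma> t = x}. action L F uf m t T \<gamma>))"


section \<open>Assumptions on the coupling and the terminal cost\<close>

text \<open>The sum over \<open>dirs 2\<close> counts each mixed second derivative once for each order of
  differentiation, which does not affect finiteness.\<close>

definition F1 :: "'a::euclidean_space set \<Rightarrow> ('a \<Rightarrow> 'a measure \<Rightarrow> real) \<Rightarrow> bool" where
  "F1 \<Omega> F \<longleftrightarrow>
     (\<forall>m\<in>prob_on (closure \<Omega>). Ckb_on 2 (\<lambda>x. F x m) UNIV) \<and>
     bdd_above ((\<lambda>m. \<Sum>bs\<in>dirs 2. sup_norm UNIV (pderivs bs (\<lambda>x. F x m))) ` prob_on (closure \<Omega>))"

definition F2 :: "'a::euclidean_space set \<Rightarrow> ('a \<Rightarrow> 'a measure \<Rightarrow> real) \<Rightarrow> bool" where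
  "F2 \<Omega> F \<longleftrightarrow>
     bdd_above {\<bar>F x m1 - F x m2\<bar> / d1 (closure \<Omega>) m1 m2 | x m1 m2.
       m1 \<in> prob_on (closure \<Omega>) \<and> m2 \<in> prob_on (closure \<Omega>) \<and> m1 \<noteq> m2}"

definition F3 :: "'a::euclidean_space set \<Rightarrow> ('a \<Rightarrow> 'a measure \<Rightarrow> real) \<Rightarrow> bool" where
  "F3 \<Omega> F \<longleftrightarrow>
     (\<exists>CF>0. \<forall>m1\<in>prob_on (closure \<Omega>). \<forall>m2\<in>prob_on (closure \<Omega>).
        (\<integral>x. F x m1 - F x m2 \<partial>m1) - (\<integral>x. F x m1 - F x m2 \<partial>m2)
          \<ge> CF * (\<integral>x. (F x m1 - F x m2)\<^sup>2 \<partial>lebesgue_on (closure \<Omega>)))"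

definition A2 ::
  "'a::euclidean_space set \<Rightarrow> ('a \<Rightarrow> 'a \<Rightarrow> real) \<Rightarrow> ('a \<Rightarrow> 'a measure \<Rightarrow> real) \<Rightarrow> bool" where
  "A2 \<Omega> L F \<longleftrightarrow>
     (\<forall>m\<in>prob_on (closure \<Omega>). argmin_set (\<lambda>x. L x 0 + F x m) UNIV \<inter> closure \<Omega> \<noteq> {})"

definition A3 ::
  "'a::euclidean_space set \<Rightarrow> ('a \<Rightarrow> 'a \<Rightarrow> real) \<Rightarrow> ('a \<Rightarrow> 'a measure \<Rightarrow> real) \<Rightarrow> bool" where
  "A3 \<Omega> L F \<longleftrightarrow>
     (\<exists>\<xi> :: 'a measure \<Rightarrow> 'a.
        (\<exists>K. \<forall>m1\<in>prob_on (closure \<Omega>). \<forall>m2\<in>prob_on (closure \<Omega>).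
           dist (\<xi> m1) (\<xi> m2) \<le> K * d1 (closure \<Omega>) m1 m2) \<and>
        (\<forall>m\<in>prob_on (closure \<Omega>). \<xi> m \<in> argmin_set (\<lambda>x. L x 0 + F x m) (closure \<Omega>))) \<and>
     (\<forall>m\<in>prob_on (closure \<Omega>). (INF x\<in>closure \<Omega>. L x 0 + F x m) = 0)"

definition U_cond :: "'a::euclidean_space set \<Rightarrow> ('a \<Rightarrow> real) \<Rightarrow> bool" where
  "U_cond \<Omega> uf \<longleftrightarrow> (\<exists>U. open U \<and> closure \<Omega> \<subseteq> U \<and> Ckb_on 1 uf U)"


section \<open>Solutions of the constrained ergodic system\<close>

definition constrained_viscosity_solution ::
  "'a::euclidean_space set \<Rightarrow> ('a \<Rightarrow> 'a \<Rightarrow> real) \<Rightarrow> real \<Rightarrow> ('a \<Rightarrow> real) \<Rightarrow> bool" where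
  "constrained_viscosity_solution \<Omega> G c u \<longleftrightarrow>
     continuous_on (closure \<Omega>) u \<and>
     (\<forall>\<phi>. Ck_on 1 \<phi> UNIV \<longrightarrow>
        (\<forall>x\<in>\<Omega>. (\<forall>\<^sub>F y in at x. u y - \<phi> y \<le> u x - \<phi> x) \<longrightarrow> G x (grad \<phi> (at x)) \<le> c) \<and>
        (\<forall>x\<in>closure \<Omega>. (\<forall>\<^sub>F y in at x within closure \<Omega>. u x - \<phi> x \<le> u y - \<phi> y) \<longrightarrow>
           G x (grad \<phi> (at x)) \<ge> c))"

definition superdifferential :: "'a::euclidean_space set \<Rightarrow> ('a \<Rightarrow> real) \<Rightarrow> 'a \<Rightarrow> 'a set" where
  "superdifferential \<Omega> u x =
     {p. Limsup (at x within closure \<Omega>)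
           (\<lambda>y. ereal ((u y - u x - p \<bullet> (y - x)) / norm (y - x))) \<le> 0}"

definition tangential :: "'a::euclidean_space set \<Rightarrow> 'a \<Rightarrow> 'a \<Rightarrow> 'a" where
  "tangential \<Omega> x p = p - (p \<bullet> outward_normal \<Omega> x) *\<^sub>R outward_normal \<Omega> x"

definition lambda_p :: "'a::euclidean_space set \<Rightarrow> ('a \<Rightarrow> real) \<Rightarrow> 'a \<Rightarrow> 'a \<Rightarrow> real" where
  "lambda_p \<Omega> u x p =
     (GREATEST l. tangential \<Omega> x p + l *\<^sub>R outward_normal \<Omega> x \<in> superdifferential \<Omega> u x)"

definition lambda_plus :: "'a::euclidean_space set \<Rightarrow> ('a \<Rightarrow> real) \<Rightarrow> 'a \<Rightarrow> real" where
  "lambda_plus \<Omega> u x = (GREATEST l. \<exists>p\<in>superdifferential \<Omega> u x. l = lambda_p \<Omega> u x p)"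

definition calibrated ::
  "'a::euclidean_space set \<Rightarrow> ('a \<Rightarrow> real) \<Rightarrow> ('a \<Rightarrow> 'a \<Rightarrow> real) \<Rightarrow> real \<Rightarrow> real \<Rightarrow> real \<Rightarrow>
   (real \<Rightarrow> 'a) \<Rightarrow> bool" where
  "calibrated \<Omega> u l c a b \<gamma> \<longleftrightarrow>
     \<gamma> ` {a..b} \<subseteq> closure \<Omega> \<and>
     (\<forall>s\<in>{a..b}. \<gamma> differentiable (at s within {a..b})) \<and>
     continuous_on {a..b} (\<lambda>s. vector_derivative \<gamma> (at s within {a..b})) \<and>
     (\<forall>t t'. a \<le> t \<and> t < t' \<and> t' \<le> b \<longrightarrow>
        u (\<gamma> t') - u (\<gamma> t) =
          (\<integral>s. l (\<gamma> s) (vector_derivative \<gamma> (at s within {a..b})) \<partial>lebesgue_on {t..t'})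
          + c * (t' - t))"

definition D_tau ::
  "'a::euclidean_space set \<Rightarrow> ('a \<Rightarrow> real) \<Rightarrow> ('a \<Rightarrow> 'a \<Rightarrow> real) \<Rightarrow> real \<Rightarrow> 'a \<Rightarrow> 'a" where
  "D_tau \<Omega> u l c x = (SOME p. \<exists>\<tau>>0. \<exists>\<gamma>. calibrated \<Omega> u l c (- \<tau>) \<tau> \<gamma> \<and> \<gamma> 0 = x \<and>
     p = tangential \<Omega> x (Dv l x (vector_derivative \<gamma> (at 0))))"

definition velocity_field ::
  "'a::euclidean_space set \<Rightarrow> ('a \<Rightarrow> 'a \<Rightarrow> real) \<Rightarrow> ('a \<Rightarrow> 'a measure \<Rightarrow> real) \<Rightarrow>
   real \<Rightarrow> ('a \<Rightarrow> real) \<Rightarrow> 'a measure \<Rightarrow> 'a \<Rightarrow> 'a" where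
  "velocity_field \<Omega> L F lam u m x =
     (if x \<in> \<Omega> \<inter> spt m then DpH (hamiltonian L) x (grad u (at x))
      else if x \<in> frontier \<Omega> \<inter> spt m then
        DpH (hamiltonian L) x
          (D_tau \<Omega> u (\<lambda>y v. L y v + F y m) lam x + lambda_plus \<Omega> u x *\<^sub>R outward_normal \<Omega> x)
      else 0)"

text \<open>A smooth function on the closed domain with support inside the open domain is the
  restriction of a smooth function on the whole space with the same support.\<close>

definition ergodic_solution ::
  "'a::euclidean_space set \<Rightarrow> ('a \<Rightarrow> 'a \<Rightarrow> real) \<Rightarrow> ('a \<Rightarrow> 'a measure \<Rightarrow> real) \<Rightarrow>
   real \<Rightarrow> ('a \<Rightarrow> real) \<Rightarrow> 'a measure \<Rightarrow> bool" where
  "ergodic_solution \<Omega> L F lam u m \<longleftrightarrow>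
     m \<in> prob_on (closure \<Omega>) \<and>
     constrained_viscosity_solution \<Omega> (\<lambda>x p. hamiltonian L x p - F x m) lam u \<and>
     (AE x in m. u differentiable (at x within closure \<Omega>)) \<and>
     (\<exists>\<mu>. mather_measure \<Omega> (\<lambda>x v. L x v + F x m) \<mu> \<and>
        m = distr \<mu> (restrict_space borel (closure \<Omega>)) fst) \<and>
     (\<forall>f. (\<forall>k. Ck_on k f UNIV) \<and> closure {x. f x \<noteq> 0} \<subseteq> \<Omega> \<longrightarrow>
        has_bochner_integral m (\<lambda>x. grad f (at x) \<bullet> velocity_field \<Omega> L F lam u m x) 0)"

end

theory Submission
  imports Defs
begin

text \<open>The normalization in (A3) forces \<open>\<lambda> = 0\<close>: minimum points of \<open>u\<close> give \<open>\<lambda> \<le> 0\<close>, and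
  touching \<open>u\<close> from above by steep paraboloids gives \<open>\<lambda> \<ge> 0\<close>. Write
  \<open>G\<^sub>m(x) = L(x,0) + F(x,m)\<close>, which is nonnegative on the closed domain and vanishes
  \<open>m\<close>-almost everywhere for the ergodic measure \<open>m\<close>. From every point one reaches any
  given \<open>y\<close> within unit time at bounded cost and may then rest there, so a minimizing curve
  \<open>\<gamma>\<close> satisfies \<open>\<integral> G\<^bsub>m(s)\<^esub>(\<gamma>(s)) ds \<le> C + \<integral> G\<^bsub>m(s)\<^esub>(y) ds\<close>. Averaging over \<open>\<gamma>\<close> with respect to
  the equilibrium and over \<open>y\<close> with respect to the ergodic measure, the monotonicity (F3) bounds
  \<open>\<integral> \<parallel>F(\<cdot>,m(s)) - F(\<cdot>,m)\<parallel>\<^sub>2\<^sup>2 ds\<close> independently of \<open>T\<close>. The functions involved are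
  uniformly Lipschitz, so the power \<open>d + 2\<close> of their supremum norm is controlled by the square of
  their \<open>L\<^sup>2\<close> norm, and Jensen's inequality gives the rate. The value function is then bounded
  above by going to a minimum point of \<open>G\<^sub>m\<close> and resting there.\<close>

section \<open>Calculus and Tonelli Lagrangians\<close>

text \<open>The bounds do not grow with \<open>T\<close> because a competitor pays for travel only
  once, during one unit of time. Averaging is effective because evaluation at time s sends the
  equilibrium to its marginal: the average cost of the curves is an integral of the running
  potential against m(s). Subtracting its integral against the ergodic measure dominates the
  left-hand side of (F3), since the ergodic potential has a nonnegative integral against m(s) and
  integral zero against the ergodic measure. The exponent d + 2 splits into 2 for the square and d
  for the volume of a ball whose radius is proportional to the value of the function. Both geometric
  inputs, balls of comparable size inside the closed domain and paths of bounded speed within it,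
  come from an interior cone property with a locally constant axis. Two obstacles shape the rest: an
  absolutely continuous curve may have infinite action, so comparisons are made in extended reals,
  and optimality is known only on the support of the equilibrium, which has full measure because the
  space of curves is separable.\<close>

lemma grad_eqI:
  assumes "(f has_derivative (\<lambda>h. h \<bullet> g)) (at x)"
  shows "grad f (at x) = g"
  unfolding grad_def
proof (rule the_equality, rule assms)
  fix g' assume "(f has_derivative (\<lambda>h. h \<bullet> g')) (at x)"
  then have "(\<lambda>h. h \<bullet> g') = (\<lambda>h. h \<bullet> g)"
    using assms by (rule has_derivative_unique)
  then have "\<And>h. h \<bullet> g' = h \<bullet> g" by metis
  then show "g' = g" using vector_eq_ldot by blast
qed

section \<open>Coordinate derivatives and mean value bounds\<close>

lemma dirs_Nil [simp]: "[] \<in> dirs k"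
  by (simp add: dirs_def)

lemma dirs_single: "b \<in> Basis \<Longrightarrow> 0 < k \<Longrightarrow> [b] \<in> dirs k"
  by (simp add: dirs_def)

lemma finite_dirs: "finite (dirs k :: 'a::euclidean_space list set)"
  unfolding dirs_def by (rule finite_lists_length_le) simp

lemma Ck_on_continuous: "Ck_on k f U \<Longrightarrow> continuous_on U f"
  unfolding Ck_on_def using dirs_Nil by fastforce

lemma has_derivative_pderivs:
  fixes f :: "'a::euclidean_space \<Rightarrow> real"
  assumes "Ck_on k f U" "0 < k" "x \<in> U"
  shows "(f has_derivative (\<lambda>h. \<Sum>b\<in>Basis. (h \<bullet> b) * pderivs [b] f x)) (at x)"
proof -
  have "pderivs [] f differentiable at x"
    using assms dirs_Nil[of k] unfolding Ck_on_def by fastforce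
  then have d: "(f has_derivative frechet_derivative f (at x)) (at x)"
    by (simp add: frechet_derivative_works)
  then interpret linear "frechet_derivative f (at x)"
    by (rule has_derivative_linear)
  have "frechet_derivative f (at x) h = (\<Sum>b\<in>Basis. (h \<bullet> b) * pderivs [b] f x)" for h
  proof -
    have "frechet_derivative f (at x) h = frechet_derivative f (at x) (\<Sum>b\<in>Basis. (h \<bullet> b) *\<^sub>R b)"
      by (simp add: euclidean_representation)
    then show ?thesis by (simp add: sum scale)
  qed
  with d show ?thesis by (metis (no_types, lifting) ext)
qed

text \<open>Each coordinate of \<open>h\<close> is bounded by its norm and there are
  \<open>DIM('a)\<close> of them, which bounds the operator norm of the differential. The crude
  factor suffices, as only some uniform constant is wanted.\<close>

lemma pderivs_bound_imp_lipschitz: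
  fixes f :: "'a::euclidean_space \<Rightarrow> real"
  assumes "Ck_on k f U" "0 < k" "convex S" "S \<subseteq> U"
    and "\<And>x b. x \<in> S \<Longrightarrow> b \<in> Basis \<Longrightarrow> \<bar>pderivs [b] f x\<bar> \<le> M"
    and "x \<in> S" "y \<in> S"
  shows "\<bar>f x - f y\<bar> \<le> real DIM('a) * M * dist x y"
proof -
  let ?D = "\<lambda>x h. \<Sum>b\<in>Basis. (h \<bullet> b) * pderivs [b] f x"
  have "norm (f x - f y) \<le> real DIM('a) * M * norm (x - y)"
  proof (rule differentiable_bound[OF assms(3)])
    show "(f has_derivative ?D z) (at z within S)" if "z \<in> S" for z
      using has_derivative_pderivs[OF assms(1,2)] assms(4) that
      by (blast intro: has_derivative_at_withinI)
    show "onorm (?D z) \<le> real DIM('a) * M" if z: "z \<in> S" for z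
    proof (rule onorm_le)
      fix h
      have "\<bar>(h \<bullet> b) * pderivs [b] f z\<bar> \<le> norm h * M" if "b \<in> Basis" for b
        unfolding abs_mult by (intro mult_mono Basis_le_norm assms(5) z that) auto
      then have "\<bar>?D z h\<bar> \<le> (\<Sum>b\<in>(Basis::'a set). norm h * M)"
        by (intro order_trans[OF sum_abs] sum_mono)
      then show "norm (?D z h) \<le> real DIM('a) * M * norm h" by (simp add: mult_ac)
    qed
  qed (use assms in auto)
  then show ?thesis by (simp add: dist_norm)
qed

lemma Ck_on_imp_lipschitz_cball:
  fixes f :: "'a::euclidean_space \<Rightarrow> real"
  assumes "Ck_on k f UNIV" "0 < k"
  obtains l where "l \<ge> 0" "\<And>x y. x \<in> cball z r \<Longrightarrow> y \<in> cball z r \<Longrightarrow> \<bar>f x - f y\<bar> \<le> l * dist x y"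
proof -
  have "\<exists>M. \<forall>x\<in>cball z r. \<bar>pderivs [b] f x\<bar> \<le> M" if "b \<in> Basis" for b
  proof -
    have "continuous_on (cball z r) (pderivs [b] f)"
      using assms dirs_single[OF that assms(2)] unfolding Ck_on_def
      by (blast intro: continuous_on_subset)
    then have "bounded (pderivs [b] f ` cball z r)"
      by (intro compact_imp_bounded compact_continuous_image) auto
    then show ?thesis unfolding bounded_iff by auto
  qed
  then obtain M where M: "\<And>b x. b \<in> Basis \<Longrightarrow> x \<in> cball z r \<Longrightarrow> \<bar>pderivs [b] f x\<bar> \<le> M b"
    by metis
  \<comment> \<open>A sum of absolute values dominates all the directional bounds \<open>M b\<close>
    at once and is nonnegative whatever their signs.\<close>
  define N where "N = (\<Sum>b\<in>Basis. \<bar>M b\<bar>)"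
  have "M b \<le> N" if "b \<in> Basis" for b
  proof -
    have "\<bar>M b\<bar> \<le> N" unfolding N_def by (rule member_le_sum) (auto simp: that)
    then show ?thesis by linarith
  qed
  then have "\<bar>pderivs [b] f x\<bar> \<le> N" if "x \<in> cball z r" "b \<in> Basis" for x b
    using M[OF that(2,1)] that by fastforce
  then have "\<bar>f x - f y\<bar> \<le> real DIM('a) * N * dist x y"
    if "x \<in> cball z r" "y \<in> cball z r" for x y
    using that by (intro pderivs_bound_imp_lipschitz[OF assms convex_cball]) blast+
  moreover have "0 \<le> real DIM('a) * N" unfolding N_def by (intro mult_nonneg_nonneg sum_nonneg) auto
  ultimately show ?thesis using that by blast
qed

text \<open>Provides the test functions for both viscosity inequalities: \<open>k = 0\<close> gives
  a constant function to test at a minimum, and a large \<open>k\<close> confines a maximum to the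
  interior of a small ball.\<close>

lemma Ck_on_paraboloid:
  fixes z :: "'a::euclidean_space" and k :: real
  defines "\<phi> \<equiv> \<lambda>y. k * ((y - z) \<bullet> (y - z))"
  shows "Ck_on 1 \<phi> UNIV" "grad \<phi> (at x) = (2 * k) *\<^sub>R (x - z)"
proof -
  have d: "(\<phi> has_derivative (\<lambda>h. h \<bullet> ((2 * k) *\<^sub>R (x - z)))) (at x)" for x
    unfolding \<phi>_def by (auto intro!: derivative_eq_intros simp: inner_commute algebra_simps)
  then show "grad \<phi> (at x) = (2 * k) *\<^sub>R (x - z)" by (rule grad_eqI)
  have fd: "frechet_derivative \<phi> (at x) = (\<lambda>h. h \<bullet> ((2 * k) *\<^sub>R (x - z)))" for x
    using frechet_derivative_at[OF d] by simp
  have "\<phi> differentiable at x" for x using d by (rule differentiableI)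
  moreover have "continuous_on UNIV (\<lambda>x. frechet_derivative \<phi> (at x) b)" for b
    unfolding fd by (intro continuous_intros)
  moreover have "continuous_on UNIV \<phi>" unfolding \<phi>_def by (intro continuous_intros)
  moreover have "bs = [] \<or> (\<exists>b. bs = [b])" if "bs \<in> dirs 1" for bs :: "'a list"
    using that by (cases bs; cases "tl bs") (auto simp: dirs_def)
  ultimately show "Ck_on 1 \<phi> UNIV" unfolding Ck_on_def by fastforce
qed

text \<open>Reversibility makes \<open>L x\<close> even in the velocity, so its velocity gradient
  vanishes at rest. The lower Hessian bound then yields quadratic growth by integrating twice along
  the ray through \<open>v\<close>; \<open>C\<close> is the Hessian constant.\<close>

lemma strict_tonelli_lower_bound:
  fixes L :: "'a::euclidean_space \<Rightarrow> 'a \<Rightarrow> real"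
  assumes "strict_tonelli L" "reversible L"
  obtains C where "C > 0" "\<And>x v. L x v \<ge> L x 0 + (norm v)\<^sup>2 / (2 * C)"
proof -
  let ?f = "\<lambda>(x, v). L x v"
  from assms(1) obtain C where C: "C > 0" and ck: "Ck_on 2 ?f UNIV"
    and hess: "\<And>x v h. (norm h)\<^sup>2 / C \<le> frechet_derivative (\<lambda>w. Dv L x w) (at v) h \<bullet> h"
    unfolding strict_tonelli_def by metis
  define p where "p = (\<lambda>b x v. pderivs [(0, b)] ?f (x, v))"
  have L': "((\<lambda>w. L x w) has_derivative (\<lambda>h. h \<bullet> (\<Sum>b\<in>Basis. p b x v *\<^sub>R b))) (at v)" for x v
  proof -
    have "((\<lambda>w. ?f (x, w)) has_derivative
      (\<lambda>h. \<Sum>b\<in>Basis. ((0, h) \<bullet> b) * pderivs [b] ?f (x, v))) (at v)"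
      by (rule has_derivative_compose[of "\<lambda>w. (x, w)" "\<lambda>h. (0, h)",
            OF _ has_derivative_pderivs[OF ck]])
        (auto intro!: derivative_eq_intros)
    moreover have "(\<Sum>b\<in>Basis. ((0, h) \<bullet> b) * pderivs [b] ?f (x, v))
       = h \<bullet> (\<Sum>b\<in>Basis. p b x v *\<^sub>R b)" for h :: 'a
    proof -
      \<comment> \<open>The basis of the product consists of the vectors \<open>(b, 0)\<close> and
        \<open>(0, b)\<close>; only the second family pairs nontrivially with
        \<open>(0, h)\<close>.\<close>
      have "(\<Sum>b\<in>Basis. ((0, h) \<bullet> b) * pderivs [b] ?f (x, v))
         = (\<Sum>b\<in>Basis. (h \<bullet> b) * pderivs [(0, b)] ?f (x, v))"
        unfolding Basis_prod_def
        by (subst sum.union_disjoint)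
          (auto simp: sum.reindex inj_on_def simp del: pderivs.simps)
      then show ?thesis by (simp add: p_def inner_sum_right mult.commute del: pderivs.simps)
    qed
    ultimately show ?thesis by simp
  qed
  then have Dv_eq: "Dv L x v = (\<Sum>b\<in>Basis. p b x v *\<^sub>R b)" for x v
    unfolding Dv_def by (rule grad_eqI)
  note L'' = L'[folded Dv_eq]
  have pd: "(\<lambda>v. p b x v) differentiable at v" if "b \<in> Basis" for b x v
  proof -
    have "[(0::'a, b)] \<in> dirs 2" using that by (intro dirs_single) (auto simp: Basis_prod_def)
    then have "pderivs [(0, b)] ?f differentiable at (x, v)"
      using ck unfolding Ck_on_def by force
    moreover have "(\<lambda>w. (x, w)) differentiable at v"
      by (rule differentiableI, rule has_derivative_Pair[OF has_derivative_const has_derivative_ident])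
    ultimately show ?thesis unfolding p_def
      using differentiable_chain_at[of "\<lambda>w. (x, w)" v "pderivs [(0, b)] ?f"] by (simp add: o_def)
  qed
  have Dv': "((\<lambda>w. Dv L x w) has_derivative frechet_derivative (\<lambda>w. Dv L x w) (at v)) (at v)" for x v
    unfolding frechet_derivative_works[symmetric] Dv_eq
    by (intro differentiable_sum ballI differentiable_scaleR pd differentiable_const) auto
  have Dv0: "Dv L x 0 = 0" for x
  proof -
    have "((\<lambda>w. L x (- w)) has_derivative (\<lambda>h. - h \<bullet> Dv L x 0)) (at 0)"
      by (rule has_derivative_compose[of uminus uminus 0 UNIV "\<lambda>w. L x w"])
        (use L''[of x 0] in \<open>auto intro!: derivative_eq_intros\<close>)
    moreover have "(\<lambda>w. L x (- w)) = (\<lambda>w. L x w)"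
      using assms(2) unfolding reversible_def by (intro ext) simp
    ultimately have "((\<lambda>w. L x w) has_derivative (\<lambda>h. h \<bullet> (- Dv L x 0))) (at 0)"
      by simp
    from grad_eqI[OF this] have "Dv L x 0 + Dv L x 0 = 0" by (metis Dv_def add.left_inverse)
    then show ?thesis by (simp add: scaleR_2[symmetric])
  qed
  have "L x v \<ge> L x 0 + (norm v)\<^sup>2 / (2 * C)" for x v
  proof -
    \<comment> \<open>\<open>k\<close> is the restriction of \<open>L x\<close> to the ray minus the
      claimed quadratic term, and \<open>k'\<close> is its derivative. The Hessian bound makes
      \<open>k'\<close> nondecreasing and \<open>Dv0\<close> gives \<open>k' 0 = 0\<close>, so
      \<open>k 0 \<le> k 1\<close>, which is the claim.\<close>
    define k' where "k' = (\<lambda>s. Dv L x (s *\<^sub>R v) \<bullet> v - s * (norm v)\<^sup>2 / C)"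
    define k where "k = (\<lambda>s. L x (s *\<^sub>R v) - s\<^sup>2 * (norm v)\<^sup>2 / (2 * C))"
    have sv: "((\<lambda>s. s *\<^sub>R v) has_derivative (\<lambda>h. h *\<^sub>R v)) (at s)" for s :: real
      by (auto intro!: derivative_eq_intros)
    have dk': "(k' has_real_derivative
      frechet_derivative (\<lambda>w. Dv L x w) (at (s *\<^sub>R v)) v \<bullet> v - (norm v)\<^sup>2 / C) (at s)" for s
    proof -
      interpret linear "frechet_derivative (\<lambda>w. Dv L x w) (at (s *\<^sub>R v))"
        using Dv' by (rule has_derivative_linear)
      have "((\<lambda>s. Dv L x (s *\<^sub>R v) \<bullet> v) has_derivative
          (\<lambda>h. frechet_derivative (\<lambda>w. Dv L x w) (at (s *\<^sub>R v)) (h *\<^sub>R v) \<bullet> v)) (at s)"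
        by (intro has_derivative_inner_left has_derivative_compose[OF sv Dv'])
      then have "((\<lambda>s. Dv L x (s *\<^sub>R v) \<bullet> v) has_real_derivative
          frechet_derivative (\<lambda>w. Dv L x w) (at (s *\<^sub>R v)) v \<bullet> v) (at s)"
        unfolding has_field_derivative_def scale inner_scaleR_left mult_commute_abs .
      then show ?thesis unfolding k'_def using C by (auto intro!: derivative_eq_intros)
    qed
    have dk: "(k has_real_derivative k' s) (at s)" for s
    proof -
      have "((\<lambda>s. L x (s *\<^sub>R v)) has_derivative (\<lambda>h. (h *\<^sub>R v) \<bullet> Dv L x (s *\<^sub>R v))) (at s)"
        using has_derivative_compose[OF sv L''[of x "s *\<^sub>R v"]] .
      then have "((\<lambda>s. L x (s *\<^sub>R v)) has_real_derivative Dv L x (s *\<^sub>R v) \<bullet> v) (at s)"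
        unfolding has_field_derivative_def inner_scaleR_left inner_commute[of v] mult_commute_abs .
      then show ?thesis unfolding k_def k'_def using C
        by (auto intro!: derivative_eq_intros)
    qed
    have "0 \<le> k' s" if "0 \<le> s" for s
    proof -
      have "k' 0 \<le> k' s"
        using dk' hess[of v x] by (intro DERIV_nonneg_imp_nondecreasing[OF that]) fastforce
      then show ?thesis by (simp add: k'_def Dv0)
    qed
    then have "\<exists>y. (k has_real_derivative y) (at s) \<and> 0 \<le> y" if "0 \<le> s" for s
      using dk that by blast
    then have "k 0 \<le> k 1"
      by (intro DERIV_nonneg_imp_nondecreasing[of 0 1 k]) auto
    then show ?thesis by (simp add: k_def)
  qed
  with C that show ?thesis by blast
qed

section \<open>Geometry of domains with smooth boundary\<close>

text \<open>An interior cone property whose axis \<open>- e\<close> and aperture are the same for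
  all points near \<open>z\<close>. In a graph chart, descending by \<open>t\<close> creates room at
  least \<open>t\<close> below the graph; a further displacement by \<open>\<kappa> * t\<close>
  costs at most this much height plus the variation of the graph, controlled by its local Lipschitz
  constant.\<close>

lemma bounded_C2_domain_cone:
  fixes \<Omega> :: "'a::euclidean_space set"
  assumes "bounded_C2_domain \<Omega>" "z \<in> closure \<Omega>"
  obtains \<rho> e \<kappa> \<tau> where "\<rho> > 0" "norm e = 1" "0 < \<kappa>" "\<kappa> \<le> 1" "\<tau> > 0"
    "\<And>x t. x \<in> closure \<Omega> \<Longrightarrow> dist z x < \<rho> \<Longrightarrow> 0 \<le> t \<Longrightarrow> t \<le> \<tau> \<Longrightarrow>
       cball (x - t *\<^sub>R e) (\<kappa> * t) \<subseteq> closure \<Omega>"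
proof (cases "z \<in> \<Omega>")
  case True
  then obtain r where r: "r > 0" "ball z r \<subseteq> \<Omega>"
    using assms unfolding bounded_C2_domain_def by (meson openE)
  obtain e :: 'a where e: "norm e = 1" using norm_Basis nonempty_Basis by blast
  have "cball (x - t *\<^sub>R e) (1 * t) \<subseteq> closure \<Omega>"
    if "dist z x < r/3" "0 \<le> t" "t \<le> r/3" for x t
  proof
    fix y assume y: "y \<in> cball (x - t *\<^sub>R e) (1 * t)"
    have "dist z y \<le> dist z x + dist x (x - t *\<^sub>R e) + dist (x - t *\<^sub>R e) y"
      using dist_triangle[of z y x] dist_triangle[of x y "x - t *\<^sub>R e"] by linarith
    also have "dist x (x - t *\<^sub>R e) = t" using e that by (simp add: dist_norm)
    finally have "y \<in> ball z r" using y that by auto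
    then show "y \<in> closure \<Omega>" using r closure_subset by blast
  qed
  then show ?thesis using r e by (intro that[of "r/3" e 1 "r/3"]) auto
next
  case False
  then have "z \<in> frontier \<Omega>"
    using assms unfolding frontier_def bounded_C2_domain_def by (simp add: interior_open)
  then obtain r e g where "boundary_chart \<Omega> z r e g"
    using assms unfolding bounded_C2_domain_def C2_boundary_def by blast
  then have r: "0 < r" and e: "norm e = 1" and g: "Ck_on 2 g UNIV"
    and chart: "\<Omega> \<inter> ball z r = {y \<in> ball z r. y \<bullet> e < g (y - (y \<bullet> e) *\<^sub>R e)}"
    unfolding boundary_chart_def by auto
  define P where "P = (\<lambda>y::'a. y - (y \<bullet> e) *\<^sub>R e)"
  have ee: "e \<bullet> e = 1" using e by (simp add: norm_eq_1)
  have P_diff: "P x - P y = P (x - y)" for x y by (simp add: P_def algebra_simps)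
  have P_norm: "norm (P y) \<le> norm y" for y
  proof -
    have "(norm (P y))\<^sup>2 = (norm y)\<^sup>2 - (y \<bullet> e)\<^sup>2"
      using ee unfolding P_def power2_norm_eq_inner
      by (simp add: algebra_simps inner_commute power2_eq_square)
    then have "(norm (P y))\<^sup>2 \<le> (norm y)\<^sup>2" by simp
    then show ?thesis by (rule power2_le_imp_le) simp
  qed
  have P_lip: "dist (P x) (P y) \<le> dist x y" for x y
    by (simp add: dist_norm P_diff P_norm)
  obtain l where l: "l \<ge> 0"
    "\<And>x y. x \<in> cball (P z) r \<Longrightarrow> y \<in> cball (P z) r \<Longrightarrow> \<bar>g x - g y\<bar> \<le> l * dist x y"
    using Ck_on_imp_lipschitz_cball[OF g, of "P z" r] by auto
  \<comment> \<open>The chart describes points of the open domain by a strict inequality; on the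
    closure the weak inequality survives by continuity.\<close>
  have closure_le: "y \<bullet> e \<le> g (P y)" if "y \<in> closure \<Omega>" "y \<in> ball z r" for y
  proof -
    have "closed {y. y \<bullet> e \<le> g (P y)}"
      unfolding P_def
      by (intro closed_Collect_le continuous_intros
          continuous_on_compose2[OF Ck_on_continuous[OF g]]) auto
    moreover have "\<Omega> \<inter> ball z r \<subseteq> {y. y \<bullet> e \<le> g (P y)}"
      unfolding chart P_def by auto
    ultimately have "closure (\<Omega> \<inter> ball z r) \<subseteq> {y. y \<bullet> e \<le> g (P y)}"
      by (rule closure_minimal[rotated])
    moreover have "y \<in> closure (\<Omega> \<inter> ball z r)"
      using that open_Int_closure_subset[of "ball z r" \<Omega>] by (auto simp: Int_commute)
    ultimately show ?thesis by blast
  qed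
  \<comment> \<open>Chosen so that \<open>\<kappa> * (1 + l) < 1\<close>: the gain of height
    \<open>\<kappa> * t\<close> and the variation \<open>l * \<kappa> * t\<close> of the graph
    together stay below the descent \<open>t\<close>.\<close>
  define \<kappa> where "\<kappa> = 1 / (2 + l)"
  have \<kappa>: "0 < \<kappa>" "\<kappa> \<le> 1" "\<kappa> + l * \<kappa> < 1"
    using l(1) unfolding \<kappa>_def by (auto simp: field_simps)
  \<comment> \<open>Bounding both \<open>dist z x\<close> and \<open>t\<close> by \<open>r/3\<close>
    keeps the cone ball in the chart, since its points are within \<open>2 * t\<close> of
    \<open>x\<close>. For \<open>t = 0\<close> the ball is the single point \<open>x\<close>, where
    the strict inequality may fail.\<close>
  have "cball (x - t *\<^sub>R e) (\<kappa> * t) \<subseteq> closure \<Omega>"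
    if x: "x \<in> closure \<Omega>" "dist z x < r/3" and t: "0 \<le> t" "t \<le> r/3" for x t
  proof (cases "t = 0")
    case True
    then show ?thesis using x by simp
  next
    case False
    show ?thesis
    proof
      fix q assume q: "q \<in> cball (x - t *\<^sub>R e) (\<kappa> * t)"
      define w where "w = q - (x - t *\<^sub>R e)"
      have w: "norm w \<le> \<kappa> * t" "q = x - t *\<^sub>R e + w"
        using q by (auto simp: w_def dist_norm norm_minus_commute)
      have "\<kappa> * t \<le> 1 * t" using \<kappa> t by (intro mult_right_mono) auto
      then have "norm (w - t *\<^sub>R e) \<le> 2 * t"
        using norm_triangle_ineq4[of w "t *\<^sub>R e"] w(1) e t by simp
      then have "dist x q \<le> 2 * t"
        unfolding w(2) by (simp add: dist_norm algebra_simps norm_minus_commute)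
      then have qz: "dist z q < r" using dist_triangle[of z q x] x t by linarith
      have Pq: "P x - P q = - P w"
        unfolding P_diff w(2) using ee by (simp add: P_def algebra_simps)
      have "\<bar>g (P x) - g (P q)\<bar> \<le> l * dist (P x) (P q)"
        using x(2) qz P_lip[of z x] P_lip[of z q] r by (intro l(2)) auto
      also have "\<dots> \<le> l * (\<kappa> * t)"
        using P_norm[of w] w(1) l(1) by (intro mult_left_mono) (auto simp: dist_norm Pq)
      finally have gq: "g (P q) \<ge> g (P x) - l * (\<kappa> * t)" by linarith
      have "q \<bullet> e = x \<bullet> e - t + w \<bullet> e" using ee by (simp add: w(2) algebra_simps)
      moreover have "x \<bullet> e \<le> g (P x)" using x r by (intro closure_le) auto
      moreover have "w \<bullet> e \<le> \<kappa> * t"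
        using norm_cauchy_schwarz[of w e] e w(1) by simp
      moreover have "(\<kappa> + l * \<kappa>) * t < 1 * t"
        using \<kappa> t False by (intro mult_strict_right_mono) auto
      ultimately have "q \<bullet> e < g (P q)" using gq by (simp add: algebra_simps)
      then have "q \<in> \<Omega> \<inter> ball z r" unfolding chart P_def using qz by auto
      then show "q \<in> closure \<Omega>" using closure_subset by blast
    qed
  qed
  then show ?thesis using r e \<kappa> by (intro that[of "r/3" e \<kappa> "r/3"]) auto
qed

section \<open>Uniform consequences of the cone property: inscribed balls and Lipschitz
  paths\<close>

lemma compact_closure_domain: "bounded_C2_domain \<Omega> \<Longrightarrow> compact (closure \<Omega>)"
  unfolding bounded_C2_domain_def by (simp add: compact_closure)

text \<open>Stepping only \<open>t/2\<close> along the cone axis keeps a ball of radius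
  \<open>\<kappa> * t/2\<close> inside \<open>cball x t\<close>. Compactness of the closure replaces
  the local constants by minima over a finite subcover.\<close>

lemma domain_balls_dense:
  fixes \<Omega> :: "'a::euclidean_space set"
  assumes "bounded_C2_domain \<Omega>"
  obtains c r where "c > 0" "r > 0"
    "\<And>x t. x \<in> closure \<Omega> \<Longrightarrow> 0 \<le> t \<Longrightarrow> t \<le> r \<Longrightarrow> \<exists>y. cball y (c * t) \<subseteq> closure \<Omega> \<inter> cball x t"
proof -
  let ?P = "\<lambda>c r x. \<forall>t. 0 \<le> t \<longrightarrow> t \<le> r \<longrightarrow> (\<exists>y. cball y (c * t) \<subseteq> closure \<Omega> \<inter> cball x t)"
  have local: "\<exists>\<rho>>0. \<exists>c>0. \<exists>r>0. \<forall>x\<in>closure \<Omega> \<inter> ball z \<rho>. ?P c r x" if z: "z \<in> closure \<Omega>" for z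
  proof -
    obtain \<rho> e \<kappa> \<tau> where *: "\<rho> > 0" "norm e = 1" "0 < \<kappa>" "\<kappa> \<le> 1" "\<tau> > 0"
      "\<And>x t. x \<in> closure \<Omega> \<Longrightarrow> dist z x < \<rho> \<Longrightarrow> 0 \<le> t \<Longrightarrow> t \<le> \<tau> \<Longrightarrow>
         cball (x - t *\<^sub>R e) (\<kappa> * t) \<subseteq> closure \<Omega>"
      using bounded_C2_domain_cone[OF assms z] by metis
    have "\<exists>y. cball y (\<kappa> / 2 * t) \<subseteq> closure \<Omega> \<inter> cball x t"
      if "x \<in> closure \<Omega> \<inter> ball z \<rho>" "0 \<le> t" "t \<le> \<tau>" for x t
    proof -
      have "cball (x - (t/2) *\<^sub>R e) (\<kappa> * (t/2)) \<subseteq> closure \<Omega>"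
        using that by (intro *(6)) auto
      moreover have "cball (x - (t/2) *\<^sub>R e) (\<kappa> * (t/2)) \<subseteq> cball x t"
      proof
        fix y assume "y \<in> cball (x - (t/2) *\<^sub>R e) (\<kappa> * (t/2))"
        moreover have "\<kappa> * (t/2) \<le> 1 * (t/2)" using *(4) that by (intro mult_right_mono) auto
        moreover have "dist x (x - (t/2) *\<^sub>R e) = t/2" using *(2) that by (simp add: dist_norm)
        ultimately show "y \<in> cball x t"
          using dist_triangle[of x y "x - (t/2) *\<^sub>R e"] by auto
      qed
      ultimately show ?thesis by (intro exI[of _ "x - (t/2) *\<^sub>R e"]) auto
    qed
    then show ?thesis using * by (intro exI[of _ \<rho>] conjI exI[of _ "\<kappa>/2"] exI[of _ \<tau>]) auto
  qed
  obtain \<rho> c r where pos: "\<And>z. z \<in> closure \<Omega> \<Longrightarrow> \<rho> z > 0 \<and> c z > 0 \<and> r z > (0::real)"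
    and P: "\<And>z x. z \<in> closure \<Omega> \<Longrightarrow> x \<in> closure \<Omega> \<inter> ball z (\<rho> z) \<Longrightarrow> ?P (c z) (r z) x"
    using local by metis
  have "closure \<Omega> \<subseteq> (\<Union>z\<in>closure \<Omega>. ball z (\<rho> z))" using pos by force
  then obtain D where D: "D \<subseteq> closure \<Omega>" "finite D" "closure \<Omega> \<subseteq> (\<Union>z\<in>D. ball z (\<rho> z))"
    by (rule compactE_image[OF compact_closure_domain[OF assms], rotated]) auto
  have "closure \<Omega> \<noteq> {}" using assms by (auto simp: bounded_C2_domain_def)
  then have "D \<noteq> {}" using D by auto
  show ?thesis
  proof (rule that[of "Min (c ` D)" "Min (r ` D)"])
    show "0 < Min (c ` D)" "0 < Min (r ` D)" using D pos \<open>D \<noteq> {}\<close> by auto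
    fix x t assume x: "x \<in> closure \<Omega>" and t: "0 \<le> t" "t \<le> Min (r ` D)"
    then obtain z where z: "z \<in> D" "x \<in> ball z (\<rho> z)" using D by blast
    have "Min (r ` D) \<le> r z" using D z(1) by simp
    then have "t \<le> r z" using t by linarith
    then obtain y where y: "cball y (c z * t) \<subseteq> closure \<Omega> \<inter> cball x t"
      using P[of z x] D z x t by blast
    have "Min (c ` D) * t \<le> c z * t" using D z t by (intro mult_right_mono) auto
    then have "cball y (Min (c ` D) * t) \<subseteq> cball y (c z * t)" by (rule subset_cball)
    with y show "\<exists>y. cball y (Min (c ` D) * t) \<subseteq> closure \<Omega> \<inter> cball x t" by blast
  qed
qed

text \<open>Paths live on the whole line and stand still outside the unit interval. Thus
  \<open>M\<close> bounds the speed of a unit time walk, and a competitor that walks and then rests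
  is obtained from \<open>p\<close> by a time shift.\<close>

definition lipschitz_joined :: "'a::euclidean_space set \<Rightarrow> real \<Rightarrow> 'a \<Rightarrow> 'a \<Rightarrow> bool" where
  "lipschitz_joined K M x y \<longleftrightarrow> (\<exists>p. M-lipschitz_on UNIV p \<and> range p \<subseteq> K \<and>
     (\<forall>s\<le>0. p s = x) \<and> (\<forall>s\<ge>(1::real). p s = y))"

lemma lipschitz_joined_mono: "lipschitz_joined K M x y \<Longrightarrow> M \<le> M' \<Longrightarrow> lipschitz_joined K M' x y"
  unfolding lipschitz_joined_def by (metis lipschitz_on_le)

lemma lipschitz_joined_sym:
  assumes "lipschitz_joined K M x y"
  shows "lipschitz_joined K M y x"
proof -
  from assms obtain p where p: "M-lipschitz_on UNIV p" "range p \<subseteq> K"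
     "\<forall>s\<le>0. p s = x" "\<forall>s\<ge>(1::real). p s = y"
    unfolding lipschitz_joined_def by blast
  have "M-lipschitz_on UNIV (\<lambda>s. p (1 - s))"
  proof (rule lipschitz_onI)
    fix s t :: real
    show "dist (p (1 - s)) (p (1 - t)) \<le> M * dist s t"
      using lipschitz_onD[OF p(1), of "1 - s" "1 - t"] by (simp add: dist_real_def abs_minus_commute)
  qed (rule lipschitz_on_nonneg[OF p(1)])
  with p(2-) show ?thesis unfolding lipschitz_joined_def
    by (intro exI[of _ "\<lambda>s. p (1 - s)"]) auto
qed

text \<open>Since \<open>p\<close> and \<open>q\<close> are constant outside \<open>[0,1]\<close>, their concatenation is a sum, whose
  Lipschitz constant needs no case analysis.\<close>

lemma lipschitz_joined_trans:
  assumes "lipschitz_joined K M x y" "lipschitz_joined K N y z"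
  shows "lipschitz_joined K (2 * (M + N)) x z"
proof -
  from assms(1) obtain p where p: "M-lipschitz_on UNIV p" "range p \<subseteq> K"
     "\<forall>s\<le>0. p s = x" "\<forall>s\<ge>(1::real). p s = y"
    unfolding lipschitz_joined_def by blast
  from assms(2) obtain q where q: "N-lipschitz_on UNIV q" "range q \<subseteq> K"
     "\<forall>s\<le>0. q s = y" "\<forall>s\<ge>(1::real). q s = z"
    unfolding lipschitz_joined_def by blast
  define r where "r = (\<lambda>s. p (2 * s) + (q (2 * s - 1) - y))"
  have r: "r s = (if s \<le> 1/2 then p (2 * s) else q (2 * s - 1))" for s
    using p q by (auto simp: r_def)
  have "(2 * (M + N))-lipschitz_on UNIV r"
  proof (rule lipschitz_onI)
    fix s t :: real
    have "dist (r s) (r t) \<le> dist (p (2 * s)) (p (2 * t)) + dist (q (2 * s - 1)) (q (2 * t - 1))"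
      unfolding r_def dist_norm
      by (rule order_trans[OF eq_refl norm_triangle_ineq]) (simp add: algebra_simps)
    also have "\<dots> \<le> M * dist (2 * s) (2 * t) + N * dist (2 * s - 1) (2 * t - 1)"
      by (intro add_mono lipschitz_onD[OF p(1)] lipschitz_onD[OF q(1)]) auto
    also have "dist (2 * s) (2 * t) = 2 * dist s t" by (simp add: dist_real_def abs_if)
    also have "dist (2 * s - 1) (2 * t - 1) = 2 * dist s t" by (simp add: dist_real_def abs_if)
    also have "M * (2 * dist s t) + N * (2 * dist s t) = 2 * (M + N) * dist s t"
      by (simp add: algebra_simps)
    finally show "dist (r s) (r t) \<le> 2 * (M + N) * dist s t" .
  qed (use lipschitz_on_nonneg[OF p(1)] lipschitz_on_nonneg[OF q(1)] in auto)
  moreover have "range r \<subseteq> K" "\<forall>s\<le>0. r s = x" "\<forall>s\<ge>1. r s = z"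
    using p(2-) q(2-) unfolding r by auto
  ultimately show ?thesis unfolding lipschitz_joined_def by blast
qed

lemma lipschitz_joined_segment:
  assumes "closed_segment x y \<subseteq> K"
  shows "lipschitz_joined K (dist x y) x y"
proof -
  define c where "c = (\<lambda>s::real. max 0 (min 1 s))"
  define p where "p = (\<lambda>s. x + c s *\<^sub>R (y - x))"
  have "dist (p s) (p t) \<le> dist x y * dist s t" for s t
  proof -
    have "dist (p s) (p t) = \<bar>c s - c t\<bar> * dist x y"
      unfolding p_def dist_norm
      by (metis add_diff_cancel_left norm_minus_commute norm_scaleR scaleR_left_diff_distrib)
    also have "\<bar>c s - c t\<bar> \<le> dist s t" unfolding c_def dist_real_def by auto
    finally show ?thesis by (simp add: mult.commute mult_right_mono)
  qed
  then have "(dist x y)-lipschitz_on UNIV p" by (auto intro: lipschitz_onI)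
  moreover have "p s \<in> closed_segment x y" for s
    unfolding closed_segment_def mem_Collect_eq
    by (rule exI[of _ "c s"]) (auto simp: p_def c_def algebra_simps)
  moreover have "\<forall>s\<le>0. p s = x" "\<forall>s\<ge>1. p s = y" by (auto simp: p_def c_def)
  ultimately show ?thesis using assms unfolding lipschitz_joined_def by blast
qed

text \<open>Near \<open>z\<close>, two points are joined by descending along the cone axis, crossing
  inside one cone ball, and climbing back. Connectedness chains such paths with a constant depending
  on the end points; a finite subcover and a fixed base point make it uniform.\<close>

lemma domain_lipschitz_joined:
  fixes \<Omega> :: "'a::euclidean_space set"
  assumes "bounded_C2_domain \<Omega>"
  obtains M where "\<And>x y. x \<in> closure \<Omega> \<Longrightarrow> y \<in> closure \<Omega> \<Longrightarrow> lipschitz_joined (closure \<Omega>) M x y"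
proof -
  let ?K = "closure \<Omega>"
  have local: "\<exists>\<rho>>0. \<exists>M. \<forall>x\<in>?K \<inter> ball z \<rho>. \<forall>y\<in>?K \<inter> ball z \<rho>. lipschitz_joined ?K M x y"
    if z: "z \<in> ?K" for z
  proof -
    obtain \<rho> e \<kappa> \<tau> where *: "\<rho> > 0" "norm e = 1" "0 < \<kappa>" "\<kappa> \<le> 1" "\<tau> > 0"
      "\<And>x t. x \<in> ?K \<Longrightarrow> dist z x < \<rho> \<Longrightarrow> 0 \<le> t \<Longrightarrow> t \<le> \<tau> \<Longrightarrow>
         cball (x - t *\<^sub>R e) (\<kappa> * t) \<subseteq> ?K"
      using bounded_C2_domain_cone[OF assms z] by metis
    have shift: "lipschitz_joined ?K \<tau> x (x - \<tau> *\<^sub>R e)" if "x \<in> ?K" "dist z x < \<rho>" for x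
    proof -
      have "closed_segment x (x - \<tau> *\<^sub>R e) \<subseteq> ?K"
      proof
        fix y assume "y \<in> closed_segment x (x - \<tau> *\<^sub>R e)"
        then obtain u where u: "0 \<le> u" "u \<le> 1" "y = x - (u * \<tau>) *\<^sub>R e"
          by (auto simp: closed_segment_def algebra_simps)
        have "u * \<tau> \<le> \<tau>" using u *(5) by (simp add: mult_left_le_one_le)
        then have "cball (x - (u * \<tau>) *\<^sub>R e) (\<kappa> * (u * \<tau>)) \<subseteq> ?K"
          using u *(5) that by (intro *(6)) auto
        moreover have "y \<in> cball (x - (u * \<tau>) *\<^sub>R e) (\<kappa> * (u * \<tau>))"
          using u *(3,5) by simp
        ultimately show "y \<in> ?K" by blast
      qed
      from lipschitz_joined_segment[OF this] show ?thesis
        using *(2,5) by (simp add: dist_norm)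
    qed
    \<comment> \<open>Three legs of speed at most \<open>\<tau>\<close>, concatenated by two
      applications of \<open>lipschitz_joined_trans\<close>. The radius
      \<open>\<kappa> * \<tau> / 2\<close> places the lowered \<open>y\<close> in the cone ball
      around the lowered \<open>x\<close>.\<close>
    have "lipschitz_joined ?K (2 * (2 * (\<tau> + \<tau>) + \<tau>)) x y"
      if x: "x \<in> ?K" "dist z x < min \<rho> (\<kappa> * \<tau> / 2)" and y: "y \<in> ?K" "dist z y < min \<rho> (\<kappa> * \<tau> / 2)" for x y
    proof -
      have d: "dist x y \<le> \<kappa> * \<tau>" using dist_triangle2[of x y z] x y by (simp add: dist_commute)
      have "y - \<tau> *\<^sub>R e \<in> cball (x - \<tau> *\<^sub>R e) (\<kappa> * \<tau>)" "x - \<tau> *\<^sub>R e \<in> cball (x - \<tau> *\<^sub>R e) (\<kappa> * \<tau>)"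
        using d *(3,5) by (auto simp: dist_norm)
      then have "closed_segment (x - \<tau> *\<^sub>R e) (y - \<tau> *\<^sub>R e) \<subseteq> cball (x - \<tau> *\<^sub>R e) (\<kappa> * \<tau>)"
        by (intro closed_segment_subset convex_cball)
      also have "\<dots> \<subseteq> ?K" using x *(5) by (intro *(6)) auto
      finally have "lipschitz_joined ?K (dist (x - \<tau> *\<^sub>R e) (y - \<tau> *\<^sub>R e)) (x - \<tau> *\<^sub>R e) (y - \<tau> *\<^sub>R e)"
        by (rule lipschitz_joined_segment)
      moreover have "\<kappa> * \<tau> \<le> 1 * \<tau>" using *(4,5) by (intro mult_right_mono) auto
      ultimately have "lipschitz_joined ?K \<tau> (x - \<tau> *\<^sub>R e) (y - \<tau> *\<^sub>R e)"
        using d by (auto simp: dist_norm intro: lipschitz_joined_mono)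
      then show ?thesis
        using x y by (intro lipschitz_joined_trans[OF lipschitz_joined_trans[OF shift]
              lipschitz_joined_sym[OF shift]]) auto
    qed
    then show ?thesis using *
      by (intro exI[of _ "min \<rho> (\<kappa> * \<tau> / 2)"] conjI exI[of _ "2 * (2 * (\<tau> + \<tau>) + \<tau>)"]) auto
  qed
  obtain \<rho> N where \<rho>: "\<And>z. z \<in> ?K \<Longrightarrow> \<rho> z > 0"
    and N: "\<And>z x y. z \<in> ?K \<Longrightarrow> x \<in> ?K \<inter> ball z (\<rho> z) \<Longrightarrow> y \<in> ?K \<inter> ball z (\<rho> z) \<Longrightarrow>
      lipschitz_joined ?K (N z) x y"
    using local by metis
  have conn: "\<exists>M. lipschitz_joined ?K M x y" if "x \<in> ?K" "y \<in> ?K" for x y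
  proof (rule connected_equivalence_relation[OF _ that])
    show "connected ?K" using assms by (simp add: bounded_C2_domain_def connected_imp_connected_closure)
    show "\<exists>M. lipschitz_joined ?K M y x" if "\<exists>M. lipschitz_joined ?K M x y" for x y
      using that lipschitz_joined_sym by blast
    show "\<exists>M. lipschitz_joined ?K M x z"
      if "\<exists>M. lipschitz_joined ?K M x y" "\<exists>M. lipschitz_joined ?K M y z" for x y z
      using that lipschitz_joined_trans by blast
    show "\<exists>T. openin (top_of_set ?K) T \<and> a \<in> T \<and> (\<forall>x\<in>T. \<exists>M. lipschitz_joined ?K M a x)"
      if "a \<in> ?K" for a
    proof (intro exI conjI ballI)
      show "openin (top_of_set ?K) (?K \<inter> ball a (\<rho> a))" by (simp add: openin_open_Int)
      show a: "a \<in> ?K \<inter> ball a (\<rho> a)" using \<rho> that by simp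
      show "lipschitz_joined ?K (N a) a x" if "x \<in> ?K \<inter> ball a (\<rho> a)" for x
        using N[OF \<open>a \<in> ?K\<close> a that] .
    qed
  qed
  have "?K \<noteq> {}" using assms by (simp add: bounded_C2_domain_def)
  then obtain x0 where x0: "x0 \<in> ?K" by (metis all_not_in_conv)
  obtain C where C: "\<And>z. z \<in> ?K \<Longrightarrow> lipschitz_joined ?K (C z) x0 z"
    using conn[OF x0] by metis
  have "?K \<subseteq> (\<Union>z\<in>?K. ball z (\<rho> z))" using \<rho> by force
  then obtain D where D: "D \<subseteq> ?K" "finite D" "?K \<subseteq> (\<Union>z\<in>D. ball z (\<rho> z))"
    by (rule compactE_image[OF compact_closure_domain[OF assms], rotated]) auto
  define B where "B = Max ((\<lambda>z. 2 * (C z + N z)) ` D)"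
  have B: "lipschitz_joined ?K B x0 y" if y: "y \<in> ?K" for y
  proof -
    obtain z where z: "z \<in> D" "y \<in> ball z (\<rho> z)" using D y by blast
    then have "z \<in> ?K" using D by blast
    then have "lipschitz_joined ?K (2 * (C z + N z)) x0 y"
      using C N[of z z y] \<rho> z y by (intro lipschitz_joined_trans) auto
    moreover have "2 * (C z + N z) \<le> B" unfolding B_def using z D by (intro Max_ge) auto
    ultimately show ?thesis by (rule lipschitz_joined_mono)
  qed
  show ?thesis
    by (rule that[of "2 * (B + B)"])
      (intro lipschitz_joined_trans[OF lipschitz_joined_sym[OF B] B])
qed

section \<open>From integrals of squares to pointwise bounds\<close>

lemma integrable_lebesgue_on_compact:
  fixes f :: "'a::euclidean_space \<Rightarrow> real"
  assumes "compact S" "continuous_on S f"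
  shows "integrable (lebesgue_on S) f"
proof -
  have *: "integrable lborel (\<lambda>x. indicator S x *\<^sub>R f x)"
    using assms by (rule borel_integrable_compact)
  then have "integrable lebesgue (\<lambda>x. indicator S x *\<^sub>R f x)"
    using integrable_completion[of "\<lambda>x. indicator S x *\<^sub>R f x" lborel] by auto
  moreover have "S \<in> sets lebesgue" using assms(1) by (simp add: borel_compact)
  ultimately show ?thesis by (subst integrable_restrict_space) auto
qed

text \<open>A Lipschitz function that is large at a point is large on a ball around it, a fixed
  proportion of which lies in the domain.\<close>

lemma lipschitz_power_le_integral_square:
  fixes \<Omega> :: "'a::euclidean_space set"
  assumes \<Omega>: "bounded_C2_domain \<Omega>" and pos: "\<Lambda> > 0" "B > 0"
  obtains C where "C > 0"
    "\<And>f x. (\<And>x y. x \<in> closure \<Omega> \<Longrightarrow> y \<in> closure \<Omega> \<Longrightarrow> \<bar>f x - f y\<bar> \<le> \<Lambda> * dist x y) \<Longrightarrow>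
      (\<And>x. x \<in> closure \<Omega> \<Longrightarrow> \<bar>f x\<bar> \<le> B) \<Longrightarrow> x \<in> closure \<Omega> \<Longrightarrow>
      \<bar>f x\<bar> ^ (DIM('a) + 2) \<le> C * (\<integral>x. (f x)\<^sup>2 \<partial>lebesgue_on (closure \<Omega>))"
proof -
  let ?K = "closure \<Omega>"
  let ?d = "DIM('a)"
  let ?V = "unit_ball_vol (real ?d)"
  have K: "compact ?K" using \<Omega> by (rule compact_closure_domain)
  obtain c r where c: "c > 0" "r > 0"
    "\<And>x t. x \<in> ?K \<Longrightarrow> 0 \<le> t \<Longrightarrow> t \<le> r \<Longrightarrow> \<exists>y. cball y (c * t) \<subseteq> ?K \<inter> cball x t"
    using domain_balls_dense[OF \<Omega>] by metis
  \<comment> \<open>For \<open>a = \<bar>f x\<bar> \<le> B\<close> the radius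
    \<open>t = q * a\<close> satisfies \<open>t \<le> r\<close>, so an inscribed ball exists, and
    \<open>\<Lambda> * t \<le> a / 2\<close>, so \<open>\<bar>f\<bar> \<ge> a / 2\<close> on that
    ball.\<close>
  define q where "q = min (1 / (2 * \<Lambda>)) (r / B)"
  have q: "q > 0" "q \<le> 1 / (2 * \<Lambda>)" "q \<le> r / B" using pos c by (auto simp: q_def)
  \<comment> \<open>The square is at least \<open>a^2 / 4\<close> on a ball of volume
    \<open>?V * (c * q * a) ^ ?d\<close>; \<open>C\<close> is the reciprocal of the coefficient of
    \<open>a ^ (?d + 2)\<close> in the product of the two.\<close>
  define C where "C = 4 / (?V * (c * q) ^ ?d)"
  have "C > 0" unfolding C_def using c q by (intro divide_pos_pos mult_pos_pos) auto
  moreover have "\<bar>f x\<bar> ^ (?d + 2) \<le> C * (\<integral>x. (f x)\<^sup>2 \<partial>lebesgue_on ?K)"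
    if lip: "\<And>x y. x \<in> ?K \<Longrightarrow> y \<in> ?K \<Longrightarrow> \<bar>f x - f y\<bar> \<le> \<Lambda> * dist x y"
      and bd: "\<And>x. x \<in> ?K \<Longrightarrow> \<bar>f x\<bar> \<le> B" and x: "x \<in> ?K" for f x
  proof -
    define a where "a = \<bar>f x\<bar>"
    define t where "t = q * a"
    have a: "0 \<le> a" "a \<le> B" using bd x by (auto simp: a_def)
    have t0: "0 \<le> t" using a q by (simp add: t_def)
    have "t \<le> (r / B) * B" unfolding t_def using a q pos c by (intro mult_mono) auto
    then have tr: "t \<le> r" using pos by simp
    have "\<Lambda> * t \<le> \<Lambda> * (1 / (2 * \<Lambda>) * a)"
      unfolding t_def using a q pos by (intro mult_left_mono mult_right_mono) auto
    then have t\<Lambda>: "\<Lambda> * t \<le> a / 2" using pos by simp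
    obtain y where y: "cball y (c * t) \<subseteq> ?K" "cball y (c * t) \<subseteq> cball x t"
      using c(3)[OF x t0 tr] by blast
    have sq: "a\<^sup>2 / 4 \<le> (f w)\<^sup>2" if w: "w \<in> cball y (c * t)" for w
    proof -
      have "\<bar>f x - f w\<bar> \<le> \<Lambda> * dist x w" using w y(1) by (intro lip x) auto
      also have "\<dots> \<le> \<Lambda> * t" using w y(2) pos by (intro mult_left_mono) auto
      finally have "a / 2 \<le> \<bar>f w\<bar>" using t\<Lambda> unfolding a_def by linarith
      then have "(a / 2)\<^sup>2 \<le> \<bar>f w\<bar>\<^sup>2" using a by (intro power_mono) auto
      then show ?thesis by (simp add: power_divide)
    qed
    have "\<Lambda>-lipschitz_on ?K f"
      using lip pos by (intro lipschitz_onI) (auto simp: dist_real_def)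
    then have cont: "continuous_on ?K f" by (rule lipschitz_on_continuous_on)
    have Ks: "?K \<in> sets lebesgue" using K by (simp add: borel_compact)
    have eq: "indicator ?K w *\<^sub>R indicator (cball y (c * t)) w = (indicator (cball y (c * t)) w :: real)" for w
      using y(1) by (auto simp: indicator_def)
    have ball_int: "integrable (lebesgue_on ?K) (\<lambda>w. (a\<^sup>2 / 4) * indicator (cball y (c * t)) w)"
    proof (intro integrable_mult_right impI, subst integrable_restrict_space)
      show "integrable lebesgue (\<lambda>w. indicator ?K w *\<^sub>R indicator (cball y (c * t)) w :: real)"
        unfolding eq using emeasure_bounded_finite[OF bounded_cball[of y "c * t"]]
        by (intro integrable_real_indicator) (simp_all add: less_top)
    qed (use Ks in auto)
    have "a\<^sup>2 / 4 * (?V * (c * t) ^ ?d) = (\<integral>w. (a\<^sup>2 / 4) * indicator (cball y (c * t)) w \<partial>lebesgue_on ?K)"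
    proof -
      have "(\<integral>w. indicator (cball y (c * t)) w \<partial>lebesgue_on ?K) = measure lebesgue (cball y (c * t))"
        using Ks by (subst integral_restrict_space) (simp_all add: eq[unfolded real_scaleR_def])
      also have "\<dots> = ?V * (c * t) ^ ?d"
        using content_cball[of "c * t" y] c t0 by (simp add: measure_completion)
      finally show ?thesis by simp
    qed
    also have "\<dots> \<le> (\<integral>x. (f x)\<^sup>2 \<partial>lebesgue_on ?K)"
      using cont sq by (intro integral_mono ball_int integrable_lebesgue_on_compact[OF K])
        (auto intro!: continuous_intros simp: indicator_def)
    finally have le: "a\<^sup>2 / 4 * (?V * (c * t) ^ ?d) \<le> (\<integral>x. (f x)\<^sup>2 \<partial>lebesgue_on ?K)" .
    have "C * (a\<^sup>2 / 4 * (?V * (c * t) ^ ?d)) = a ^ (?d + 2)"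
      using c(1) q(1) less_imp_neq[OF unit_ball_vol_pos[of "real ?d"]] unfolding C_def t_def
      by (simp add: power_mult_distrib power_add power2_eq_square field_simps)
    then show ?thesis using mult_left_mono[OF le, of C] \<open>C > 0\<close> by (simp add: a_def)
  qed
  ultimately show ?thesis using that by blast
qed

section \<open>Probability measures and curves\<close>

lemma prob_onD:
  assumes "\<mu> \<in> prob_on K"
  shows "prob_space \<mu>" "sets \<mu> = sets (restrict_space borel K)" "space \<mu> = K"
proof -
  show *: "prob_space \<mu>" "sets \<mu> = sets (restrict_space borel K)"
    using assms unfolding prob_on_def by auto
  show "space \<mu> = K" using sets_eq_imp_space_eq[OF *(2)] by (simp add: space_restrict_space)
qed

lemma prob_on_measurable:
  fixes f :: "'a::topological_space \<Rightarrow> 'b::topological_space"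
  assumes "\<mu> \<in> prob_on K" "continuous_on K f"
  shows "f \<in> borel_measurable \<mu>"
  using borel_measurable_continuous_on_restrict[OF assms(2)]
    measurable_cong_sets[OF prob_onD(2)[OF assms(1)] refl] by blast

lemma prob_on_integrable:
  fixes f :: "'a::topological_space \<Rightarrow> real"
  assumes "\<mu> \<in> prob_on K" "continuous_on K f" "compact K"
  shows "integrable \<mu> f"
proof -
  interpret prob_space \<mu> using prob_onD[OF assms(1)] by simp
  have "bounded (f ` K)" using assms by (intro compact_imp_bounded compact_continuous_image)
  then obtain B where "\<And>x. x \<in> K \<Longrightarrow> norm (f x) \<le> B" by (auto simp: bounded_iff)
  then show ?thesis
    using prob_on_measurable[OF assms(1,2)] prob_onD(3)[OF assms(1)]
    by (intro integrable_const_bound[of _ B]) auto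
qed

text \<open>Every point outside the support has a null neighbourhood, and separability lets it be
  shrunk to one of countably many null balls with centre in \<open>D\<close> and rational radius.
  Centres outside \<open>S\<close> are allowed, since the balls are intersected with
  \<open>S\<close>.\<close>

lemma AE_in_spt:
  fixes M :: "'b::metric_space measure"
  assumes sets: "sets M = sets (restrict_space borel S)"
    and D: "countable D" "S \<subseteq> closure D"
  shows "AE x in M. x \<in> spt M"
proof -
  have space: "space M = S" using sets_eq_imp_space_eq[OF sets] by (simp add: space_restrict_space)
  define I where "I = {(d, q). d \<in> D \<and> q \<in> \<rat> \<and> emeasure M (ball d q \<inter> S) = 0}"
  have "I \<subseteq> D \<times> \<rat>" by (auto simp: I_def)
  then have I: "countable I"
    by (rule countable_subset) (intro countable_SIGMA D countable_rat)
  have null: "(\<Union>(d, q)\<in>I. ball d q \<inter> S) \<in> null_sets M"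
    by (intro null_sets_UN'[OF I])
      (auto simp: I_def null_sets_def sets sets_restrict_space intro!: rev_image_eqI[of "ball _ _"])
  have "\<exists>i\<in>I. x \<in> (case i of (d, q) \<Rightarrow> ball d q \<inter> S)" if x: "x \<in> S" "x \<notin> spt M" for x
  proof -
    obtain U where U: "open U" "x \<in> U" "emeasure M (U \<inter> S) = 0"
      using x unfolding spt_def space by auto
    then obtain e where e: "e > 0" "ball x e \<subseteq> U" by (meson openE)
    obtain q where q: "q \<in> \<rat>" "0 < q" "q < e / 2"
      using Rats_dense_in_real[of 0 "e/2"] e by auto
    obtain d where d: "d \<in> D" "dist d x < q"
      using D(2) x(1) q(2) closure_approachable[of x D] by blast
    have sub: "ball d q \<subseteq> ball x e"
    proof
      fix y assume "y \<in> ball d q"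
      then show "y \<in> ball x e" using dist_triangle[of x y d] d q by (auto simp: dist_commute)
    qed
    have "emeasure M (ball d q \<inter> S) \<le> emeasure M (U \<inter> S)"
      using sub e U(1) by (intro emeasure_mono) (auto simp: sets sets_restrict_space)
    then have "(d, q) \<in> I" using U d q by (simp add: I_def)
    moreover have "x \<in> ball d q \<inter> S" using d x by simp
    ultimately show ?thesis by (intro bexI[of _ "(d, q)"]) auto
  qed
  then show ?thesis by (intro AE_I'[OF null]) (auto simp: space)
qed

text \<open>\<open>d1\<close> is a supremum of reals, so it dominates its members only once they are
  known to be bounded above; the oscillation over \<open>K\<close>, at most the Lipschitz constant
  times the diameter, provides this. The rest is scaling to Lipschitz constant one, with
  \<open>l = 0\<close> treated apart.\<close>

lemma prob_on_lipschitz_diff_le_d1: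
  fixes f :: "'a::metric_space \<Rightarrow> real"
  assumes m: "m1 \<in> prob_on K" "m2 \<in> prob_on K" and K: "compact K"
    and f: "l-lipschitz_on K f"
  shows "(\<integral>x. f x \<partial>m1) - (\<integral>x. f x \<partial>m2) \<le> l * d1 K m1 m2"
proof -
  let ?I = "\<lambda>\<phi>. (\<integral>x. \<phi> x \<partial>m1) - (\<integral>x. \<phi> x \<partial>m2)"
  interpret m1: prob_space m1 using prob_onD[OF m(1)] by simp
  interpret m2: prob_space m2 using prob_onD[OF m(2)] by simp
  have le: "?I \<phi> \<le> c * diameter K" if \<phi>: "c-lipschitz_on K \<phi>" for c \<phi>
  proof -
    obtain x0 where x0: "x0 \<in> K" using m1.not_empty prob_onD(3)[OF m(1)] by blast
    have cont: "continuous_on K \<phi>" using \<phi> by (rule lipschitz_on_continuous_on)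
    have "\<bar>\<phi> x - \<phi> y\<bar> \<le> c * diameter K" if "x \<in> K" "y \<in> K" for x y
    proof -
      have "\<bar>\<phi> x - \<phi> y\<bar> \<le> c * dist x y"
        using lipschitz_onD[OF \<phi> that] by (simp add: dist_real_def)
      also have "\<dots> \<le> c * diameter K"
        using diameter_bounded_bound[OF compact_imp_bounded[OF K] that] lipschitz_on_nonneg[OF \<phi>]
        by (rule mult_left_mono)
      finally show ?thesis .
    qed
    then have osc: "\<phi> x \<le> \<phi> y + c * diameter K" if "x \<in> K" "y \<in> K" for x y
      using that by (smt (verit))
    have "(\<integral>x. \<phi> x \<partial>m1) \<le> \<phi> y + c * diameter K" if "y \<in> K" for y
      using osc that prob_onD(3)[OF m(1)]
      by (intro m1.integral_le_const prob_on_integrable[OF m(1) cont K] AE_I2) auto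
    then have "(\<integral>x. \<phi> x \<partial>m1) - c * diameter K \<le> (\<integral>x. \<phi> x \<partial>m2)"
      using prob_onD(3)[OF m(2)]
      by (intro m2.integral_ge_const prob_on_integrable[OF m(2) cont K] AE_I2) (auto simp: algebra_simps)
    then show ?thesis by simp
  qed
  have d1: "?I \<phi> \<le> d1 K m1 m2" if "1-lipschitz_on K \<phi>" for \<phi>
    unfolding d1_def using that le by (intro cSup_upper bdd_aboveI[of _ "1 * diameter K"]) blast+
  show ?thesis
  proof (cases "l = 0")
    case True
    then show ?thesis using le[OF f] by simp
  next
    case False
    then have l: "l > 0" using lipschitz_on_nonneg[OF f] by simp
    have "1-lipschitz_on K (\<lambda>x. f x / l)"
    proof (rule lipschitz_onI)
      fix x y assume "x \<in> K" "y \<in> K"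
      have "dist (f x / l) (f y / l) = dist (f x) (f y) / l"
        using l by (simp add: dist_real_def flip: diff_divide_distrib)
      then show "dist (f x / l) (f y / l) \<le> 1 * dist x y"
        using lipschitz_onD[OF f \<open>x \<in> K\<close> \<open>y \<in> K\<close>] l by (simp add: divide_le_eq mult.commute)
    qed simp
    from d1[OF this] l show ?thesis by (simp add: field_simps)
  qed
qed

lemma d1_nonneg:
  assumes "m1 \<in> prob_on K" "m2 \<in> prob_on K" "compact K"
  shows "0 \<le> d1 K m1 m2"
  using prob_on_lipschitz_diff_le_d1[OF assms lipschitz_on_le[OF lipschitz_on_constant[of K 0], of 1]]
  by simp

text \<open>Lipschitz functions determine a measure: the truncated distances
  \<open>max 0 (1 - n * infdist x C)\<close> decrease to the indicator of a closed set, and closed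
  sets form an intersection-stable generator of the Borel sets.\<close>

lemma d1_eq_0_imp_eq:
  fixes m1 m2 :: "'a::metric_space measure"
  assumes m: "m1 \<in> prob_on K" "m2 \<in> prob_on K" and K: "compact K" and d: "d1 K m1 m2 = 0"
  shows "m1 = m2"
proof -
  have lip: "(\<integral>x. f x \<partial>m1) = (\<integral>x. f x \<partial>m2)" if f: "l-lipschitz_on K f" for l and f :: "'a \<Rightarrow> real"
  proof -
    have "l-lipschitz_on K (\<lambda>x. - f x)"
      using f unfolding lipschitz_on_def by (simp add: dist_minus)
    then show ?thesis
      using prob_on_lipschitz_diff_le_d1[OF m K f]
        prob_on_lipschitz_diff_le_d1[OF m K, of l "\<lambda>x. - f x"] d by simp
  qed
  \<comment> \<open>Extending the measures by zero to the whole space allows the generator to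
    consist of all closed sets instead of their traces on \<open>K\<close>.\<close>
  define \<mu> where "\<mu> = (\<lambda>m::'a measure. distr m borel (\<lambda>x. x))"
  have id_meas: "(\<lambda>x. x) \<in> measurable m borel" if "m \<in> prob_on K" for m
    using prob_on_measurable[OF that continuous_on_id] .
  have emeas: "emeasure (\<mu> m) B = emeasure m (B \<inter> K)" if "m \<in> prob_on K" "B \<in> sets borel" for m B
    unfolding \<mu>_def using emeasure_distr[OF id_meas] that prob_onD(3)[OF that(1)]
    by (simp add: Int_commute)
  have closed_eq: "emeasure m1 (C \<inter> K) = emeasure m2 (C \<inter> K)" if C: "closed C" "C \<noteq> {}" for C
  proof -
    define f where "f = (\<lambda>n::nat. \<lambda>x. max 0 (1 - real n * infdist x C))"
    have f01: "0 \<le> f n x" "f n x \<le> 1" for n x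
      unfolding f_def using infdist_nonneg[of x C] by auto
    have f_lip: "(real n)-lipschitz_on K (f n)" for n
    proof (rule lipschitz_onI)
      fix x y
      have "real n * \<bar>infdist x C - infdist y C\<bar> \<le> real n * dist x y"
        by (intro mult_left_mono infdist_triangle_abs) auto
      then have "\<bar>real n * infdist x C - real n * infdist y C\<bar> \<le> real n * dist x y"
        by (simp add: abs_mult flip: right_diff_distrib)
      then show "dist (f n x) (f n y) \<le> real n * dist x y"
        unfolding f_def dist_real_def by linarith
    qed simp
    have f_lim: "(\<lambda>n. f n x) \<longlonglongrightarrow> indicator (C \<inter> K) x" if "x \<in> K" for x
    proof (cases "x \<in> C")
      case True
      then show ?thesis using that by (simp add: f_def)
    next
      case False
      then have pos: "infdist x C > 0" using C infdist_pos_not_in_closed by blast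
      obtain N where N: "real N > 1 / infdist x C" using reals_Archimedean2 by blast
      have "f n x = 0" if "n \<ge> N" for n
      proof -
        have "1 < real N * infdist x C" using N pos by (simp add: field_simps)
        also have "\<dots> \<le> real n * infdist x C" using that pos by simp
        finally show ?thesis by (simp add: f_def)
      qed
      then have "eventually (\<lambda>n. f n x = 0) sequentially" using eventually_sequentially by blast
      then show ?thesis using False by (simp add: tendsto_eventually)
    qed
    have "(\<lambda>n. \<integral>x. f n x \<partial>m) \<longlonglongrightarrow> measure m (C \<inter> K)" if "m \<in> prob_on K" for m
    proof -
      interpret prob_space m using prob_onD[OF that] by simp
      note sp = prob_onD(2,3)[OF that]
      have CK: "C \<inter> K \<in> sets m" using C by (auto simp: sp sets_restrict_space)
      have "(\<lambda>n. \<integral>x. f n x \<partial>m) \<longlonglongrightarrow> (\<integral>x. indicator (C \<inter> K) x \<partial>m)"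
      proof (rule integral_dominated_convergence[where w = "\<lambda>_. 1"])
        show "f n \<in> borel_measurable m" for n
          using lipschitz_on_continuous_on[OF f_lip] by (rule prob_on_measurable[OF that])
      qed (use CK f_lim f01 sp in \<open>auto intro!: AE_I2\<close>)
      then show ?thesis using CK by simp
    qed
    from this[OF m(1)] this[OF m(2)] have "measure m1 (C \<inter> K) = measure m2 (C \<inter> K)"
      using lip[OF f_lip] by (simp add: LIMSEQ_unique)
    then show ?thesis
      using prob_onD(1)[OF m(1)] prob_onD(1)[OF m(2)]
      by (simp add: finite_measure.emeasure_eq_measure prob_space_def)
  qed
  have "\<mu> m1 = \<mu> m2"
  proof (rule measure_eqI_generator_eq[where E = "Collect closed" and \<Omega> = UNIV and A = "\<lambda>_. UNIV"])
    show "emeasure (\<mu> m1) X = emeasure (\<mu> m2) X" if "X \<in> Collect closed" for X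
      using that closed_eq[of X] m by (cases "X = {}") (auto simp: emeas)
    show "emeasure (\<mu> m1) UNIV \<noteq> \<infinity>"
      using prob_space.emeasure_space_1[OF prob_onD(1)[OF m(1)]] prob_onD(3)[OF m(1)]
      by (simp add: emeas[OF m(1)])
    show "sets (\<mu> m1) = sigma_sets UNIV (Collect closed)" "sets (\<mu> m2) = sigma_sets UNIV (Collect closed)"
      by (simp_all add: \<mu>_def borel_eq_closed)
  qed (auto simp: Int_stable_def)
  show ?thesis
  proof (rule measure_eqI)
    show "sets m1 = sets m2" using prob_onD(2)[OF m(1)] prob_onD(2)[OF m(2)] by simp
    fix A assume "A \<in> sets m1"
    then obtain B where "B \<in> sets borel" "A = B \<inter> K"
      by (auto simp: prob_onD(2)[OF m(1)] sets_restrict_space)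
    then show "emeasure m1 A = emeasure m2 A"
      using emeas[OF m(1), of B] emeas[OF m(2), of B] \<open>\<mu> m1 = \<mu> m2\<close> by simp
  qed
qed

text \<open>Since division by zero returns zero, the quotient in \<open>F2\<close> gives a Lipschitz
  bound only where the distance is nonzero. Distinct measures do have positive distance by
  \<open>d1_eq_0_imp_eq\<close>, so no pair escapes.\<close>

lemma F2_lipschitz:
  assumes "F2 \<Omega> F" "compact (closure \<Omega>)"
  obtains B where "B \<ge> 0"
    "\<And>x m1 m2. m1 \<in> prob_on (closure \<Omega>) \<Longrightarrow> m2 \<in> prob_on (closure \<Omega>) \<Longrightarrow>
      \<bar>F x m1 - F x m2\<bar> \<le> B * d1 (closure \<Omega>) m1 m2"
proof -
  let ?K = "closure \<Omega>"
  obtain B where B: "\<And>x m1 m2. m1 \<in> prob_on ?K \<Longrightarrow> m2 \<in> prob_on ?K \<Longrightarrow> m1 \<noteq> m2 \<Longrightarrow>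
      \<bar>F x m1 - F x m2\<bar> / d1 ?K m1 m2 \<le> B"
    using assms(1) unfolding F2_def bdd_above_def by blast
  have "\<bar>F x m1 - F x m2\<bar> \<le> \<bar>B\<bar> * d1 ?K m1 m2" if m: "m1 \<in> prob_on ?K" "m2 \<in> prob_on ?K" for x m1 m2
  proof (cases "m1 = m2")
    case True
    then show ?thesis using d1_nonneg[OF m assms(2)] by simp
  next
    case False
    then have pos: "d1 ?K m1 m2 > 0"
      using d1_nonneg[OF m assms(2)] d1_eq_0_imp_eq[OF m assms(2)] by fastforce
    have "\<bar>F x m1 - F x m2\<bar> / d1 ?K m1 m2 \<le> \<bar>B\<bar>" using B[OF m False, of x] by linarith
    then show ?thesis using pos by (simp add: field_simps)
  qed
  then show ?thesis using that[of "\<bar>B\<bar>"] by simp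
qed

text \<open>Each curve is within \<open>1 / Suc j\<close> of a step function with \<open>n\<close>
  steps per unit time and values in a countable dense set. Picking one curve from each nonempty cell
  avoids constructing approximants inside \<open>curves K T\<close>; two curves of one cell differ
  by at most \<open>2 / Suc j\<close>.\<close>

lemma curves_separable:
  fixes K :: "'a::euclidean_space set"
  assumes "0 \<le> T"
  obtains D where "countable D" "curves K T \<subseteq> closure D"
proof -
  obtain Q :: "'a set" where Q: "countable Q" "\<And>U. open U \<Longrightarrow> U \<noteq> {} \<Longrightarrow> \<exists>q\<in>Q. q \<in> U"
    using countable_dense_setE by blast
  define cell where "cell = (\<lambda>(n::nat, j::nat, ws). {\<gamma> \<in> curves K T.
      \<forall>s\<in>{0..T}. dist (\<gamma> s) (ws ! nat \<lfloor>s * real n\<rfloor>) < 1 / real (Suc j)})"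
  \<comment> \<open>For an empty cell \<open>SOME\<close> returns an arbitrary curve, which is
    harmless: \<open>D\<close> only has to be countable and to approximate
    \<open>curves K T\<close>.\<close>
  define D where "D = (\<lambda>i. SOME \<gamma>. \<gamma> \<in> cell i) ` (UNIV \<times> UNIV \<times> lists Q)"
  have "countable D" unfolding D_def
    by (intro countable_image countable_SIGMA countable_lists Q(1) countableI_type)
  moreover have "\<gamma> \<in> closure D" if \<gamma>: "\<gamma> \<in> curves K T" for \<gamma>
  proof -
    have "\<exists>\<gamma>'\<in>D. dist \<gamma>' \<gamma> < e" if "e > 0" for e
    proof -
      obtain j :: nat where j: "1 / real (Suc j) < e / 2"
        using reals_Archimedean[of "e/2"] \<open>e > 0\<close> by (auto simp: inverse_eq_divide)
      define c where "c = 1 / (2 * real (Suc j))"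
      have c: "c > 0" by (simp add: c_def)
      have "uniformly_continuous_on {0..T} (apply_bcontfun \<gamma>)"
        by (intro compact_uniformly_continuous continuous_intros) auto
      then obtain \<delta> where \<delta>: "\<delta> > 0" "\<And>s s'. s \<in> {0..T} \<Longrightarrow> s' \<in> {0..T} \<Longrightarrow> dist s' s < \<delta> \<Longrightarrow>
          dist (\<gamma> s') (\<gamma> s) < c"
        using c unfolding uniformly_continuous_on_def by metis
      obtain n0 :: nat where n0: "1 / real (Suc n0) < \<delta>"
        using reals_Archimedean[OF \<delta>(1)] by (auto simp: inverse_eq_divide)
      define n where "n = Suc n0"
      have "\<exists>q\<in>Q. dist (\<gamma> (real k / real n)) q < c" for k
        using Q(2)[of "ball (\<gamma> (real k / real n)) c"] c by auto
      then obtain q where q: "\<And>k. q k \<in> Q" "\<And>k. dist (\<gamma> (real k / real n)) (q k) < c" by metis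
      \<comment> \<open>One entry for every \<open>k\<close> up to and including
        \<open>\<lfloor>T * n\<rfloor>\<close>, the index reached at \<open>s = T\<close>.\<close>
      define ws where "ws = map q [0..<Suc (nat \<lfloor>T * real n\<rfloor>)]"
      have ws: "ws \<in> lists Q" using q(1) by (auto simp: ws_def)
      have "dist (\<gamma> s) (ws ! nat \<lfloor>s * real n\<rfloor>) < 1 / real (Suc j)" if s: "s \<in> {0..T}" for s
      proof -
        define k where "k = nat \<lfloor>s * real n\<rfloor>"
        have "s * real n \<ge> 0" using s by simp
        then have k: "real k \<le> s * real n" "s * real n < real k + 1" unfolding k_def by linarith+
        have "k \<le> nat \<lfloor>T * real n\<rfloor>"
          unfolding k_def using s by (intro nat_mono floor_mono mult_right_mono) auto
        then have "ws ! k = q k" unfolding ws_def by (simp del: upt_Suc)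
        have kn: "real k / real n \<le> s" "s < real k / real n + 1 / real n"
          using k by (auto simp: n_def field_simps)
        have "dist (\<gamma> s) (\<gamma> (real k / real n)) < c"
          using kn s n0 by (intro \<delta>(2)) (auto simp: dist_real_def n_def)
        then have "dist (\<gamma> s) (q k) < c + c"
          using q(2)[of k] dist_triangle[of "\<gamma> s" "q k" "\<gamma> (real k / real n)"] by linarith
        also have "c + c = 1 / real (Suc j)" by (simp add: c_def field_simps)
        finally show ?thesis using \<open>ws ! k = q k\<close> by (simp add: k_def)
      qed
      then have mem: "\<gamma> \<in> cell (n, j, ws)" using \<gamma> by (simp add: cell_def)
      define \<gamma>' where "\<gamma>' = (SOME \<gamma>. \<gamma> \<in> cell (n, j, ws))"
      have mem': "\<gamma>' \<in> cell (n, j, ws)" unfolding \<gamma>'_def using mem by (rule someI)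
      have "\<gamma>' \<in> D" unfolding D_def \<gamma>'_def using ws by blast
      moreover have "dist \<gamma>' \<gamma> \<le> 2 / real (Suc j)"
      proof (rule dist_bound)
        fix s
        have near: "dist (\<gamma>' s) (\<gamma> s) \<le> 2 / real (Suc j)" if "s \<in> {0..T}" for s
        proof -
          have "dist (\<gamma> s) (ws ! nat \<lfloor>s * real n\<rfloor>) < 1 / real (Suc j)"
            "dist (\<gamma>' s) (ws ! nat \<lfloor>s * real n\<rfloor>) < 1 / real (Suc j)"
            using mem mem' that unfolding cell_def by auto
          then show ?thesis
            using dist_triangle2[of "\<gamma>' s" "\<gamma> s" "ws ! nat \<lfloor>s * real n\<rfloor>"]
              add_divide_distrib[of 1 1 "real (Suc j)"] by simp
        qed
        \<comment> \<open>The distance of bounded continuous functions is a supremum over the whole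
          line; constancy outside \<open>{0..T}\<close> reduces it to times clamped to that
          interval.\<close>
        show "dist (\<gamma>' s) (\<gamma> s) \<le> 2 / real (Suc j)"
        proof -
          have "\<alpha> s = \<alpha> (max 0 (min T s))" if "\<alpha> \<in> curves K T" for \<alpha>
          proof -
            have "s \<le> 0 \<Longrightarrow> \<alpha> s = \<alpha> 0" "T \<le> s \<Longrightarrow> \<alpha> s = \<alpha> T" using that unfolding curves_def by blast+
            then show ?thesis using assms by (cases "s \<le> 0"; cases "T \<le> s") (simp_all add: max_def min_def)
          qed
          then have "\<gamma> s = \<gamma> (max 0 (min T s))" "\<gamma>' s = \<gamma>' (max 0 (min T s))"
            using \<gamma> mem' unfolding cell_def by blast+
          then show ?thesis using near[of "max 0 (min T s)"] assms by simp
        qed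
      qed
      ultimately show ?thesis using j by (intro bexI[of _ \<gamma>']) auto
    qed
    then show ?thesis by (simp add: closure_approachable)
  qed
  ultimately show ?thesis using that by blast
qed

text \<open>Evaluation at a fixed time is continuous. For joint measurability, time is rounded down
  to a grid of mesh \<open>1 / Suc n\<close>: countably many times occur, so the rounded evaluation
  is measurable, and continuity of the curve passes to the limit. Tonelli for curve costs rests on
  this.\<close>

lemma eval_borel_measurable:
  fixes M :: "(real \<Rightarrow>\<^sub>C 'a::euclidean_space) measure"
  assumes "sets M = sets (restrict_space borel S)"
  shows "(\<lambda>\<gamma>. apply_bcontfun \<gamma> s) \<in> borel_measurable M"
    and "(\<lambda>(s, \<gamma>). apply_bcontfun \<gamma> s) \<in> borel_measurable (borel \<Otimes>\<^sub>M M)"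
proof -
  show eval: "(\<lambda>\<gamma>. apply_bcontfun \<gamma> s) \<in> borel_measurable M" for s
  proof -
    have "1-lipschitz_on S (\<lambda>\<gamma>::real \<Rightarrow>\<^sub>C 'a. apply_bcontfun \<gamma> s)"
      by (rule lipschitz_onI) (auto simp: dist_bounded)
    from borel_measurable_continuous_on_restrict[OF lipschitz_on_continuous_on[OF this]]
    show ?thesis using measurable_cong_sets[OF assms refl] by blast
  qed
  define f where "f = (\<lambda>n::nat. \<lambda>(s, \<gamma>::real \<Rightarrow>\<^sub>C 'a). \<gamma> (real_of_int \<lfloor>s * real (Suc n)\<rfloor> / real (Suc n)))"
  show "(\<lambda>(s, \<gamma>). apply_bcontfun \<gamma> s) \<in> borel_measurable (borel \<Otimes>\<^sub>M M)"
  proof (rule borel_measurable_LIMSEQ_metric)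
    show "f n \<in> borel_measurable (borel \<Otimes>\<^sub>M M)" for n
    proof -
      have "(\<lambda>x. (\<lambda>k x. apply_bcontfun (snd x) (real_of_int k / real (Suc n))) \<lfloor>fst x * real (Suc n)\<rfloor> x)
          \<in> borel_measurable (borel \<Otimes>\<^sub>M M)"
        by (rule measurable_compose_countable) (auto intro!: measurable_compose[OF measurable_snd eval])
      then show ?thesis by (simp add: f_def case_prod_beta)
    qed
    fix x :: "real \<times> (real \<Rightarrow>\<^sub>C 'a)" assume "x \<in> space (borel \<Otimes>\<^sub>M M)"
    obtain s \<gamma> where x: "x = (s, \<gamma>)" by (cases x)
    have "(\<lambda>n. real_of_int \<lfloor>s * real (Suc n)\<rfloor> / real (Suc n)) \<longlonglongrightarrow> s"
    proof (rule tendsto_sandwich[of "\<lambda>n. s - 1 / real (Suc n)" _ _ "\<lambda>_. s"])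
      show "(\<lambda>n. s - 1 / real (Suc n)) \<longlonglongrightarrow> s"
        using tendsto_diff[OF tendsto_const LIMSEQ_Suc[OF lim_1_over_n], of s] by simp
      show "eventually (\<lambda>n. s - 1 / real (Suc n) \<le> real_of_int \<lfloor>s * real (Suc n)\<rfloor> / real (Suc n)) sequentially"
      proof (rule always_eventually, rule allI)
        fix n
        have "s * real (Suc n) - 1 \<le> real_of_int \<lfloor>s * real (Suc n)\<rfloor>" by linarith
        then have "(s * real (Suc n) - 1) / real (Suc n) \<le> real_of_int \<lfloor>s * real (Suc n)\<rfloor> / real (Suc n)"
          by (rule divide_right_mono) simp
        then show "s - 1 / real (Suc n) \<le> real_of_int \<lfloor>s * real (Suc n)\<rfloor> / real (Suc n)"
          by (simp add: diff_divide_distrib del: of_nat_Suc)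
      qed
      show "eventually (\<lambda>n. real_of_int \<lfloor>s * real (Suc n)\<rfloor> / real (Suc n) \<le> s) sequentially"
        by (intro always_eventually allI) (simp add: divide_le_eq del: of_nat_Suc)
    qed simp
    moreover have "isCont (apply_bcontfun \<gamma>) s"
      using continuous_on_apply_bcontfun[of UNIV \<gamma>]
      by (simp add: continuous_on_eq_continuous_at del: continuous_on_apply_bcontfun)
    ultimately show "(\<lambda>n. f n x) \<longlonglongrightarrow> (case x of (s, \<gamma>) \<Rightarrow> apply_bcontfun \<gamma> s)"
      unfolding x f_def prod.case by (rule isCont_tendsto_compose[rotated])
  qed
qed

section \<open>The ergodic constant\<close>

text \<open>Completing the square in the quadratic lower bound shows that the set under the supremum
  is bounded above, so that the real supremum dominates its member at \<open>v = 0\<close>.\<close>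

lemma hamiltonian_ge:
  assumes "C > 0" "\<And>v. L x v \<ge> L x 0 + (norm v)\<^sup>2 / (2 * C)"
  shows "- L x 0 \<le> hamiltonian L x p"
proof -
  have "p \<bullet> v - L x v \<le> C * (norm p)\<^sup>2 / 2 - L x 0" for v
  proof -
    have "0 \<le> (C * norm p - norm v)\<^sup>2 / (2 * C)" using assms(1) by simp
    also have "\<dots> = C * (norm p)\<^sup>2 / 2 + (norm v)\<^sup>2 / (2 * C) - norm p * norm v"
      using assms(1) by (simp add: power2_eq_square field_simps)
    finally show ?thesis using assms(2)[of v] norm_cauchy_schwarz[of p v] by linarith
  qed
  then have "bdd_above (range (\<lambda>v. p \<bullet> v - L x v))" by (auto simp: bdd_above_def)
  from cSUP_upper[OF UNIV_I[of 0] this] show ?thesis by (simp add: hamiltonian_def)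
qed

lemma hamiltonian_0_le:
  assumes "\<And>v. L x v \<ge> L x 0"
  shows "hamiltonian L x 0 \<le> - L x 0"
  unfolding hamiltonian_def using assms by (intro cSUP_least) auto

text \<open>The supersolution inequality holds up to the boundary, so a global minimum of
  \<open>u\<close> can be tested directly. The subsolution inequality lives in the open domain while
  \<open>z\<close> may lie on its boundary, hence the detour through a small ball at a nearby
  interior point. Steepness is harmless because \<open>- L x 0\<close> bounds the Hamiltonian below
  for every momentum.\<close>

lemma constrained_viscosity_solution_constant:
  fixes \<Omega> :: "'a::euclidean_space set"
  assumes \<Omega>: "open \<Omega>" "compact (closure \<Omega>)" "\<Omega> \<noteq> {}"
    and L: "C > 0" "\<And>x v. L x v \<ge> L x 0 + (norm v)\<^sup>2 / (2 * C)"
    and u: "constrained_viscosity_solution \<Omega> (\<lambda>x p. hamiltonian L x p - f x) c u"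
    and G: "continuous_on (closure \<Omega>) (\<lambda>x. L x 0 + f x)" "\<And>x. x \<in> closure \<Omega> \<Longrightarrow> 0 \<le> L x 0 + f x"
    and z: "z \<in> closure \<Omega>" "L z 0 + f z = 0"
  shows "c = 0"
proof (rule antisym)
  have cont: "continuous_on (closure \<Omega>) u"
    and sub: "\<And>\<phi> x. Ck_on 1 \<phi> UNIV \<Longrightarrow> x \<in> \<Omega> \<Longrightarrow> (\<forall>\<^sub>F y in at x. u y - \<phi> y \<le> u x - \<phi> x) \<Longrightarrow>
      hamiltonian L x (grad \<phi> (at x)) - f x \<le> c"
    and super: "\<And>\<phi> x. Ck_on 1 \<phi> UNIV \<Longrightarrow> x \<in> closure \<Omega> \<Longrightarrow>
      (\<forall>\<^sub>F y in at x within closure \<Omega>. u x - \<phi> x \<le> u y - \<phi> y) \<Longrightarrow>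
      hamiltonian L x (grad \<phi> (at x)) - f x \<ge> c"
    using u unfolding constrained_viscosity_solution_def by blast+
  have L_ge: "L x v \<ge> L x 0" for x v
    using L(2)[of x v] L(1) by (smt (verit) divide_nonneg_pos zero_le_power2)
  show "c \<le> 0"
  proof -
    have "closure \<Omega> \<noteq> {}" using \<Omega> by simp
    then obtain x where x: "x \<in> closure \<Omega>" "\<And>y. y \<in> closure \<Omega> \<Longrightarrow> u x \<le> u y"
      using continuous_attains_inf[OF \<Omega>(2) _ cont] by blast
    define \<phi> where "\<phi> = (\<lambda>y::'a. 0 * ((y - 0) \<bullet> (y - 0)))"
    have "\<forall>\<^sub>F y in at x within closure \<Omega>. u x - \<phi> x \<le> u y - \<phi> y"
      using x(2) by (auto simp: eventually_at_filter \<phi>_def)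
    then have "c \<le> hamiltonian L x (grad \<phi> (at x)) - f x"
      unfolding \<phi>_def by (intro super Ck_on_paraboloid(1) x(1))
    also have "grad \<phi> (at x) = 0" unfolding \<phi>_def Ck_on_paraboloid(2) by simp
    also have "hamiltonian L x 0 - f x \<le> 0"
      using hamiltonian_0_le[of L x] L_ge G(2)[OF x(1)] by fastforce
    finally show ?thesis .
  qed
  show "0 \<le> c"
  proof (rule ccontr)
    assume "\<not> 0 \<le> c"
    then have "- c > 0" by simp
    then obtain \<delta> where \<delta>: "\<delta> > 0"
      "\<And>x. x \<in> closure \<Omega> \<Longrightarrow> dist x z < \<delta> \<Longrightarrow> dist (L x 0 + f x) (L z 0 + f z) < - c"
      using G(1) z(1) unfolding continuous_on_iff by meson
    obtain x1 where x1: "x1 \<in> \<Omega>" "dist x1 z < \<delta> / 2"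
      using z(1) \<delta>(1) closure_approachable[of z \<Omega>] half_gt_zero by blast
    obtain r0 where r0: "r0 > 0" "cball x1 r0 \<subseteq> \<Omega>"
      using open_contains_cball \<Omega>(1) x1(1) by blast
    define r where "r = min r0 (\<delta> / 2)"
    have r: "r > 0" "cball x1 r \<subseteq> \<Omega>" "r \<le> \<delta> / 2" using r0 \<delta> by (auto simp: r_def)
    have "bounded (u ` closure \<Omega>)" using \<Omega> cont by (intro compact_imp_bounded compact_continuous_image)
    then obtain B where B: "\<And>x. x \<in> closure \<Omega> \<Longrightarrow> \<bar>u x\<bar> \<le> B" by (auto simp: bounded_iff)
    \<comment> \<open>On the sphere of radius \<open>r\<close> the paraboloid equals
      \<open>2 * B + 1\<close>, more than the oscillation of \<open>u\<close>, so the maximum over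
      the ball lies in its interior and is a genuine local maximum.\<close>
    define k where "k = (2 * B + 1) / r\<^sup>2"
    define \<phi> where "\<phi> = (\<lambda>y. k * ((y - x1) \<bullet> (y - x1)))"
    have "continuous_on (cball x1 r) (\<lambda>y. u y - \<phi> y)"
      unfolding \<phi>_def using r(2) closure_subset
      by (intro continuous_intros continuous_on_subset[OF cont]) blast
    then obtain y where y: "y \<in> cball x1 r" "\<And>w. w \<in> cball x1 r \<Longrightarrow> u w - \<phi> w \<le> u y - \<phi> y"
      using continuous_attains_sup[of "cball x1 r" "\<lambda>y. u y - \<phi> y"] r(1)
      by (metis cball_eq_empty compact_cball not_less_iff_gr_or_eq)
    have "dist x1 y < r"
    proof (rule ccontr)
      assume "\<not> dist x1 y < r"
      then have "norm (y - x1) = r" using y(1) by (simp add: dist_norm norm_minus_commute)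
      then have "\<phi> y = 2 * B + 1"
        using r(1) by (simp add: \<phi>_def k_def flip: power2_norm_eq_inner)
      moreover have "u x1 - \<phi> x1 \<le> u y - \<phi> y" using y(2) r(1) by simp
      moreover have "y \<in> closure \<Omega>" "x1 \<in> closure \<Omega>" using y(1) r(2) x1(1) closure_subset by blast+
      ultimately show False using B[of y] B[of x1] by (simp add: \<phi>_def)
    qed
    then have "\<forall>\<^sub>F w in nhds y. w \<in> ball x1 r" by (intro eventually_nhds_in_open) auto
    then have "\<forall>\<^sub>F w in at y. u w - \<phi> w \<le> u y - \<phi> y"
      unfolding eventually_at_filter by eventually_elim (auto intro: y(2))
    moreover have y': "y \<in> \<Omega>" using y(1) r(2) by blast
    ultimately have "hamiltonian L y (grad \<phi> (at y)) - f y \<le> c"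
      unfolding \<phi>_def by (intro sub Ck_on_paraboloid(1))
    then have "- c \<le> L y 0 + f y" using hamiltonian_ge[of C L y "grad \<phi> (at y)"] L by fastforce
    moreover have "dist y z < \<delta>"
      using dist_triangle[of y z x1] x1(2) \<open>dist x1 y < r\<close> r(3) by (simp add: dist_commute)
    then have "L y 0 + f y < - c" using \<delta>(2)[of y] z(2) y' closure_subset by (force simp: dist_real_def)
    ultimately show False by simp
  qed
qed

section \<open>Competitors in the action\<close>

lemma abs_continuous_on_lipschitz:
  assumes "M-lipschitz_on UNIV \<gamma>"
  shows "abs_continuous_on a b \<gamma>"
  unfolding abs_continuous_on_def
proof (intro allI impI)
  fix \<epsilon> :: real assume "\<epsilon> > 0"
  have M: "M \<ge> 0" using assms by (rule lipschitz_on_nonneg)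
  show "\<exists>\<delta>>0. \<forall>I :: (real \<times> real) set. finite I \<longrightarrow>
        (\<forall>(s, t)\<in>I. a \<le> s \<and> s \<le> t \<and> t \<le> b) \<longrightarrow>
        pairwise (\<lambda>(s, t) (s', t'). {s<..<t} \<inter> {s'<..<t'} = {}) I \<longrightarrow>
        (\<Sum>(s, t)\<in>I. t - s) < \<delta> \<longrightarrow> (\<Sum>(s, t)\<in>I. dist (\<gamma> s) (\<gamma> t)) < \<epsilon>"
  proof (intro exI conjI allI impI)
    show "0 < \<epsilon> / (M + 1)" using M \<open>\<epsilon> > 0\<close> by simp
    fix I :: "(real \<times> real) set"
    assume I: "\<forall>(s, t)\<in>I. a \<le> s \<and> s \<le> t \<and> t \<le> b" "(\<Sum>(s, t)\<in>I. t - s) < \<epsilon> / (M + 1)"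
    have nn: "0 \<le> (\<Sum>(s, t)\<in>I. t - s)" using I(1) by (intro sum_nonneg) auto
    have "(\<Sum>(s, t)\<in>I. dist (\<gamma> s) (\<gamma> t)) \<le> (\<Sum>(s, t)\<in>I. M * (t - s))"
    proof (rule sum_mono)
      fix i assume "i \<in> I"
      then obtain s t where "i = (s, t)" "s \<le> t" using I(1) by (cases i) auto
      then show "(case i of (s, t) \<Rightarrow> dist (\<gamma> s) (\<gamma> t)) \<le> (case i of (s, t) \<Rightarrow> M * (t - s))"
        using lipschitz_onD[OF assms, of s t] by (simp add: dist_real_def)
    qed
    also have "\<dots> = M * (\<Sum>(s, t)\<in>I. t - s)" by (simp add: sum_distrib_left case_prod_beta)
    also have "\<dots> \<le> (M + 1) * (\<Sum>(s, t)\<in>I. t - s)" using nn by (intro mult_right_mono) auto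
    also have "\<dots> < \<epsilon>" using I(2) M by (simp add: field_simps)
    finally show "(\<Sum>(s, t)\<in>I. dist (\<gamma> s) (\<gamma> t)) < \<epsilon>" .
  qed
qed

text \<open>The right-hand side accounts for the junk value of \<^const>\<open>vector_derivative\<close> at points
  where \<open>\<gamma>\<close> is not differentiable, so that Rademacher's theorem is not needed.\<close>

lemma norm_vector_derivative_lipschitz_le:
  fixes \<gamma> :: "real \<Rightarrow> 'a::real_normed_vector"
  assumes "M-lipschitz_on UNIV \<gamma>"
  shows "norm (vector_derivative \<gamma> (at s)) \<le> max M (norm (SOME v::'a. False))"
proof (cases "\<exists>D. (\<gamma> has_vector_derivative D) (at s)")
  case False
  then have "vector_derivative \<gamma> (at s) = (SOME v::'a. False)"
    by (simp add: vector_derivative_def)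
  then show ?thesis by simp
next
  case True
  then obtain D where D: "(\<gamma> has_vector_derivative D) (at s)" by blast
  have "norm D \<le> M"
  proof (rule field_le_epsilon)
    fix e :: real assume e: "e > 0"
    obtain d where d: "d > 0"
      "\<And>y. norm (y - s) < d \<Longrightarrow> norm (\<gamma> y - \<gamma> s - (y - s) *\<^sub>R D) \<le> e * norm (y - s)"
      using D e unfolding has_vector_derivative_def has_derivative_at_alt by blast
    define h where "h = d / 2"
    have h: "h > 0" "h < d" using d by (auto simp: h_def)
    have "norm (h *\<^sub>R D) \<le> norm (\<gamma> (s + h) - \<gamma> s) + norm (\<gamma> (s + h) - \<gamma> s - h *\<^sub>R D)"
      by (metis norm_triangle_sub norm_minus_commute)
    also have "norm (\<gamma> (s + h) - \<gamma> s) \<le> M * h"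
      using lipschitz_onD[OF assms, of "s + h" s] h by (simp add: dist_norm)
    also have "norm (\<gamma> (s + h) - \<gamma> s - h *\<^sub>R D) \<le> e * h"
      using d(2)[of "s + h"] h by simp
    finally have "h * norm D \<le> h * (M + e)" using h by (simp add: algebra_simps)
    then show "norm D \<le> M + e" using h by simp
  qed
  then show ?thesis using vector_derivative_at[OF D] by simp
qed

text \<open>The nonnegative integral is monotone for arbitrary functions, so an integrand containing
  \<open>vector_derivative\<close> can be compared with \<open>h\<close> without discussing its
  measurability.\<close>

lemma eintegral_le:
  assumes "\<And>x. x \<in> space M \<Longrightarrow> 0 \<le> f x" "\<And>x. x \<in> space M \<Longrightarrow> f x \<le> h x" "integrable M h"
  shows "eintegral M f \<le> ereal (\<integral>x. h x \<partial>M)"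
proof -
  have h: "0 \<le> h x" if "x \<in> space M" for x using assms(1,2)[OF that] by linarith
  have "(\<integral>\<^sup>+x. ennreal (- f x) \<partial>M) = (\<integral>\<^sup>+x. 0 \<partial>M)"
    using assms(1) by (intro nn_integral_cong) (simp add: ennreal_neg)
  then have "eintegral M f = enn2ereal (\<integral>\<^sup>+x. ennreal (f x) \<partial>M)"
    by (simp add: eintegral_def zero_ennreal.rep_eq)
  also have "(\<integral>\<^sup>+x. ennreal (f x) \<partial>M) \<le> (\<integral>\<^sup>+x. ennreal (h x) \<partial>M)"
    using assms(2) by (intro nn_integral_mono ennreal_leI)
  also have "\<dots> = ennreal (\<integral>x. h x \<partial>M)"
    using assms(3) h by (intro nn_integral_eq_integral) auto
  finally have "eintegral M f \<le> enn2ereal (ennreal (\<integral>x. h x \<partial>M))"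
    by (simp add: less_eq_ennreal.rep_eq)
  moreover have "0 \<le> (\<integral>x. h x \<partial>M)" using h by (intro integral_nonneg_AE AE_I2)
  ultimately show ?thesis by (simp add: enn2ereal_ennreal)
qed

text \<open>The lower bound remains an extended nonnegative integral because \<open>f\<close> may
  have infinite integral, as along a curve of infinite action.\<close>

lemma eintegral_ge:
  assumes "\<And>x. x \<in> space M \<Longrightarrow> 0 \<le> g x" "\<And>x. x \<in> space M \<Longrightarrow> g x \<le> f x"
  shows "enn2ereal (\<integral>\<^sup>+x. ennreal (g x) \<partial>M) \<le> eintegral M f"
proof -
  have f: "0 \<le> f x" if "x \<in> space M" for x using assms[OF that] by linarith
  have "(\<integral>\<^sup>+x. ennreal (- f x) \<partial>M) = (\<integral>\<^sup>+x. 0 \<partial>M)"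
    using f by (intro nn_integral_cong) (simp add: ennreal_neg)
  then have "eintegral M f = enn2ereal (\<integral>\<^sup>+x. ennreal (f x) \<partial>M)"
    by (simp add: eintegral_def zero_ennreal.rep_eq)
  moreover have "(\<integral>\<^sup>+x. ennreal (g x) \<partial>M) \<le> (\<integral>\<^sup>+x. ennreal (f x) \<partial>M)"
    using assms(2) by (intro nn_integral_mono ennreal_leI)
  ultimately show ?thesis by (simp add: less_eq_ennreal.rep_eq)
qed

text \<open>The competitor walks to \<open>y\<close> in unit time, at bounded cost, and then rests there.\<close>

lemma action_competitor:
  fixes K :: "'a::euclidean_space set"
  assumes K: "compact K"
    and joined: "\<And>x y. x \<in> K \<Longrightarrow> y \<in> K \<Longrightarrow> lipschitz_joined K M x y"
    and L: "continuous_on UNIV (\<lambda>(x, v). L x v)"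
    and F: "\<And>x \<mu>. x \<in> K \<Longrightarrow> \<mu> \<in> prob_on K \<Longrightarrow> \<bar>F x \<mu>\<bar> \<le> B"
    and uf: "\<And>x. x \<in> K \<Longrightarrow> uf x \<le> B"
  obtains C where
    "\<And>T m t x y. \<lbrakk>0 \<le> t; t \<le> T; x \<in> K; y \<in> K; \<forall>s\<in>{t..T}. m s \<in> prob_on K;
        continuous_on {t..T} (\<lambda>s. F y (m s));
        \<forall>s\<in>{t..T}. \<forall>z\<in>K. \<forall>v. 0 \<le> L z v + F z (m s)\<rbrakk> \<Longrightarrow>
      \<exists>\<gamma>\<in>curves K T. apply_bcontfun \<gamma> t = x \<and>
        action L F uf m t T \<gamma> \<le> ereal (C + (\<integral>s. L y 0 + F y (m s) \<partial>lebesgue_on {t..T}))"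
proof -
  \<comment> \<open>Bounds the speed of every competitor, including the default value of
    \<open>vector_derivative\<close>; \<open>L\<close> is then bounded on the compact set
    \<open>K \<times> cball 0 V\<close>.\<close>
  define V where "V = max M (norm (SOME v::'a. False))"
  have "compact ((\<lambda>(x, v). L x v) ` (K \<times> cball 0 V))"
    by (intro compact_continuous_image continuous_on_subset[OF L] compact_Times K) auto
  then obtain A0 where A0': "\<forall>z\<in>(\<lambda>(x, v). L x v) ` (K \<times> cball 0 V). norm z \<le> A0"
    by (meson bounded_iff compact_imp_bounded)
  have A0: "\<bar>L x v\<bar> \<le> A0" if "x \<in> K" "norm v \<le> V" for x v
  proof -
    have "L x v \<in> (\<lambda>(x, v). L x v) ` (K \<times> cball 0 V)"
      using that by (intro image_eqI[of _ _ "(x, v)"]) auto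
    then show ?thesis using A0' by (metis real_norm_def)
  qed
  define A where "A = \<bar>A0\<bar> + \<bar>B\<bar>"
  show ?thesis
  proof (rule that[of "A + B"])
    fix T :: real and m t x y
    assume t: "0 \<le> t" "t \<le> T" and x: "x \<in> K" and y: "y \<in> K"
      and m: "\<forall>s\<in>{t..T}. m s \<in> prob_on K"
      and cont: "continuous_on {t..T} (\<lambda>s. F y (m s))"
      and nonneg: "\<forall>s\<in>{t..T}. \<forall>z\<in>K. \<forall>v. 0 \<le> L z v + F z (m s)"
    obtain p :: "real \<Rightarrow> 'a" where p: "M-lipschitz_on UNIV p" "range p \<subseteq> K" "\<And>s. s \<le> 0 \<Longrightarrow> p s = x"
      "\<And>s. 1 \<le> s \<Longrightarrow> p s = y"
      using joined[OF x y] unfolding lipschitz_joined_def by blast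
    \<comment> \<open>The walk starts at time \<open>t\<close> and is frozen at \<open>T\<close>, so
      that the curve is constant afterwards as \<open>curves\<close> requires. If
      \<open>T < t + 1\<close> the walk is cut short and \<open>y\<close> need not be
      reached.\<close>
    define g where "g = (\<lambda>s. p (min T s - t))"
    have g_lip: "M-lipschitz_on UNIV g"
    proof (rule lipschitz_onI)
      fix a b
      have "dist (g a) (g b) \<le> M * dist (min T a - t) (min T b - t)"
        unfolding g_def by (rule lipschitz_onD[OF p(1)]) auto
      also have "\<dots> \<le> M * dist a b"
        using lipschitz_on_nonneg[OF p(1)] by (intro mult_left_mono) (auto simp: dist_real_def)
      finally show "dist (g a) (g b) \<le> M * dist a b" .
    qed (rule lipschitz_on_nonneg[OF p(1)])
    have p_K: "p s \<in> K" for s using p(2) by blast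
    have g_K: "g s \<in> K" for s by (simp add: g_def p_K)
    have "bounded (range g)" using g_K compact_imp_bounded[OF K] by (auto intro: bounded_subset)
    then have "g \<in> bcontfun"
      using lipschitz_on_continuous_on[OF g_lip] by (simp add: bcontfun_def)
    then have app: "apply_bcontfun (Bcontfun g) = g" by (simp add: Bcontfun_inverse)
    have "Bcontfun g \<in> curves K T"
      unfolding curves_def mem_Collect_eq app
      using abs_continuous_on_lipschitz[OF g_lip] p_K t p(3) by (auto simp: g_def)
    moreover have "apply_bcontfun (Bcontfun g) t = x" unfolding app using t p(3) by (simp add: g_def)
    moreover have "action L F uf m t T (Bcontfun g) \<le>
      ereal (A + B + (\<integral>s. L y 0 + F y (m s) \<partial>lebesgue_on {t..T}))"
    proof -
      \<comment> \<open>The resting cost at \<open>y\<close> is charged on the whole interval: it is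
        nonnegative, so adding it during the walk only increases the majorant.\<close>
      define h where "h = (\<lambda>s. A * indicator {t..t+1} s + (L y 0 + F y (m s)))"
      have int_rest: "integrable (lebesgue_on {t..T}) (\<lambda>s. L y 0 + F y (m s))"
        by (intro integrable_lebesgue_on_compact continuous_intros cont) auto
      have eq: "indicator {t..T} s *\<^sub>R indicator {t..t+1} s = (indicator {t..min T (t+1)} s :: real)" for s
        by (auto simp: indicator_def)
      have int_ind: "integrable (lebesgue_on {t..T}) (\<lambda>s. A * indicator {t..t+1} s)"
        by (intro integrable_mult_right impI, subst integrable_restrict_space, simp, unfold eq)
          (intro integrable_real_indicator, auto simp: emeasure_lborel_Icc_eq)
      have "(\<integral>s. indicator {t..t+1} s \<partial>lebesgue_on {t..T}) = measure lebesgue {t..min T (t+1)}"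
        by (subst integral_restrict_space, simp, unfold eq) simp
      then have "(\<integral>s. indicator {t..t+1} s \<partial>lebesgue_on {t..T}) \<le> (1::real)"
        using t by simp
      have le: "L (g s) (vector_derivative g (at s)) + F (g s) (m s) \<le> h s" if s: "s \<in> {t..T}" for s
      proof (cases "s \<le> t + 1")
        case True
        have "\<bar>L (g s) (vector_derivative g (at s))\<bar> \<le> A0"
          using norm_vector_derivative_lipschitz_le[OF g_lip, of s]
          by (intro A0 g_K) (simp add: V_def)
        moreover have "\<bar>F (g s) (m s)\<bar> \<le> B" using F g_K m s by blast
        ultimately have "L (g s) (vector_derivative g (at s)) + F (g s) (m s) \<le> A"
          unfolding A_def by linarith
        moreover have "0 \<le> L y 0 + F y (m s)" using nonneg y s by blast
        ultimately show ?thesis using True s by (simp add: h_def)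
      next
        case False
        then have "T > t + 1" using s by auto
        have *: "g s' = y" if "s' \<in> {t+1<..}" for s'
          unfolding g_def using that \<open>T > t + 1\<close> by (intro p(4)) auto
        have "(g has_vector_derivative 0) (at s)"
        proof (rule has_vector_derivative_transform_within_open)
          show "((\<lambda>_. y) has_vector_derivative 0) (at s)" by (rule has_vector_derivative_const)
          show "open {t+1<..}" "s \<in> {t+1<..}" using False by auto
        qed (rule *[symmetric])
        then have "vector_derivative g (at s) = 0" by (rule vector_derivative_at)
        then show ?thesis using *[of s] False by (simp add: h_def)
      qed
      have "action L F uf m t T (Bcontfun g) \<le> ereal (\<integral>s. h s \<partial>lebesgue_on {t..T}) + ereal B"
        unfolding action_def app
        by (intro add_mono eintegral_le) (use nonneg g_K le uf int_rest int_ind in \<open>auto simp: h_def\<close>)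
      also have "(\<integral>s. h s \<partial>lebesgue_on {t..T})
          = A * (\<integral>s. indicator {t..t+1} s \<partial>lebesgue_on {t..T}) + (\<integral>s. L y 0 + F y (m s) \<partial>lebesgue_on {t..T})"
        unfolding h_def by (subst Bochner_Integration.integral_add[OF int_ind int_rest]) simp
      also have "ereal \<dots> + ereal B \<le> ereal (A + B + (\<integral>s. L y 0 + F y (m s) \<partial>lebesgue_on {t..T}))"
        using mult_left_mono[OF \<open>(\<integral>s. indicator {t..t+1} s \<partial>lebesgue_on {t..T}) \<le> (1::real)\<close>, of A]
        by (simp add: A_def)
      finally show ?thesis .
    qed
    ultimately show "\<exists>\<gamma>\<in>curves K T. apply_bcontfun \<gamma> t = x \<and>
        action L F uf m t T \<gamma> \<le> ereal (A + B + (\<integral>s. L y 0 + F y (m s) \<partial>lebesgue_on {t..T}))"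
      by blast
  qed
qed

section \<open>Energy and value function estimates\<close>

lemma sup_norm_upper:
  assumes "bounded (f ` S)" "x \<in> S"
  shows "\<bar>f x\<bar> \<le> sup_norm S f"
proof -
  obtain B where "\<forall>x\<in>S. \<bar>f x\<bar> \<le> B" using assms(1) by (auto simp: bounded_iff)
  then have "bdd_above ((\<lambda>x. \<bar>f x\<bar>) ` S)" by (auto simp: bdd_above_def)
  then show ?thesis unfolding sup_norm_def by (rule cSUP_upper[OF assms(2)])
qed

lemma sup_norm_least: "S \<noteq> {} \<Longrightarrow> (\<And>x. x \<in> S \<Longrightarrow> \<bar>f x\<bar> \<le> c) \<Longrightarrow> sup_norm S f \<le> c"
  unfolding sup_norm_def by (rule cSUP_least)

text \<open>Actions are integrated over \<open>lebesgue_on\<close>, whereas Tonelli is applied over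
  \<open>lborel\<close>; for Borel integrands the two agree.\<close>

lemma nn_integral_lebesgue_on:
  fixes f :: "'a::euclidean_space \<Rightarrow> ennreal"
  assumes "(\<lambda>x. f x * indicator S x) \<in> borel_measurable borel" "S \<in> sets borel"
  shows "(\<integral>\<^sup>+x. f x \<partial>lebesgue_on S) = (\<integral>\<^sup>+x. f x * indicator S x \<partial>lborel)"
  using assms by (simp add: nn_integral_restrict_space nn_integral_completion)

lemma sup_norm_nonneg: "bounded (f ` S) \<Longrightarrow> S \<noteq> {} \<Longrightarrow> 0 \<le> sup_norm S f"
  using sup_norm_upper[of f S] by (metis abs_ge_zero all_not_in_conv order_trans)

lemma sup_norm_diff_le:
  assumes "bounded (f ` S)" "bounded (g ` S)" "S \<noteq> {}" "\<And>x. x \<in> S \<Longrightarrow> \<bar>f x - g x\<bar> \<le> c"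
  shows "\<bar>sup_norm S f - sup_norm S g\<bar> \<le> c"
proof -
  have "sup_norm S f \<le> sup_norm S g + c"
    using assms(4) sup_norm_upper[OF assms(2)] by (intro sup_norm_least[OF assms(3)]) (smt (verit))
  moreover have "sup_norm S g \<le> sup_norm S f + c"
    using assms(4) sup_norm_upper[OF assms(1)] by (intro sup_norm_least[OF assms(3)]) (smt (verit))
  ultimately show ?thesis by linarith
qed

text \<open>A pointwise substitute for Jensen's inequality: when \<open>b\<close> exceeds
  \<open>a\<close>, the factor \<open>(b / a) ^ n\<close> is at least one. The free parameter
  \<open>a\<close> is later chosen as a power of \<open>T\<close>.\<close>

lemma le_add_power_div:
  fixes a b :: real
  assumes "a > 0" "b \<ge> 0"
  shows "b \<le> a + b ^ Suc n / a ^ n"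
proof (cases "b \<le> a")
  case True
  moreover have "0 \<le> b ^ Suc n / a ^ n" using assms by simp
  ultimately show ?thesis by linarith
next
  case False
  then have "1 \<le> (b / a) ^ n" using assms by (intro one_le_power) simp
  then have "b * 1 \<le> b * (b / a) ^ n" using assms by (intro mult_left_mono) auto
  then show ?thesis using assms by (simp add: power_divide)
qed

text \<open>Collects the data on which the final constant may depend. The initial measure, the
  horizon and the solutions are quantified inside each estimate after its constant, which records
  the uniformity.\<close>

locale constrained_mfg =
  fixes \<Omega> :: "'a::euclidean_space set"
    and L :: "'a \<Rightarrow> 'a \<Rightarrow> real"
    and F :: "'a \<Rightarrow> 'a measure \<Rightarrow> real"
    and uf :: "'a \<Rightarrow> real"
  assumes domain: "bounded_C2_domain \<Omega>"
    and tonelli: "strict_tonelli L" and rev: "reversible L"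
    and F1: "F1 \<Omega> F" and F2: "F2 \<Omega> F" and F3: "F3 \<Omega> F"
    and A2: "A2 \<Omega> L F" and U_cond: "U_cond \<Omega> uf" and A3: "A3 \<Omega> L F"
begin

abbreviation K :: "'a set" where "K \<equiv> closure \<Omega>"

abbreviation P :: "'a measure set" where "P \<equiv> prob_on K"

section \<open>Consequences of the standing assumptions\<close>

lemma compact_K: "compact K" using domain by (rule compact_closure_domain)

lemma K_nonempty: "K \<noteq> {}" using domain by (simp add: bounded_C2_domain_def)

lemma L_continuous: "continuous_on UNIV (\<lambda>(x, v). L x v)"
  using tonelli Ck_on_continuous unfolding strict_tonelli_def by blast

lemma L0_continuous: "continuous_on S (\<lambda>x. L x 0)"
  using continuous_on_compose2[OF L_continuous, of S "\<lambda>x. (x, 0)"]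
  by (simp add: continuous_on_Pair continuous_on_id continuous_on_const)

lemma L_ge: "L x 0 \<le> L x v"
proof -
  obtain C where "C > 0" "\<And>x v. L x v \<ge> L x 0 + (norm v)\<^sup>2 / (2 * C)"
    using strict_tonelli_lower_bound[OF tonelli rev] by blast
  then show ?thesis by (smt (verit) divide_nonneg_pos zero_le_power2)
qed

text \<open>One constant serves all measures: the sum in \<open>F1\<close> has nonnegative terms and
  is bounded uniformly in \<open>m\<close>, so each derivative is, and those of first order give the
  spatial Lipschitz bound.\<close>

lemma bounds:
  obtains B where "B > 0"
    "\<And>x m. m \<in> P \<Longrightarrow> \<bar>F x m\<bar> \<le> B"
    "\<And>x y m. m \<in> P \<Longrightarrow> \<bar>F x m - F y m\<bar> \<le> B * dist x y"
    "\<And>x m m'. m \<in> P \<Longrightarrow> m' \<in> P \<Longrightarrow> \<bar>F x m - F x m'\<bar> \<le> B * d1 K m m'"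
    "\<And>x. x \<in> K \<Longrightarrow> \<bar>uf x\<bar> \<le> B"
proof -
  obtain S where S: "\<And>m. m \<in> P \<Longrightarrow> (\<Sum>bs\<in>dirs 2. sup_norm UNIV (pderivs bs (\<lambda>x. F x m))) \<le> S"
    using F1 unfolding F1_def bdd_above_def by blast
  have Ckb: "Ckb_on 2 (\<lambda>x. F x m) UNIV" if "m \<in> P" for m
    using F1 that unfolding F1_def by blast
  have D: "\<bar>pderivs bs (\<lambda>x. F x m) x\<bar> \<le> S" if m: "m \<in> P" and bs: "bs \<in> dirs 2" for m bs x
  proof -
    have le: "\<bar>pderivs cs (\<lambda>x. F x m) y\<bar> \<le> sup_norm UNIV (pderivs cs (\<lambda>x. F x m))"
      if "cs \<in> dirs 2" for cs y
      using Ckb[OF m] that unfolding Ckb_on_def by (intro sup_norm_upper) auto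
    have "\<bar>pderivs bs (\<lambda>x. F x m) x\<bar> \<le> sup_norm UNIV (pderivs bs (\<lambda>x. F x m))" by (rule le[OF bs])
    also have "\<dots> \<le> (\<Sum>bs\<in>dirs 2. sup_norm UNIV (pderivs bs (\<lambda>x. F x m)))"
      using le by (intro member_le_sum bs finite_dirs) (meson DiffD1 abs_ge_zero order_trans)
    finally show ?thesis using S[OF m] by linarith
  qed
  have F_le: "\<bar>F x m\<bar> \<le> S" if "m \<in> P" for x m
    using D[OF that dirs_Nil] by simp
  have F_lip: "\<bar>F x m - F y m\<bar> \<le> real DIM('a) * S * dist x y" if "m \<in> P" for x y m
  proof (rule pderivs_bound_imp_lipschitz[of 2 "\<lambda>x. F x m" UNIV UNIV])
    show "Ck_on 2 (\<lambda>x. F x m) UNIV" using Ckb[OF that] unfolding Ckb_on_def by blast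
    show "\<bar>pderivs [b] (\<lambda>x. F x m) x\<bar> \<le> S" if "b \<in> Basis" for x b
      using D[OF \<open>m \<in> P\<close> dirs_single[OF that]] by simp
  qed auto
  obtain B2 where "B2 \<ge> 0" and B2: "\<And>x m1 m2. m1 \<in> P \<Longrightarrow> m2 \<in> P \<Longrightarrow> \<bar>F x m1 - F x m2\<bar> \<le> B2 * d1 K m1 m2"
    by (rule F2_lipschitz[OF F2 compact_K], rule that)
  obtain U where U: "K \<subseteq> U" "Ckb_on 1 uf U" using U_cond unfolding U_cond_def by blast
  have "bounded (pderivs [] uf ` U)" using U(2) dirs_Nil unfolding Ckb_on_def by blast
  then obtain B3 where B3: "\<And>x. x \<in> U \<Longrightarrow> \<bar>uf x\<bar> \<le> B3" by (auto simp: bounded_iff)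
  define B where "B = max 1 (max \<bar>S\<bar> (max (real DIM('a) * S) (max B2 B3)))"
  have B: "B > 0" "S \<le> B" "real DIM('a) * S \<le> B" "B2 \<le> B" "B3 \<le> B" unfolding B_def by auto
  show ?thesis
  proof (rule that[OF B(1)])
    show "\<bar>F x m\<bar> \<le> B" if "m \<in> P" for x m using F_le[OF that, of x] B by linarith
    show "\<bar>F x m - F y m\<bar> \<le> B * dist x y" if "m \<in> P" for x y m
      using F_lip[OF that, of x y] mult_right_mono[OF B(3), of "dist x y"] by simp
    show "\<bar>F x m - F x m'\<bar> \<le> B * d1 K m m'" if "m \<in> P" "m' \<in> P" for x m m'
      using B2[OF that, of x] mult_right_mono[OF B(4) d1_nonneg[OF that compact_K]] by linarith
    show "\<bar>uf x\<bar> \<le> B" if "x \<in> K" for x using B3[of x] U(1) that B by fastforce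
  qed
qed

lemma F_continuous:
  assumes "m \<in> P"
  shows "continuous_on S (\<lambda>x. F x m)"
  using F1 assms Ck_on_continuous continuous_on_subset[OF _ subset_UNIV]
  unfolding F1_def Ckb_on_def by blast

lemma potential_continuous: "m \<in> P \<Longrightarrow> continuous_on S (\<lambda>x. L x 0 + F x m)"
  by (intro continuous_on_add L0_continuous F_continuous)

lemma potential_minimizer:
  assumes "m \<in> P"
  obtains z where "z \<in> K" "L z 0 + F z m = 0" "\<And>x. x \<in> K \<Longrightarrow> 0 \<le> L x 0 + F x m"
proof -
  obtain z where z: "z \<in> K" "\<And>x. x \<in> K \<Longrightarrow> L z 0 + F z m \<le> L x 0 + F x m"
    using continuous_attains_inf[OF compact_K K_nonempty potential_continuous[OF assms]] by blast
  then have "(INF x\<in>K. L x 0 + F x m) = L z 0 + F z m"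
    by (intro cInf_eq_minimum) auto
  then have "L z 0 + F z m = 0" using A3 assms unfolding A3_def by simp
  then show ?thesis using z that by simp
qed

lemma potential_nonneg: "m \<in> P \<Longrightarrow> x \<in> K \<Longrightarrow> 0 \<le> L x 0 + F x m"
  using potential_minimizer by metis

lemma lagrangian_nonneg: "m \<in> P \<Longrightarrow> x \<in> K \<Longrightarrow> 0 \<le> L x v + F x m"
  using potential_nonneg[of m x] L_ge[of x v] by linarith

text \<open>Mather measures refer to the minimum over the whole space, while (A3) normalizes the one
  over \<open>K\<close>. By (A2) some global minimizer lies in \<open>K\<close>, so the two
  agree.\<close>

lemma potential_INF:
  assumes "m \<in> P"
  shows "(INF x. L x 0 + F x m) = 0"
proof -
  obtain x where x: "x \<in> K" "\<And>y. L x 0 + F x m \<le> L y 0 + F y m"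
    using A2 assms unfolding A2_def argmin_set_def is_arg_min_def by (auto simp: not_less)
  obtain z where z: "z \<in> K" "L z 0 + F z m = 0" using potential_minimizer[OF assms] by blast
  have "L x 0 + F x m = 0" using x(2)[of z] z potential_nonneg[OF assms x(1)] by simp
  then show ?thesis using x(2) by (intro cInf_eq_minimum) (auto intro: rev_image_eqI[of x])
qed

lemma ergodic_constant:
  assumes "ergodic_solution \<Omega> L F lam u m"
  shows "lam = 0"
proof -
  have m: "m \<in> P" and u: "constrained_viscosity_solution \<Omega> (\<lambda>x p. hamiltonian L x p - F x m) lam u"
    using assms unfolding ergodic_solution_def by blast+
  obtain C where C: "C > 0" "\<And>x v. L x v \<ge> L x 0 + (norm v)\<^sup>2 / (2 * C)"
    using strict_tonelli_lower_bound[OF tonelli rev] by blast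
  obtain z where z: "z \<in> K" "L z 0 + F z m = 0" using potential_minimizer[OF m] by blast
  show ?thesis
    using domain z unfolding bounded_C2_domain_def
    by (intro constrained_viscosity_solution_constant[OF _ compact_K _ C u potential_continuous[OF m]
          potential_nonneg[OF m]]) auto
qed

text \<open>Almost every point lies in the support of the Mather measure, where the potential takes
  its global minimum, identified as zero by \<open>potential_INF\<close>. Projection to positions
  transfers this to \<open>m\<close>.\<close>

lemma ergodic_potential_integral:
  assumes "ergodic_solution \<Omega> L F lam u m"
  shows "(\<integral>x. L x 0 + F x m \<partial>m) = 0"
proof -
  obtain \<mu> where m: "m \<in> P" and \<mu>: "mather_measure \<Omega> (\<lambda>x v. L x v + F x m) \<mu>"
    and m_eq: "m = distr \<mu> (restrict_space borel K) fst"
    using assms unfolding ergodic_solution_def by blast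
  have \<mu>P: "\<mu> \<in> prob_on (K \<times> UNIV)"
    and spt: "spt \<mu> \<subseteq> {(x, 0) | x. x \<in> K \<and> L x 0 + F x m = 0}"
    using \<mu> unfolding mather_measure_def by (auto simp: potential_INF[OF m])
  obtain D :: "('a \<times> 'a) set" where D: "countable D" "\<And>U. open U \<Longrightarrow> U \<noteq> {} \<Longrightarrow> \<exists>d\<in>D. d \<in> U"
    using countable_dense_setE by blast
  have "x \<in> closure D" for x
    unfolding closure_approachable using D(2)[of "ball x _"] by (metis ball_eq_empty dist_commute mem_ball not_le open_ball)
  then have "AE z in \<mu>. z \<in> spt \<mu>"
    by (intro AE_in_spt[OF prob_onD(2)[OF \<mu>P] D(1)]) auto
  then have AE: "AE z in \<mu>. L (fst z) 0 + F (fst z) m = 0"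
    by (rule AE_mp) (use spt in \<open>auto intro!: AE_I2\<close>)
  have "fst \<in> borel_measurable \<mu>" by (intro prob_on_measurable[OF \<mu>P] continuous_intros)
  then have fst: "fst \<in> measurable \<mu> (restrict_space borel K)"
    using prob_onD(3)[OF \<mu>P] by (intro measurable_restrict_space2) auto
  have "(\<integral>x. L x 0 + F x m \<partial>m) = (\<integral>z. L (fst z) 0 + F (fst z) m \<partial>\<mu>)"
    by (subst m_eq, rule integral_distr[OF fst])
      (rule borel_measurable_continuous_on_restrict[OF potential_continuous[OF m]])
  also have "\<dots> = 0" using AE by (rule integral_eq_zero_AE)
  finally show ?thesis .
qed

text \<open>The Lipschitz bound in \<open>x\<close> is uniform in the measure, so the variations in
  space and in time can be estimated separately and added.\<close>

lemma coupling_continuous: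
  fixes m :: "real \<Rightarrow> 'a measure"
  assumes "\<And>t. t \<in> I \<Longrightarrow> m t \<in> P \<and> ((\<lambda>s. d1 K (m s) (m t)) \<longlongrightarrow> 0) (at t within I)"
  shows "continuous_on (I \<times> K) (\<lambda>(s, x). F x (m s))"
  unfolding continuous_on_iff
proof (intro ballI allI impI)
  fix z and e :: real assume z: "z \<in> I \<times> K" and e: "e > 0"
  obtain t x where tx: "z = (t, x)" "t \<in> I" "x \<in> K" using z by blast
  obtain B where B: "B > 0" "\<And>x y m. m \<in> P \<Longrightarrow> \<bar>F x m - F y m\<bar> \<le> B * dist x y"
    "\<And>x m m'. m \<in> P \<Longrightarrow> m' \<in> P \<Longrightarrow> \<bar>F x m - F x m'\<bar> \<le> B * d1 K m m'"
    using bounds by metis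
  have "e / (2 * B) > 0" using e B(1) by simp
  then have "\<forall>\<^sub>F s in at t within I. dist (d1 K (m s) (m t)) 0 < e / (2 * B)"
    using assms[OF tx(2)] tendstoD by blast
  then obtain d where d: "d > 0"
    "\<And>s. s \<in> I \<Longrightarrow> s \<noteq> t \<Longrightarrow> dist s t < d \<Longrightarrow> dist (d1 K (m s) (m t)) 0 < e / (2 * B)"
    unfolding eventually_at by blast
  define d' where "d' = min d (e / (2 * B))"
  have "dist (F y (m s)) (F x (m t)) < e" if s: "s \<in> I" "dist (s, y) (t, x) < d'" for s y
  proof -
    have dist: "dist s t < d" "dist y x < e / (2 * B)"
      using dist_fst_le[of "(s, y)" "(t, x)"] dist_snd_le[of "(s, y)" "(t, x)"] s(2)
      by (auto simp: d'_def)
    have P: "m s \<in> P" "m t \<in> P" using assms s(1) tx(2) by auto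
    have "\<bar>F x (m s) - F x (m t)\<bar> \<le> e / 2"
    proof (cases "s = t")
      case False
      have "B * d1 K (m s) (m t) \<le> B * (e / (2 * B))"
        using d(2)[OF s(1) False dist(1)] B(1) by (intro mult_left_mono) auto
      then show ?thesis using B(3)[OF P, of x] B(1) by simp
    qed (use e in simp)
    moreover have "\<bar>F y (m s) - F x (m s)\<bar> < e / 2"
    proof -
      have "B * dist y x < B * (e / (2 * B))"
        using dist(2) B(1) by (intro mult_strict_left_mono) auto
      then show ?thesis using B(2)[OF P(1), of y x] B(1) by simp
    qed
    ultimately show ?thesis unfolding dist_real_def by linarith
  qed
  moreover have "d' > 0" using d(1) \<open>e / (2 * B) > 0\<close> by (simp add: d'_def)
  ultimately show "\<exists>d>0. \<forall>z'\<in>I \<times> K. dist z' z < d \<longrightarrow>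
      dist (case z' of (s, x) \<Rightarrow> F x (m s)) (case z of (s, x) \<Rightarrow> F x (m s)) < e"
    unfolding tx(1) by auto
qed

section \<open>Mild solutions and their competitors\<close>

lemma mild_solutionD:
  assumes "mild_solution \<Omega> L F uf m0 T u m"
  shows "t \<in> {0..T} \<Longrightarrow> m t \<in> P"
    and "continuous_on ({0..T} \<times> K) (\<lambda>(s, x). F x (m s))"
    and "t \<in> {0..T} \<Longrightarrow> x \<in> K \<Longrightarrow>
      ereal (u t x) = (INF \<gamma>\<in>{\<gamma> \<in> curves K T. \<gamma> t = x}. action L F uf m t T \<gamma>)"
proof -
  note * = assms[unfolded mild_solution_def]
  from * show "t \<in> {0..T} \<Longrightarrow> m t \<in> P" by blast
  from * show "continuous_on ({0..T} \<times> K) (\<lambda>(s, x). F x (m s))"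
    by (intro coupling_continuous) blast
  from * show "t \<in> {0..T} \<Longrightarrow> x \<in> K \<Longrightarrow>
      ereal (u t x) = (INF \<gamma>\<in>{\<gamma> \<in> curves K T. \<gamma> t = x}. action L F uf m t T \<gamma>)"
    by blast
qed

lemma coupling_continuous_in_time:
  assumes "mild_solution \<Omega> L F uf m0 T u m" "x \<in> K" "0 \<le> t"
  shows "continuous_on {t..T} (\<lambda>s. F x (m s))"
proof -
  have "continuous_on {t..T} ((\<lambda>(s, x). F x (m s)) \<circ> (\<lambda>s. (s, x)))"
    using assms(2,3)
    by (intro continuous_on_compose continuous_intros
        continuous_on_subset[OF mild_solutionD(2)[OF assms(1)]]) auto
  then show ?thesis by (simp add: o_def)
qed

lemma potential_continuous_in_time:
  assumes "mild_solution \<Omega> L F uf m0 T u m" "x \<in> K" "0 \<le> t"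
  shows "continuous_on {t..T} (\<lambda>s. L x 0 + F x (m s))"
  by (intro continuous_intros coupling_continuous_in_time[OF assms])

text \<open>The constant is fixed before \<open>T\<close>, the initial measure and the solution; the
  bounds that do not depend on \<open>T\<close> inherit their uniformity from here.\<close>

lemma competitor:
  obtains C where "C \<ge> 0"
    "\<And>T m0 u m t x y. mild_solution \<Omega> L F uf m0 T u m \<Longrightarrow> t \<in> {0..T} \<Longrightarrow> x \<in> K \<Longrightarrow> y \<in> K \<Longrightarrow>
      \<exists>\<gamma>\<in>curves K T. apply_bcontfun \<gamma> t = x \<and>
        action L F uf m t T \<gamma> \<le> ereal (C + (\<integral>s. L y 0 + F y (m s) \<partial>lebesgue_on {t..T}))"
proof -
  obtain B where B: "B > 0" "\<And>x m. m \<in> P \<Longrightarrow> \<bar>F x m\<bar> \<le> B" "\<And>x. x \<in> K \<Longrightarrow> \<bar>uf x\<bar> \<le> B"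
    using bounds by metis
  obtain M where M: "\<And>x y. x \<in> K \<Longrightarrow> y \<in> K \<Longrightarrow> lipschitz_joined K M x y"
    using domain_lipschitz_joined[OF domain] by blast
  have F: "\<bar>F x m\<bar> \<le> B" if "x \<in> K" "m \<in> P" for x m using B(2) that by simp
  have uf: "uf x \<le> B" if "x \<in> K" for x using B(3)[OF that] by linarith
  show ?thesis
  proof (rule action_competitor[where K = K and M = M and L = L and F = F and B = B and uf = uf,
        OF compact_K M L_continuous F uf])
    fix C
    assume C: "\<And>T m t x y. \<lbrakk>0 \<le> t; t \<le> T; x \<in> K; y \<in> K; \<forall>s\<in>{t..T}. m s \<in> P;
        continuous_on {t..T} (\<lambda>s. F y (m s));
        \<forall>s\<in>{t..T}. \<forall>z\<in>K. \<forall>v. 0 \<le> L z v + F z (m s)\<rbrakk> \<Longrightarrow>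
      \<exists>\<gamma>\<in>curves K T. apply_bcontfun \<gamma> t = x \<and>
        action L F uf m t T \<gamma> \<le> ereal (C + (\<integral>s. L y 0 + F y (m s) \<partial>lebesgue_on {t..T}))"
    show ?thesis
    proof (rule that[of "max 0 C"])
      fix T m0 u m t x y
      assume mild: "mild_solution \<Omega> L F uf m0 T u m" and t: "t \<in> {0..T}" and x: "x \<in> K" and y: "y \<in> K"
      have "\<exists>\<gamma>\<in>curves K T. apply_bcontfun \<gamma> t = x \<and>
          action L F uf m t T \<gamma> \<le> ereal (C + (\<integral>s. L y 0 + F y (m s) \<partial>lebesgue_on {t..T}))"
        using t mild_solutionD(1)[OF mild]
        by (intro C x y coupling_continuous_in_time[OF mild y] ballI allI lagrangian_nonneg) auto
      moreover have "ereal (C + c) \<le> ereal (max 0 C + c)" for c by simp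
      ultimately show "\<exists>\<gamma>\<in>curves K T. apply_bcontfun \<gamma> t = x \<and>
          action L F uf m t T \<gamma> \<le> ereal (max 0 C + (\<integral>s. L y 0 + F y (m s) \<partial>lebesgue_on {t..T}))"
        by (meson order_trans)
    qed simp
  qed
qed

text \<open>Rest minimizes \<open>L x\<close>, so discarding the velocity lowers the integrand. What
  remains is nonnegative, so even an infinite action is bounded below by a nonnegative
  integral.\<close>

lemma action_ge:
  assumes m: "\<And>s. s \<in> {t..T} \<Longrightarrow> m s \<in> P" and \<gamma>: "\<gamma> \<in> curves K T" and t: "0 \<le> t"
  shows "enn2ereal (\<integral>\<^sup>+s. ennreal (L (\<gamma> s) 0 + F (\<gamma> s) (m s)) \<partial>lebesgue_on {t..T}) + ereal (uf (\<gamma> T))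
    \<le> action L F uf m t T \<gamma>"
proof -
  have "\<gamma> s \<in> K" if "s \<in> {t..T}" for s using \<gamma> t that by (auto simp: curves_def)
  then show ?thesis
    unfolding action_def using potential_nonneg m
    by (intro add_right_mono eintegral_ge) (auto intro: L_ge)
qed

text \<open>The extension by zero makes the integrand Borel measurable jointly in \<open>(s, x)\<close>.\<close>

definition pot :: "real \<Rightarrow> (real \<Rightarrow> 'a measure) \<Rightarrow> real \<Rightarrow> 'a \<Rightarrow> ennreal" where
  "pot T m s x = ennreal (indicator ({0..T} \<times> K) (s, x) *\<^sub>R (L x 0 + F x (m s)))"

section \<open>Averaging the optimality of equilibrium curves\<close>

lemma pot_eq: "s \<in> {0..T} \<Longrightarrow> x \<in> K \<Longrightarrow> pot T m s x = ennreal (L x 0 + F x (m s))"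
  by (simp add: pot_def)

lemma pot_eq_0: "s \<notin> {0..T} \<Longrightarrow> pot T m s x = 0"
  by (auto simp: pot_def indicator_def)

lemma pot_measurable:
  assumes "mild_solution \<Omega> L F uf m0 T u m"
  shows "(\<lambda>(s, x). pot T m s x) \<in> borel_measurable (borel \<Otimes>\<^sub>M borel)"
proof -
  have "continuous_on ({0..T} \<times> K) (\<lambda>(s, x). L x 0 + F x (m s))"
  proof -
    have "continuous_on ({0..T} \<times> K) (\<lambda>z. L (snd z) 0)"
      by (rule continuous_on_compose2[OF L0_continuous[of UNIV]]) (auto intro: continuous_intros)
    then show ?thesis
      using continuous_on_add[OF _ mild_solutionD(2)[OF assms]] by (simp add: case_prod_beta')
  qed
  then have "(\<lambda>z. indicator ({0..T} \<times> K) z *\<^sub>R (case z of (s, x) \<Rightarrow> L x 0 + F x (m s)))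
      \<in> borel_measurable borel"
    by (rule borel_measurable_continuous_on_indicator[rotated])
      (intro borel_closed closed_Times, auto)
  then have "(\<lambda>z. ennreal (indicator ({0..T} \<times> K) z *\<^sub>R (case z of (s, x) \<Rightarrow> L x 0 + F x (m s))))
      \<in> borel_measurable (borel \<Otimes>\<^sub>M borel)"
    unfolding borel_prod by measurable
  then show ?thesis by (simp add: pot_def case_prod_beta')
qed

lemma pot_measurable_pair:
  assumes mild: "mild_solution \<Omega> L F uf m0 T u m" and \<mu>: "\<mu> \<in> P"
  shows "(\<lambda>(s, x). pot T m s x) \<in> borel_measurable (lborel \<Otimes>\<^sub>M \<mu>)"
proof -
  have "(\<lambda>x. x) \<in> measurable \<mu> borel" by (rule prob_on_measurable[OF \<mu> continuous_on_id])
  then have "(\<lambda>z. (fst z, snd z)) \<in> measurable (borel \<Otimes>\<^sub>M \<mu>) (borel \<Otimes>\<^sub>M borel)"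
    by (intro measurable_Pair measurable_fst measurable_compose[OF measurable_snd])
  from measurable_compose[OF this pot_measurable[OF mild]]
  show ?thesis by (simp add: case_prod_beta' cong: measurable_cong_sets sets_pair_measure_cong)
qed

lemma pot_nn_integral_time:
  assumes "mild_solution \<Omega> L F uf m0 T u m" "y \<in> K"
  shows "ennreal (\<integral>s. L y 0 + F y (m s) \<partial>lebesgue_on {0..T}) = (\<integral>\<^sup>+s. pot T m s y \<partial>lborel)"
proof -
  have eq: "ennreal (L y 0 + F y (m s)) * indicator {0..T} s = pot T m s y" for s
    using assms(2) by (auto simp: pot_def indicator_def)
  have "(\<lambda>s. pot T m s y) \<in> borel_measurable borel"
    using measurable_compose[OF measurable_Pair2'[of y borel borel] pot_measurable[OF assms(1)]] by simp
  then have "(\<integral>\<^sup>+s. pot T m s y \<partial>lborel) = (\<integral>\<^sup>+s. ennreal (L y 0 + F y (m s)) \<partial>lebesgue_on {0..T})"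
    by (subst nn_integral_lebesgue_on) (simp_all add: eq)
  also have "\<dots> = ennreal (\<integral>s. L y 0 + F y (m s) \<partial>lebesgue_on {0..T})"
    using potential_nonneg[OF mild_solutionD(1)[OF assms(1)] assms(2)]
    by (intro nn_integral_eq_integral integrable_lebesgue_on_compact
        potential_continuous_in_time[OF assms] AE_I2) auto
  finally show ?thesis by simp
qed

text \<open>The exceptional null set is chosen before \<open>y\<close>, so that the bound can
  afterwards be averaged in \<open>y\<close>. This is possible because optimality holds at every
  curve in the support, and separability of \<open>curves K T\<close> gives the support full
  measure.\<close>

lemma equilibrium_AE_pot_le:
  obtains C where "C \<ge> 0"
    "\<And>T m0 u m \<eta>. 0 < T \<Longrightarrow> mild_solution \<Omega> L F uf m0 T u m \<Longrightarrow> mfg_equilibrium \<Omega> L F uf m0 T \<eta> \<Longrightarrow>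
      \<forall>t\<in>{0..T}. m t = marginal K \<eta> t \<Longrightarrow>
      AE \<gamma> in \<eta>. \<forall>y\<in>K. (\<integral>\<^sup>+s. pot T m s (apply_bcontfun \<gamma> s) \<partial>lborel)
        \<le> ennreal C + (\<integral>\<^sup>+s. pot T m s y \<partial>lborel)"
proof (rule competitor)
  fix C assume C: "C \<ge> 0"
    "\<And>T m0 u m t x y. mild_solution \<Omega> L F uf m0 T u m \<Longrightarrow> t \<in> {0..T} \<Longrightarrow> x \<in> K \<Longrightarrow> y \<in> K \<Longrightarrow>
      \<exists>\<gamma>\<in>curves K T. apply_bcontfun \<gamma> t = x \<and>
        action L F uf m t T \<gamma> \<le> ereal (C + (\<integral>s. L y 0 + F y (m s) \<partial>lebesgue_on {t..T}))"
  obtain B where B: "B > 0" "\<And>x. x \<in> K \<Longrightarrow> \<bar>uf x\<bar> \<le> B" using bounds by metis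
  show thesis
  proof (rule that[of "C + B"])
    show "0 \<le> C + B" using C B by simp
    fix T m0 u m \<eta>
    assume T: "0 < T" and mild: "mild_solution \<Omega> L F uf m0 T u m"
      and \<eta>: "mfg_equilibrium \<Omega> L F uf m0 T \<eta>" and marg: "\<forall>t\<in>{0..T}. m t = marginal K \<eta> t"
    have \<eta>P: "\<eta> \<in> prob_on (curves K T)"
      and spt: "spt \<eta> \<subseteq> (\<Union>x\<in>K. argmin_set (action L F uf (marginal K \<eta>) 0 T) {\<gamma> \<in> curves K T. \<gamma> 0 = x})"
      using \<eta> unfolding mfg_equilibrium_def by blast+
    \<comment> \<open>The equilibrium is optimal for its own marginals, which are known to agree
      with \<open>m\<close> only on \<open>{0..T}\<close>; the action sees no other times.\<close>
    have action_eq: "action L F uf (marginal K \<eta>) 0 T \<gamma> = action L F uf m 0 T \<gamma>" for \<gamma>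
    proof -
      have cong: "eintegral (lebesgue_on {0..T}) f = eintegral (lebesgue_on {0..T}) g"
        if "\<And>s. s \<in> {0..T} \<Longrightarrow> f s = g s" for f g
        unfolding eintegral_def
        by (intro arg_cong2[of _ _ _ _ "\<lambda>a b. enn2ereal a - enn2ereal b"] nn_integral_cong)
          (simp_all add: that)
      show ?thesis unfolding action_def by (subst cong) (simp_all only: bspec[OF marg])
    qed
    obtain D where D: "countable D" "curves K T \<subseteq> closure D"
      using curves_separable[of T K] T by auto
    have AE: "AE \<gamma> in \<eta>. \<gamma> \<in> spt \<eta>" by (rule AE_in_spt[OF prob_onD(2)[OF \<eta>P] D])
    have le: "(\<integral>\<^sup>+s. pot T m s (apply_bcontfun \<gamma> s) \<partial>lborel)
        \<le> ennreal (C + B) + (\<integral>\<^sup>+s. pot T m s y \<partial>lborel)" if \<gamma>: "\<gamma> \<in> spt \<eta>" and y: "y \<in> K" for \<gamma> y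
    proof -
      obtain x where x: "x \<in> K" "\<gamma> \<in> argmin_set (action L F uf m 0 T) {\<gamma> \<in> curves K T. \<gamma> 0 = x}"
        using spt \<gamma> unfolding action_eq[abs_def] by blast
      then have \<gamma>C: "\<gamma> \<in> curves K T"
        and min: "\<And>\<gamma>'. \<gamma>' \<in> curves K T \<Longrightarrow> apply_bcontfun \<gamma>' 0 = x \<Longrightarrow>
          action L F uf m 0 T \<gamma> \<le> action L F uf m 0 T \<gamma>'"
        unfolding argmin_set_def is_arg_min_def by (auto simp: not_less)
      let ?R = "\<integral>s. L y 0 + F y (m s) \<partial>lebesgue_on {0..T}"
      let ?X = "\<integral>\<^sup>+s. ennreal (L (\<gamma> s) 0 + F (\<gamma> s) (m s)) \<partial>lebesgue_on {0..T}"
      have "enn2ereal ?X + ereal (uf (\<gamma> T)) \<le> action L F uf m 0 T \<gamma>"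
        by (rule action_ge[OF mild_solutionD(1)[OF mild] \<gamma>C]) auto
      also have "\<dots> \<le> ereal (C + ?R)"
      proof -
        have "0 \<in> {0..T}" using T by simp
        from C(2)[OF mild this x(1) y] obtain \<gamma>' where \<gamma>': "\<gamma>' \<in> curves K T"
          "apply_bcontfun \<gamma>' 0 = x" "action L F uf m 0 T \<gamma>' \<le> ereal (C + ?R)"
          by blast
        from min[OF \<gamma>'(1,2)] \<gamma>'(3) show ?thesis by (rule order_trans)
      qed
      finally have le: "enn2ereal ?X + ereal (uf (\<gamma> T)) \<le> ereal (C + ?R)" .
      have \<gamma>K: "\<gamma> s \<in> K" if "s \<in> {0..T}" for s using \<gamma>C that unfolding curves_def by blast
      have "\<bar>uf (\<gamma> T)\<bar> \<le> B" using B(2) \<gamma>K T by simp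
      moreover have R: "0 \<le> ?R"
        using potential_nonneg[OF mild_solutionD(1)[OF mild] y]
        by (intro integral_nonneg_AE AE_I2) auto
      \<comment> \<open>\<open>B\<close> compensates for a negative terminal cost of
        \<open>\<gamma>\<close>, and finiteness of the right-hand side excludes an infinite
        integral.\<close>
      ultimately have "enn2ereal ?X \<le> ereal (C + B + ?R)"
        using le by (cases "enn2ereal ?X") auto
      moreover have "enn2ereal (ennreal (C + B + ?R)) = ereal (C + B + ?R)"
        using C(1) B(1) R by (intro enn2ereal_ennreal) linarith
      ultimately have "?X \<le> ennreal (C + B + ?R)"
        unfolding less_eq_ennreal.rep_eq by (simp only:)
      also have "\<dots> = ennreal (C + B) + ennreal ?R" using C(1) B(1) R by (intro ennreal_plus) auto
      also have "ennreal ?R = (\<integral>\<^sup>+s. pot T m s y \<partial>lborel)" by (rule pot_nn_integral_time[OF mild y])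
      also have "?X = (\<integral>\<^sup>+s. pot T m s (apply_bcontfun \<gamma> s) \<partial>lborel)"
      proof -
        have eq: "ennreal (L (\<gamma> s) 0 + F (\<gamma> s) (m s)) * indicator {0..T} s = pot T m s (apply_bcontfun \<gamma> s)" for s
          using \<gamma>K[of s] by (auto simp: pot_def indicator_def)
        have "(\<lambda>s. (s, apply_bcontfun \<gamma> s)) \<in> measurable borel (borel \<Otimes>\<^sub>M borel)"
          by (intro measurable_Pair borel_measurable_continuous_onI) auto
        from measurable_compose[OF this pot_measurable[OF mild]]
        show ?thesis by (subst nn_integral_lebesgue_on) (simp_all add: eq)
      qed
      finally show ?thesis .
    qed
    show "AE \<gamma> in \<eta>. \<forall>y\<in>K. (\<integral>\<^sup>+s. pot T m s (apply_bcontfun \<gamma> s) \<partial>lborel)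
        \<le> ennreal (C + B) + (\<integral>\<^sup>+s. pot T m s y \<partial>lborel)"
      by (rule eventually_mono[OF AE]) (rule ballI, rule le)
  qed
qed

text \<open>Evaluation at time \<open>s\<close> carries the equilibrium to \<open>m s\<close>, so
  Tonelli turns the average cost of the curves into integrals against the marginals. Averaging the
  resting cost over \<open>y\<close> with respect to \<open>mbar\<close> gives the right-hand
  side.\<close>

lemma pot_integral_marginals_le:
  obtains C where "C \<ge> 0"
    "\<And>T m0 u m mbar. 0 < T \<Longrightarrow> mild_solution \<Omega> L F uf m0 T u m \<Longrightarrow> mbar \<in> P \<Longrightarrow>
      (\<integral>\<^sup>+s. (\<integral>\<^sup>+x. pot T m s x \<partial>m s) * indicator {0..T} s \<partial>lborel)
        \<le> ennreal C + (\<integral>\<^sup>+s. (\<integral>\<^sup>+x. pot T m s x \<partial>mbar) \<partial>lborel)"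
proof (rule equilibrium_AE_pot_le)
  fix C assume C: "C \<ge> 0"
    "\<And>T m0 u m \<eta>. 0 < T \<Longrightarrow> mild_solution \<Omega> L F uf m0 T u m \<Longrightarrow> mfg_equilibrium \<Omega> L F uf m0 T \<eta> \<Longrightarrow>
      \<forall>t\<in>{0..T}. m t = marginal K \<eta> t \<Longrightarrow>
      AE \<gamma> in \<eta>. \<forall>y\<in>K. (\<integral>\<^sup>+s. pot T m s (apply_bcontfun \<gamma> s) \<partial>lborel)
        \<le> ennreal C + (\<integral>\<^sup>+s. pot T m s y \<partial>lborel)"
  show thesis
  proof (rule that[OF C(1)])
    fix T m0 u m mbar
    assume T: "0 < T" and mild: "mild_solution \<Omega> L F uf m0 T u m" and mbar: "mbar \<in> P"
    obtain \<eta> where \<eta>: "mfg_equilibrium \<Omega> L F uf m0 T \<eta>" and marg: "\<forall>t\<in>{0..T}. m t = marginal K \<eta> t"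
      using mild unfolding mild_solution_def by blast
    have \<eta>P: "\<eta> \<in> prob_on (curves K T)" using \<eta> unfolding mfg_equilibrium_def by blast
    interpret \<eta>: prob_space \<eta> using prob_onD[OF \<eta>P] by simp
    interpret mbar: prob_space mbar using prob_onD[OF mbar] by simp
    interpret pair_\<eta>: pair_sigma_finite lborel \<eta> ..
    interpret pair_m: pair_sigma_finite lborel mbar ..
    note eval = eval_borel_measurable[OF prob_onD(2)[OF \<eta>P]]
    have meas_\<eta>: "(\<lambda>(s, \<gamma>). pot T m s (apply_bcontfun \<gamma> s)) \<in> borel_measurable (lborel \<Otimes>\<^sub>M \<eta>)"
    proof -
      have "(\<lambda>z. (fst z, apply_bcontfun (snd z) (fst z))) \<in> measurable (borel \<Otimes>\<^sub>M \<eta>) (borel \<Otimes>\<^sub>M borel)"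
        using eval(2) by (intro measurable_Pair measurable_fst) (simp add: case_prod_beta')
      from measurable_compose[OF this pot_measurable[OF mild]]
      show ?thesis by (simp add: case_prod_beta' cong: measurable_cong_sets sets_pair_measure_cong)
    qed
    note meas_m = pot_measurable_pair[OF mild mbar]
    let ?A = "\<integral>\<^sup>+\<gamma>. (\<integral>\<^sup>+s. pot T m s (apply_bcontfun \<gamma> s) \<partial>lborel) \<partial>\<eta>"
    have A: "?A \<le> ennreal C + (\<integral>\<^sup>+s. pot T m s y \<partial>lborel)" if "y \<in> K" for y
    proof -
      have "?A \<le> (\<integral>\<^sup>+\<gamma>. ennreal C + (\<integral>\<^sup>+s. pot T m s y \<partial>lborel) \<partial>\<eta>)"
        using C(2)[OF T mild \<eta> marg] that by (intro nn_integral_mono_AE) auto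
      then show ?thesis using \<eta>.emeasure_space_1 by simp
    qed
    have "(\<integral>\<^sup>+x. pot T m s x \<partial>m s) * indicator {0..T} s = (\<integral>\<^sup>+\<gamma>. pot T m s (apply_bcontfun \<gamma> s) \<partial>\<eta>)" for s
    proof (cases "s \<in> {0..T}")
      case True
      have "(\<lambda>\<gamma>. apply_bcontfun \<gamma> s) \<in> measurable \<eta> (restrict_space borel K)"
        using eval(1)[of s] prob_onD(3)[OF \<eta>P] True
        by (intro measurable_restrict_space2) (auto simp: curves_def)
      moreover have "pot T m s \<in> borel_measurable (restrict_space borel K)"
        using measurable_compose[OF measurable_Pair1'[of s borel borel] pot_measurable[OF mild]]
        by (intro measurable_restrict_space1) simp
      moreover have "m s = marginal K \<eta> s" using marg True by blast
      ultimately show ?thesis using True by (simp add: marginal_def nn_integral_distr)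
    qed (simp add: pot_eq_0)
    then have "(\<integral>\<^sup>+s. (\<integral>\<^sup>+x. pot T m s x \<partial>m s) * indicator {0..T} s \<partial>lborel)
        = (\<integral>\<^sup>+s. (\<integral>\<^sup>+\<gamma>. pot T m s (apply_bcontfun \<gamma> s) \<partial>\<eta>) \<partial>lborel)" by simp
    also have "\<dots> = ?A" using pair_\<eta>.Fubini'[OF meas_\<eta>] by simp
    \<comment> \<open>\<open>?A\<close> does not depend on \<open>y\<close> and \<open>mbar\<close>
      has mass one, so the bound valid for each \<open>y\<close> can be integrated.\<close>
    also have "?A = (\<integral>\<^sup>+y. ?A \<partial>mbar)" using mbar.emeasure_space_1 by simp
    also have "\<dots> \<le> (\<integral>\<^sup>+y. ennreal C + (\<integral>\<^sup>+s. pot T m s y \<partial>lborel) \<partial>mbar)"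
      using A prob_onD(3)[OF mbar] by (intro nn_integral_mono) simp
    also have "\<dots> = ennreal C + (\<integral>\<^sup>+y. (\<integral>\<^sup>+s. pot T m s y \<partial>lborel) \<partial>mbar)"
    proof (subst nn_integral_add)
      have "(\<lambda>(y, s). pot T m s y) \<in> borel_measurable (mbar \<Otimes>\<^sub>M lborel)"
        using measurable_compose[OF measurable_pair_swap' meas_m] by (simp add: case_prod_beta')
      from lborel.borel_measurable_nn_integral[OF this]
      show "(\<lambda>y. \<integral>\<^sup>+s. pot T m s y \<partial>lborel) \<in> borel_measurable mbar" by simp
    qed (simp_all add: mbar.emeasure_space_1)
    also have "(\<integral>\<^sup>+y. (\<integral>\<^sup>+s. pot T m s y \<partial>lborel) \<partial>mbar) = (\<integral>\<^sup>+s. (\<integral>\<^sup>+y. pot T m s y \<partial>mbar) \<partial>lborel)"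
      by (rule pair_m.Fubini'[OF meas_m])
    finally show "(\<integral>\<^sup>+s. (\<integral>\<^sup>+x. pot T m s x \<partial>m s) * indicator {0..T} s \<partial>lborel)
        \<le> ennreal C + (\<integral>\<^sup>+s. (\<integral>\<^sup>+x. pot T m s x \<partial>mbar) \<partial>lborel)" .
  qed
qed

abbreviation diff_norm :: "'a measure \<Rightarrow> (real \<Rightarrow> 'a measure) \<Rightarrow> real \<Rightarrow> real" where
  "diff_norm mbar m s \<equiv> sup_norm K (\<lambda>x. F x (m s) - F x mbar)"

section \<open>Monotonicity and the energy estimate\<close>

lemma coupling_diff_bounded:
  assumes "m1 \<in> P" "m2 \<in> P"
  shows "bounded ((\<lambda>x. F x m1 - F x m2) ` K)"
  by (intro compact_imp_bounded compact_continuous_image compact_K continuous_intros F_continuous assms)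

text \<open>The supremum norm changes by at most the uniform distance of its arguments, which (F2)
  controls by \<open>d1\<close>. Continuity supplies measurability and integrability for the
  integrals in time.\<close>

lemma diff_norm_continuous:
  assumes mild: "mild_solution \<Omega> L F uf m0 T u m" and mbar: "mbar \<in> P"
  shows "continuous_on {0..T} (diff_norm mbar m)"
  unfolding continuous_on_def
proof
  fix t assume t: "t \<in> {0..T}"
  obtain B where B: "\<And>x m m'. m \<in> P \<Longrightarrow> m' \<in> P \<Longrightarrow> \<bar>F x m - F x m'\<bar> \<le> B * d1 K m m'"
    using bounds by metis
  note m = mild_solutionD(1)[OF mild]
  have "((\<lambda>s. d1 K (m s) (m t)) \<longlongrightarrow> 0) (at t within {0..T})"
    using mild t unfolding mild_solution_def by blast
  then have lim: "((\<lambda>s. B * d1 K (m s) (m t)) \<longlongrightarrow> 0) (at t within {0..T})"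
    by (rule tendsto_mult_right_zero)
  have "\<bar>diff_norm mbar m s - diff_norm mbar m t\<bar> \<le> B * d1 K (m s) (m t)" if "s \<in> {0..T}" for s
    using B[OF m[OF that] m[OF t]]
    by (intro sup_norm_diff_le K_nonempty coupling_diff_bounded m that t mbar) simp
  then have "\<forall>\<^sub>F s in at t within {0..T}.
      norm (diff_norm mbar m s - diff_norm mbar m t) \<le> B * d1 K (m s) (m t)"
    by (auto simp: eventually_at_filter)
  from Lim_null_comparison[OF this lim]
  show "(diff_norm mbar m \<longlongrightarrow> diff_norm mbar m t) (at t within {0..T})"
    by (rule LIM_zero_cancel)
qed

text \<open>The term \<open>L x 0\<close> cancels, so \<open>F x m - F x mbar\<close> is a
  difference of potentials. The potential of \<open>mbar\<close> integrates to zero against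
  \<open>mbar\<close> and to a nonnegative number against \<open>m\<close>, which may be
  dropped.\<close>

lemma monotone_coupling_le:
  assumes m: "m \<in> P" and mbar: "mbar \<in> P" and zero: "(\<integral>x. L x 0 + F x mbar \<partial>mbar) = 0"
  shows "(\<integral>x. F x m - F x mbar \<partial>m) - (\<integral>x. F x m - F x mbar \<partial>mbar)
    \<le> (\<integral>x. L x 0 + F x m \<partial>m) - (\<integral>x. L x 0 + F x m \<partial>mbar)"
proof -
  have int: "integrable \<mu> (\<lambda>x. L x 0 + F x \<nu>)" if "\<mu> \<in> P" "\<nu> \<in> P" for \<mu> \<nu>
    using that by (intro prob_on_integrable[OF _ _ compact_K] potential_continuous)
  have eq: "F x m - F x mbar = (L x 0 + F x m) - (L x 0 + F x mbar)" for x by simp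
  have "0 \<le> (\<integral>x. L x 0 + F x mbar \<partial>m)"
    using potential_nonneg[OF mbar] prob_onD(3)[OF m] by (intro integral_nonneg_AE AE_I2) auto
  moreover have "(\<integral>x. F x m - F x mbar \<partial>\<mu>) = (\<integral>x. L x 0 + F x m \<partial>\<mu>) - (\<integral>x. L x 0 + F x mbar \<partial>\<mu>)"
    if "\<mu> \<in> P" for \<mu>
    unfolding eq by (intro Bochner_Integration.integral_diff int that m mbar)
  ultimately show ?thesis using m mbar zero by simp
qed

text \<open>(F3) controls the integral of the square, and the power inequality is applied at a
  maximum point of the modulus. The estimate is phrased as a sum, free of subtraction, so that it
  passes to \<open>ennreal\<close> integrals in time.\<close>

lemma diff_norm_power_le:
  obtains c where "c > 0"
    "\<And>m mbar s. m s \<in> P \<Longrightarrow> mbar \<in> P \<Longrightarrow> (\<integral>x. L x 0 + F x mbar \<partial>mbar) = 0 \<Longrightarrow>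
      c * diff_norm mbar m s ^ (DIM('a) + 2) + (\<integral>x. L x 0 + F x (m s) \<partial>mbar)
        \<le> (\<integral>x. L x 0 + F x (m s) \<partial>(m s))"
proof -
  obtain B where B: "B > 0" "\<And>x m. m \<in> P \<Longrightarrow> \<bar>F x m\<bar> \<le> B"
    "\<And>x y m. m \<in> P \<Longrightarrow> \<bar>F x m - F y m\<bar> \<le> B * dist x y"
    using bounds by metis
  obtain CF where CF: "CF > 0" "\<And>m1 m2. m1 \<in> P \<Longrightarrow> m2 \<in> P \<Longrightarrow>
      CF * (\<integral>x. (F x m1 - F x m2)\<^sup>2 \<partial>lebesgue_on K)
        \<le> (\<integral>x. F x m1 - F x m2 \<partial>m1) - (\<integral>x. F x m1 - F x m2 \<partial>m2)"
    using F3 unfolding F3_def by blast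
  have "2 * B > 0" using B(1) by simp
  then obtain C1 where C1: "C1 > 0"
    "\<And>f x. (\<And>x y. x \<in> K \<Longrightarrow> y \<in> K \<Longrightarrow> \<bar>f x - f y\<bar> \<le> (2 * B) * dist x y) \<Longrightarrow>
      (\<And>x. x \<in> K \<Longrightarrow> \<bar>f x\<bar> \<le> 2 * B) \<Longrightarrow> x \<in> K \<Longrightarrow>
      \<bar>f x\<bar> ^ (DIM('a) + 2) \<le> C1 * (\<integral>x. (f x)\<^sup>2 \<partial>lebesgue_on K)"
    using lipschitz_power_le_integral_square[OF domain, of "2 * B" "2 * B"] by metis
  show ?thesis
  proof (rule that[of "CF / C1"])
    show "CF / C1 > 0" using CF C1 by simp
    fix m :: "real \<Rightarrow> 'a measure" and mbar s
    assume m: "m s \<in> P" and mbar: "mbar \<in> P" and zero: "(\<integral>x. L x 0 + F x mbar \<partial>mbar) = 0"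
    define f where "f = (\<lambda>x. F x (m s) - F x mbar)"
    have "continuous_on K (\<lambda>x. \<bar>f x\<bar>)"
      unfolding f_def by (intro continuous_intros F_continuous m mbar)
    then obtain z where z: "z \<in> K" "\<And>x. x \<in> K \<Longrightarrow> \<bar>f x\<bar> \<le> \<bar>f z\<bar>"
      using continuous_attains_sup[OF compact_K K_nonempty] by metis
    have N: "0 \<le> diff_norm mbar m s" "diff_norm mbar m s \<le> \<bar>f z\<bar>"
      using sup_norm_nonneg[OF coupling_diff_bounded[OF m mbar] K_nonempty] z(2)
      unfolding f_def by (auto intro!: sup_norm_least K_nonempty)
    then have "diff_norm mbar m s ^ (DIM('a) + 2) \<le> \<bar>f z\<bar> ^ (DIM('a) + 2)"
      by (intro power_mono)
    also have "\<dots> \<le> C1 * (\<integral>x. (f x)\<^sup>2 \<partial>lebesgue_on K)"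
    proof (rule C1(2)[OF _ _ z(1)])
      show "\<bar>f x - f y\<bar> \<le> 2 * B * dist x y" for x y
        using B(3)[OF m, of x y] B(3)[OF mbar, of x y] unfolding f_def by linarith
      show "\<bar>f x\<bar> \<le> 2 * B" for x
        using B(2)[OF m, of x] B(2)[OF mbar, of x] unfolding f_def by linarith
    qed
    finally have "CF / C1 * diff_norm mbar m s ^ (DIM('a) + 2) \<le> CF * (\<integral>x. (f x)\<^sup>2 \<partial>lebesgue_on K)"
      using CF(1) C1(1) by (simp add: field_simps)
    also have "\<dots> \<le> (\<integral>x. L x 0 + F x (m s) \<partial>(m s)) - (\<integral>x. L x 0 + F x (m s) \<partial>mbar)"
      using CF(2)[OF m mbar] monotone_coupling_le[OF m mbar zero] unfolding f_def by linarith
    finally show "CF / C1 * diff_norm mbar m s ^ (DIM('a) + 2) + (\<integral>x. L x 0 + F x (m s) \<partial>mbar)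
        \<le> (\<integral>x. L x 0 + F x (m s) \<partial>(m s))" by simp
  qed
qed

lemma pot_nn_integral:
  assumes "s \<in> {0..T}" "m s \<in> P" "\<mu> \<in> P"
  shows "(\<integral>\<^sup>+x. pot T m s x \<partial>\<mu>) = ennreal (\<integral>x. L x 0 + F x (m s) \<partial>\<mu>)"
proof -
  have "(\<integral>\<^sup>+x. pot T m s x \<partial>\<mu>) = (\<integral>\<^sup>+x. ennreal (L x 0 + F x (m s)) \<partial>\<mu>)"
    using assms prob_onD(3)[OF assms(3)] by (intro nn_integral_cong pot_eq) auto
  also have "\<dots> = ennreal (\<integral>x. L x 0 + F x (m s) \<partial>\<mu>)"
    using assms prob_onD(3)[OF assms(3)] potential_nonneg[OF assms(2)]
    by (intro nn_integral_eq_integral prob_on_integrable[OF _ _ compact_K] potential_continuous AE_I2) auto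
  finally show ?thesis .
qed

lemma energy_estimate:
  obtains E where "E \<ge> 0"
    "\<And>T m0 u m mbar. 0 < T \<Longrightarrow> mild_solution \<Omega> L F uf m0 T u m \<Longrightarrow> mbar \<in> P \<Longrightarrow>
      (\<integral>x. L x 0 + F x mbar \<partial>mbar) = 0 \<Longrightarrow>
      (\<integral>s. diff_norm mbar m s ^ (DIM('a) + 2) \<partial>lebesgue_on {0..T}) \<le> E"
proof (rule pot_integral_marginals_le)
  fix C assume C: "C \<ge> 0"
    "\<And>T m0 u m mbar. 0 < T \<Longrightarrow> mild_solution \<Omega> L F uf m0 T u m \<Longrightarrow> mbar \<in> P \<Longrightarrow>
      (\<integral>\<^sup>+s. (\<integral>\<^sup>+x. pot T m s x \<partial>m s) * indicator {0..T} s \<partial>lborel)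
        \<le> ennreal C + (\<integral>\<^sup>+s. (\<integral>\<^sup>+x. pot T m s x \<partial>mbar) \<partial>lborel)"
  obtain c where c: "c > 0"
    "\<And>m mbar s. m s \<in> P \<Longrightarrow> mbar \<in> P \<Longrightarrow> (\<integral>x. L x 0 + F x mbar \<partial>mbar) = 0 \<Longrightarrow>
      c * diff_norm mbar m s ^ (DIM('a) + 2) + (\<integral>x. L x 0 + F x (m s) \<partial>mbar)
        \<le> (\<integral>x. L x 0 + F x (m s) \<partial>(m s))"
    using diff_norm_power_le by blast
  obtain B where B: "B > 0" "\<And>x m. m \<in> P \<Longrightarrow> \<bar>F x m\<bar> \<le> B" using bounds by metis
  have "bounded ((\<lambda>x. L x 0) ` K)"
    by (intro compact_imp_bounded compact_continuous_image L0_continuous compact_K)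
  then obtain A where A: "\<And>x. x \<in> K \<Longrightarrow> \<bar>L x 0\<bar> \<le> A" by (auto simp: bounded_iff)
  show thesis
  proof (rule that[of "C / c"])
    show "0 \<le> C / c" using C c by simp
    fix T m0 u m mbar
    assume T: "0 < T" and mild: "mild_solution \<Omega> L F uf m0 T u m" and mbar: "mbar \<in> P"
      and zero: "(\<integral>x. L x 0 + F x mbar \<partial>mbar) = 0"
    interpret mbar: prob_space mbar using prob_onD[OF mbar] by simp
    note m = mild_solutionD(1)[OF mild]
    let ?N = "\<lambda>s. diff_norm mbar m s ^ (DIM('a) + 2)"
    let ?g = "\<lambda>s. ennreal (c * ?N s) * indicator {0..T} s"
    let ?h = "\<lambda>s. \<integral>\<^sup>+x. pot T m s x \<partial>mbar"
    have N_cont: "continuous_on {0..T} (\<lambda>s. c * ?N s)"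
      by (intro continuous_intros diff_norm_continuous[OF mild mbar])
    have N0: "0 \<le> ?N s" if "s \<in> {0..T}" for s
      using sup_norm_nonneg[OF coupling_diff_bounded[OF m[OF that] mbar] K_nonempty] by simp
    have g_meas: "?g \<in> borel_measurable borel"
    proof -
      have "(\<lambda>s. ennreal (indicator {0..T} s *\<^sub>R (c * ?N s))) \<in> borel_measurable borel"
        by (intro measurable_compose[OF _ measurable_ennreal] borel_measurable_continuous_on_indicator N_cont) auto
      moreover have "ennreal (indicator {0..T} s *\<^sub>R (c * ?N s)) = ?g s" for s
        by (auto simp: indicator_def)
      ultimately show ?thesis by simp
    qed
    have h_meas: "?h \<in> borel_measurable lborel"
      using mbar.borel_measurable_nn_integral[OF pot_measurable_pair[OF mild mbar]] by simp
    \<comment> \<open>The resting cost occurs on both sides and can be cancelled in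
      \<open>ennreal\<close> only if finite. The bound \<open>(A + B) * T\<close> serves this
      purpose alone and does not enter the final constant.\<close>
    have h_fin: "(\<integral>\<^sup>+s. ?h s \<partial>lborel) \<noteq> \<infinity>"
    proof -
      have "?h s \<le> ennreal (A + B) * indicator {0..T} s" for s
      proof (cases "s \<in> {0..T}")
        case True
        have "pot T m s x \<le> ennreal (A + B)" if "x \<in> K" for x
          unfolding pot_eq[OF True that] using A[OF that] B(2)[OF m[OF True], of x] by (intro ennreal_leI) linarith
        then have "?h s \<le> (\<integral>\<^sup>+x. ennreal (A + B) \<partial>mbar)"
          using prob_onD(3)[OF mbar] by (intro nn_integral_mono) simp
        then show ?thesis using True mbar.emeasure_space_1 by simp
      qed (simp add: pot_eq_0)
      then have "(\<integral>\<^sup>+s. ?h s \<partial>lborel) \<le> (\<integral>\<^sup>+s. ennreal (A + B) * indicator {0..T} s \<partial>lborel)"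
        by (intro nn_integral_mono)
      also have "\<dots> = ennreal (A + B) * ennreal T" using T by (simp add: nn_integral_cmult_indicator)
      also have "\<dots> < \<infinity>" by (simp add: ennreal_mult_less_top)
      finally show ?thesis by simp
    qed
    have "(\<integral>\<^sup>+s. ?g s \<partial>lborel) + (\<integral>\<^sup>+s. ?h s \<partial>lborel) = (\<integral>\<^sup>+s. ?g s + ?h s \<partial>lborel)"
      using g_meas h_meas by (subst nn_integral_add) auto
    also have "\<dots> \<le> (\<integral>\<^sup>+s. (\<integral>\<^sup>+x. pot T m s x \<partial>m s) * indicator {0..T} s \<partial>lborel)"
    proof (rule nn_integral_mono)
      fix s
      show "?g s + ?h s \<le> (\<integral>\<^sup>+x. pot T m s x \<partial>m s) * indicator {0..T} s"
      proof (cases "s \<in> {0..T}")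
        case True
        note ms = m[OF True]
        have nn: "0 \<le> (\<integral>x. L x 0 + F x (m s) \<partial>mbar)"
          using potential_nonneg[OF ms] prob_onD(3)[OF mbar] by (intro integral_nonneg_AE AE_I2) auto
        have "?g s + ?h s = ennreal (c * ?N s + (\<integral>x. L x 0 + F x (m s) \<partial>mbar))"
          using True N0[OF True] c(1) nn by (simp add: pot_nn_integral[where m = m, OF True ms mbar])
        also have "\<dots> \<le> ennreal (\<integral>x. L x 0 + F x (m s) \<partial>m s)"
          by (intro ennreal_leI c(2) ms mbar zero)
        finally show ?thesis using True by (simp add: pot_nn_integral[where m = m, OF True ms ms])
      qed (simp add: pot_eq_0)
    qed
    also have "\<dots> \<le> ennreal C + (\<integral>\<^sup>+s. ?h s \<partial>lborel)" by (rule C(2)[OF T mild mbar])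
    finally have "(\<integral>\<^sup>+s. ?g s \<partial>lborel) \<le> ennreal C"
      using h_fin by (simp add: ennreal_add_left_cancel_le add.commute)
    also have "(\<integral>\<^sup>+s. ?g s \<partial>lborel) = (\<integral>\<^sup>+s. ennreal (c * ?N s) \<partial>lebesgue_on {0..T})"
      using g_meas by (subst nn_integral_lebesgue_on) auto
    also have "\<dots> = ennreal (\<integral>s. c * ?N s \<partial>lebesgue_on {0..T})"
      using N0 c(1) by (intro nn_integral_eq_integral integrable_lebesgue_on_compact N_cont AE_I2) auto
    finally have "c * (\<integral>s. ?N s \<partial>lebesgue_on {0..T}) \<le> C" using C(1) by simp
    then show "(\<integral>s. ?N s \<partial>lebesgue_on {0..T}) \<le> C / c" using c(1) by (simp add: field_simps)
  qed
qed

lemma coupling_average_estimate: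
  obtains E where "E > 0"
    "\<And>T m0 u m mbar. 0 < T \<Longrightarrow> mild_solution \<Omega> L F uf m0 T u m \<Longrightarrow> mbar \<in> P \<Longrightarrow>
      (\<integral>x. L x 0 + F x mbar \<partial>mbar) = 0 \<Longrightarrow>
      (1 / T) * (\<integral>s. diff_norm mbar m s \<partial>lebesgue_on {0..T}) \<le> E / T powr (1 / (real DIM('a) + 2))"
proof (rule energy_estimate)
  fix E assume E: "E \<ge> 0"
    "\<And>T m0 u m mbar. 0 < T \<Longrightarrow> mild_solution \<Omega> L F uf m0 T u m \<Longrightarrow> mbar \<in> P \<Longrightarrow>
      (\<integral>x. L x 0 + F x mbar \<partial>mbar) = 0 \<Longrightarrow>
      (\<integral>s. diff_norm mbar m s ^ (DIM('a) + 2) \<partial>lebesgue_on {0..T}) \<le> E"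
  show thesis
  proof (rule that[of "1 + E"])
    show "0 < 1 + E" using E by simp
    fix T m0 u m mbar
    assume T: "0 < T" and mild: "mild_solution \<Omega> L F uf m0 T u m" and mbar: "mbar \<in> P"
      and zero: "(\<integral>x. L x 0 + F x mbar \<partial>mbar) = 0"
    define n where "n = DIM('a) + 1"
    have n: "DIM('a) + 2 = Suc n" "real DIM('a) + 2 = real (Suc n)" by (simp_all add: n_def)
    \<comment> \<open>Balances the two terms of \<open>le_add_power_div\<close>: since
      \<open>a ^ Suc n = 1 / T\<close>, after division by \<open>T\<close> the constant contributes
      \<open>a\<close> and the remainder \<open>E / (a ^ n * T) = E * a\<close>.\<close>
    define a where "a = T powr (- (1 / real (Suc n)))"
    have a: "a > 0" using T by (simp add: a_def)
    have "a ^ Suc n = T powr (- (1 / real (Suc n)) * real (Suc n))"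
      using T by (simp add: a_def powr_power del: of_nat_Suc power_Suc)
    also have "\<dots> = 1 / T" using T by (simp add: powr_minus_divide del: of_nat_Suc)
    finally have aT: "a ^ n * a * T = 1" using T by (simp add: field_simps)
    note N_cont = diff_norm_continuous[OF mild mbar]
    have int: "integrable (lebesgue_on {0..T}) f" if "continuous_on {0..T} f" for f :: "real \<Rightarrow> real"
      using that by (intro integrable_lebesgue_on_compact) auto
    have N0: "0 \<le> diff_norm mbar m s" if "s \<in> {0..T}" for s
      using sup_norm_nonneg[OF coupling_diff_bounded[OF mild_solutionD(1)[OF mild that] mbar] K_nonempty] .
    have "(\<integral>s. diff_norm mbar m s \<partial>lebesgue_on {0..T})
        \<le> (\<integral>s. a + diff_norm mbar m s ^ Suc n / a ^ n \<partial>lebesgue_on {0..T})"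
      using N0 a by (intro integral_mono int continuous_intros N_cont le_add_power_div) auto
    also have "\<dots> = (\<integral>s. a \<partial>lebesgue_on {0..T})
        + (\<integral>s. diff_norm mbar m s ^ Suc n / a ^ n \<partial>lebesgue_on {0..T})"
      using a by (intro Bochner_Integration.integral_add int continuous_intros N_cont) auto
    also have "\<dots> = a * T + (\<integral>s. diff_norm mbar m s ^ Suc n \<partial>lebesgue_on {0..T}) / a ^ n"
      using T by (simp add: integral_restrict_space measure_restrict_space)
    also have "\<dots> \<le> a * T + E / a ^ n"
      using E(2)[OF T mild mbar zero] a unfolding n by (intro add_left_mono divide_right_mono) auto
    finally have "(1 / T) * (\<integral>s. diff_norm mbar m s \<partial>lebesgue_on {0..T}) \<le> (1 / T) * (a * T + E / a ^ n)"
      using T by (intro mult_left_mono) auto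
    also have "\<dots> = a + E * (1 / (a ^ n * T))" using T by (simp add: field_simps)
    also have "1 / (a ^ n * T) = a" using aT a T by (simp add: field_simps)
    also have "a + E * a = (1 + E) / T powr (1 / (real DIM('a) + 2))"
      unfolding a_def n(2) by (simp add: powr_minus_divide algebra_simps add_divide_distrib del: of_nat_Suc)
    finally show "(1 / T) * (\<integral>s. diff_norm mbar m s \<partial>lebesgue_on {0..T})
        \<le> (1 + E) / T powr (1 / (real DIM('a) + 2))" .
  qed
qed

text \<open>The resting point is a zero of the potential of \<open>mbar\<close> rather than of
  \<open>m s\<close>: it is fixed in time, and its running cost is the coupling difference at that
  point, bounded by \<open>diff_norm\<close>. From below only the terminal cost matters, because the
  running cost is nonnegative.\<close>

lemma value_function_estimate:
  obtains C where "C > 0"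
    "\<And>T m0 u m mbar t x. mild_solution \<Omega> L F uf m0 T u m \<Longrightarrow> mbar \<in> P \<Longrightarrow> t \<in> {0..T} \<Longrightarrow> x \<in> K \<Longrightarrow>
      \<bar>u t x\<bar> \<le> C + (\<integral>s. diff_norm mbar m s \<partial>lebesgue_on {0..T})"
proof (rule competitor)
  fix C assume C: "C \<ge> 0"
    "\<And>T m0 u m t x y. mild_solution \<Omega> L F uf m0 T u m \<Longrightarrow> t \<in> {0..T} \<Longrightarrow> x \<in> K \<Longrightarrow> y \<in> K \<Longrightarrow>
      \<exists>\<gamma>\<in>curves K T. apply_bcontfun \<gamma> t = x \<and>
        action L F uf m t T \<gamma> \<le> ereal (C + (\<integral>s. L y 0 + F y (m s) \<partial>lebesgue_on {t..T}))"
  obtain B where B: "B > 0" "\<And>x. x \<in> K \<Longrightarrow> \<bar>uf x\<bar> \<le> B" using bounds by metis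
  show thesis
  proof (rule that[of "B + C"])
    show "0 < B + C" using B C by simp
    fix T m0 u m mbar t x
    assume mild: "mild_solution \<Omega> L F uf m0 T u m" and mbar: "mbar \<in> P" and t: "t \<in> {0..T}" and x: "x \<in> K"
    note m = mild_solutionD(1)[OF mild]
    note u = mild_solutionD(3)[OF mild t x]
    let ?I = "\<integral>s. diff_norm mbar m s \<partial>lebesgue_on {0..T}"
    have N0: "0 \<le> diff_norm mbar m s" if "s \<in> {0..T}" for s
      using sup_norm_nonneg[OF coupling_diff_bounded[OF m[OF that] mbar] K_nonempty] .
    have I0: "0 \<le> ?I" using N0 by (intro integral_nonneg_AE AE_I2) auto
    obtain y where y: "y \<in> K" "L y 0 + F y mbar = 0" using potential_minimizer[OF mbar] by blast
    obtain \<gamma> where \<gamma>: "\<gamma> \<in> curves K T" "apply_bcontfun \<gamma> t = x"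
      "action L F uf m t T \<gamma> \<le> ereal (C + (\<integral>s. L y 0 + F y (m s) \<partial>lebesgue_on {t..T}))"
      using C(2)[OF mild t x y(1)] by blast
    have "ereal (u t x) \<le> action L F uf m t T \<gamma>" unfolding u using \<gamma> by (intro INF_lower) auto
    with \<gamma>(3) have "u t x \<le> C + (\<integral>s. L y 0 + F y (m s) \<partial>lebesgue_on {t..T})"
      by (meson ereal_less_eq(3) order_trans)
    also have "(\<integral>s. L y 0 + F y (m s) \<partial>lebesgue_on {t..T}) \<le> ?I"
    proof -
      have le: "L y 0 + F y (m s) \<le> diff_norm mbar m s" if "s \<in> {0..T}" for s
        using sup_norm_upper[OF coupling_diff_bounded[OF m[OF that] mbar] y(1)] y(2) by linarith
      have "(\<integral>s. L y 0 + F y (m s) \<partial>lebesgue_on {t..T})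
          = (\<integral>s. indicator {t..T} s *\<^sub>R (L y 0 + F y (m s)) \<partial>lebesgue)"
        by (intro integral_restrict_space) auto
      \<comment> \<open>Nonnegativity of \<open>diff_norm\<close> permits enlarging the interval to
        \<open>{0..T}\<close>, which makes the bound independent of \<open>t\<close>.\<close>
      also have "\<dots> \<le> (\<integral>s. indicator {0..T} s *\<^sub>R diff_norm mbar m s \<partial>lebesgue)"
      proof (rule integral_mono)
        show "integrable lebesgue (\<lambda>s. indicator {t..T} s *\<^sub>R (L y 0 + F y (m s)))"
          using integrable_lebesgue_on_compact[OF compact_Icc potential_continuous_in_time[OF mild y(1), of t]] t
          by (subst integrable_restrict_space[symmetric]) auto
        show "integrable lebesgue (\<lambda>s. indicator {0..T} s *\<^sub>R diff_norm mbar m s)"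
          using integrable_lebesgue_on_compact[OF compact_Icc diff_norm_continuous[OF mild mbar]]
          by (subst integrable_restrict_space[symmetric]) auto
        show "indicator {t..T} s *\<^sub>R (L y 0 + F y (m s)) \<le> indicator {0..T} s *\<^sub>R diff_norm mbar m s" for s
          using le[of s] N0[of s] t by (auto simp: indicator_def)
      qed
      also have "\<dots> = ?I" by (intro integral_restrict_space[symmetric]) auto
      finally show ?thesis .
    qed
    finally have upper: "u t x \<le> C + ?I" by simp
    have "ereal (- B) \<le> ereal (u t x)"
      unfolding u
    proof (rule INF_greatest)
      fix \<gamma> assume "\<gamma> \<in> {\<gamma> \<in> curves K T. \<gamma> t = x}"
      then have \<gamma>: "\<gamma> \<in> curves K T" by simp
      moreover have "T \<in> {0..T}" using t by simp
      ultimately have "apply_bcontfun \<gamma> T \<in> K" unfolding curves_def by blast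
      then have "- B \<le> uf (\<gamma> T)" using B(2) by fastforce
      then have "ereal (- B) \<le> 0 + ereal (uf (\<gamma> T))" by simp
      also have "\<dots> \<le> enn2ereal (\<integral>\<^sup>+s. ennreal (L (\<gamma> s) 0 + F (\<gamma> s) (m s)) \<partial>lebesgue_on {t..T}) + ereal (uf (\<gamma> T))"
        by (intro add_right_mono) simp
      also have "\<dots> \<le> action L F uf m t T \<gamma>" using t by (intro action_ge m \<gamma>) auto
      finally show "ereal (- B) \<le> action L F uf m t T \<gamma>" .
    qed
    then have "- B \<le> u t x" by simp
    with upper I0 B(1) C(1) show "\<bar>u t x\<bar> \<le> B + C + ?I" by linarith
  qed
qed

end

theorem theorem5p5:
  fixes \<Omega> :: "'a::euclidean_space set"
    and L :: "'a \<Rightarrow> 'a \<Rightarrow> real"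
    and F :: "'a \<Rightarrow> 'a measure \<Rightarrow> real"
    and uf :: "'a \<Rightarrow> real"
  assumes "bounded_C2_domain \<Omega>"
    and "strict_tonelli L"
    and "reversible L"
    and "F1 \<Omega> F"
    and "F2 \<Omega> F"
    and "F3 \<Omega> F"
    and "A2 \<Omega> L F"
    and "U_cond \<Omega> uf"
    and "A3 \<Omega> L F"
  shows "\<exists>C'>0. \<forall>m0\<in>prob_on (closure \<Omega>). \<forall>(lam::real) ubar mbar.
    ergodic_solution \<Omega> L F lam ubar mbar \<longrightarrow>
    (\<forall>T>1. \<forall>u m. mild_solution \<Omega> L F uf m0 T u m \<longrightarrow>
      (SUP t\<in>{0..T}. sup_norm (closure \<Omega>) (\<lambda>x. u t x / T + lam * (1 - t / T)))
        \<le> C' / T powr (1 / (real DIM('a) + 2)) \<and>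
      (1 / T) * (\<integral>s. sup_norm (closure \<Omega>) (\<lambda>x. F x (m s) - F x mbar) \<partial>lebesgue_on {0..T})
        \<le> C' / T powr (1 / (real DIM('a) + 2)))"
proof -
  interpret constrained_mfg \<Omega> L F uf by (unfold_locales; fact assms)
  obtain E where E: "E > 0"
    "\<And>T m0 u m mbar. 0 < T \<Longrightarrow> mild_solution \<Omega> L F uf m0 T u m \<Longrightarrow> mbar \<in> P \<Longrightarrow>
      (\<integral>x. L x 0 + F x mbar \<partial>mbar) = 0 \<Longrightarrow>
      (1 / T) * (\<integral>s. diff_norm mbar m s \<partial>lebesgue_on {0..T}) \<le> E / T powr (1 / (real DIM('a) + 2))"
    using coupling_average_estimate by blast
  obtain C where C: "C > 0"
    "\<And>T m0 u m mbar t x. mild_solution \<Omega> L F uf m0 T u m \<Longrightarrow> mbar \<in> P \<Longrightarrow> t \<in> {0..T} \<Longrightarrow> x \<in> K \<Longrightarrow>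
      \<bar>u t x\<bar> \<le> C + (\<integral>s. diff_norm mbar m s \<partial>lebesgue_on {0..T})"
    using value_function_estimate by blast
  have "(SUP t\<in>{0..T}. sup_norm K (\<lambda>x. u t x / T + lam * (1 - t / T)))
        \<le> (C + E) / T powr (1 / (real DIM('a) + 2)) \<and>
      (1 / T) * (\<integral>s. diff_norm mbar m s \<partial>lebesgue_on {0..T})
        \<le> (C + E) / T powr (1 / (real DIM('a) + 2))"
    if erg: "ergodic_solution \<Omega> L F lam ubar mbar" and T: "T > 1"
      and mild: "mild_solution \<Omega> L F uf m0 T u m" for m0 lam ubar mbar T u m
  proof
    let ?\<alpha> = "1 / (real DIM('a) + 2)"
    have mbar: "mbar \<in> P" using erg unfolding ergodic_solution_def by blast
    have E': "(1 / T) * (\<integral>s. diff_norm mbar m s \<partial>lebesgue_on {0..T}) \<le> E / T powr ?\<alpha>"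
      using T by (intro E(2)[OF _ mild mbar ergodic_potential_integral[OF erg]]) simp
    also have "\<dots> \<le> (C + E) / T powr ?\<alpha>" using C(1) by (intro divide_right_mono) auto
    finally show "(1 / T) * (\<integral>s. diff_norm mbar m s \<partial>lebesgue_on {0..T}) \<le> (C + E) / T powr ?\<alpha>" .
    \<comment> \<open>The travel and terminal costs contribute \<open>C / T\<close>, which for
      \<open>T > 1\<close> is dominated by the slower power.\<close>
    have "T powr ?\<alpha> \<le> T powr 1" using T by (intro powr_mono) auto
    then have CT: "C / T \<le> C / T powr ?\<alpha>" using T C(1) by (intro divide_left_mono) auto
    show "(SUP t\<in>{0..T}. sup_norm K (\<lambda>x. u t x / T + lam * (1 - t / T))) \<le> (C + E) / T powr ?\<alpha>"
    proof (intro cSUP_least sup_norm_least K_nonempty)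
      show "{0..T} \<noteq> {}" using T by simp
      fix t x assume t: "t \<in> {0..T}" and x: "x \<in> K"
      \<comment> \<open>The ergodic constant is zero, so the profile linear in \<open>t\<close>
        disappears and a bound on \<open>u t x\<close> suffices.\<close>
      have "\<bar>u t x / T + lam * (1 - t / T)\<bar> = \<bar>u t x\<bar> / T"
        using T by (simp add: ergodic_constant[OF erg])
      also have "\<dots> \<le> (C + (\<integral>s. diff_norm mbar m s \<partial>lebesgue_on {0..T})) / T"
        using C(2)[OF mild mbar t x] T by (intro divide_right_mono) auto
      also have "\<dots> = C / T + (1 / T) * (\<integral>s. diff_norm mbar m s \<partial>lebesgue_on {0..T})"
        by (simp add: add_divide_distrib)
      also have "\<dots> \<le> C / T powr ?\<alpha> + E / T powr ?\<alpha>" using CT E' by (rule add_mono)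
      also have "\<dots> = (C + E) / T powr ?\<alpha>" by (simp add: add_divide_distrib)
      finally show "\<bar>u t x / T + lam * (1 - t / T)\<bar> \<le> (C + E) / T powr ?\<alpha>" .
    qed
  qed
  moreover have "C + E > 0" using C E by simp
  ultimately show ?thesis by blast
qed

end
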